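(* Let $T>0$, let $\alpha\in[\tfrac13,1]$, and let $\omega:\mathbb{R}^+\to\mathbb{R}^+$ be a non-decreasing function with $\lim_{s\to0^+}\omega(s)=0$. Let $v_0^E\in H$ and let $v^E$ be a weak solution on $(0,T)\times\mathbb{T}^3$ of the Euler equations $$\partial_t v^E+(v^E\cdot\nabla)v^E+\nabla p^E=0,\qquad \operatorname{div} v^E=0,\qquad v^E(0,x)=v_0^E(x),$$ such that $$v^E\in L^{1/\alpha}(0,T;\dot C^{\alpha}_\omega(\mathbb{T}^3)).$$ Then $v^E$ conserves the energy, i.e. $\|v^E(t)\|=\|v^E_0\|$ for all $t\in[0,T]$.
   Context: $\mathbb{T}^3$ is the three-dimensional torus; functions on $\mathbb{T}^3$ are functions on $\mathbb{R}^3$ that are $2\pi$-periodic in each coordinate. $(\cdot,\cdot)$ and $\|\cdot\|$ denote the scalar product and norm of $L^2(\mathbb{T}^3)$. $H$ is the closure in $L^2(\mathbb{T}^3)$ of the smooth, periodic, divergence-free vector fields with zero mean value. Test functions: $\mathcal{D}_T:=\{\varphi\in C_0^\infty([0,T[\times\mathbb{T}^3):\operatorname{div}\varphi=0\}$ (vector-valued). Weak solution of the Euler equations: given $v_0^E\in H$, a measurable function $v^E:(0,T)\times\mathbb{T}^3\to\mathbb{R}^3$ is a weak solution if $v^E\in L^\infty(0,T;H)$ and $$\int_0^T\Big[(v^E,\partial_t\varphi)+(v^E\otimes v^E,\nabla\varphi)\Big]\,dt=-(v_0^E,\varphi(0))\qquad\text{for all }\varphi\in\mathcal{D}_T.$$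 As usual, $v^E$ is identified with its representative that is weakly continuous from $[0,T]$ into $L^2(\mathbb{T}^3)$, with $v^E(0)=v_0^E$, so that $v^E(t)$ is meaningful for every $t\in[0,T]$. Modified Hölder semi-norm: $[u]_{\omega,\alpha}:=\sup_{x\ne y}\frac{|u(x)-u(y)|}{\omega(|x-y|)\,|x-y|^\alpha}$, and $\dot C^\alpha_\omega(\mathbb{T}^3)$ is the space of measurable functions with $[u]_{\omega,\alpha}<\infty$. One says $u\in L^\beta(0,T;\dot C^\alpha_\omega(\mathbb{T}^3))$ if there exists $f_\alpha:[0,T]\to\mathbb{R}^+$ such that $|u(t,x)-u(t,y)|\le f_\alpha(t)\,\omega(|x-y|)\,|x-y|^\alpha$ for all $x,y\in\mathbb{T}^3$ and a.e. $t\in[0,T]$, and $\int_0^T f_\alpha^\beta(t)\,dt<\infty$. *)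

theory Defs
  imports "HOL-Analysis.Analysis"
begin

text \<open>
  Functions on the three-dimensional torus are functions on \<open>real ^ 3\<close> that are \<open>2\<pi>\<close>-periodic in
  each coordinate.  Elements of \<open>L\<^sup>2\<close> are represented by functions, not by equivalence classes;
  equality in \<open>L\<^sup>2\<close> is equality almost everywhere.
\<close>

definition periodic :: "(real^3 \<Rightarrow> 'b) \<Rightarrow> bool" where
  "periodic u \<longleftrightarrow> (\<forall>x i. u (x + axis i (2 * pi)) = u x)"

definition cell :: "(real^3) set" where
  "cell = {x. \<forall>i. 0 \<le> x $ i \<and> x $ i \<le> 2 * pi}"

definition L2_inner :: "(real^3 \<Rightarrow> 'b::real_inner) \<Rightarrow> (real^3 \<Rightarrow> 'b) \<Rightarrow> real" where
  "L2_inner u w = (LINT x|lebesgue_on cell. u x \<bullet> w x)"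

definition L2_norm :: "(real^3 \<Rightarrow> 'b::real_inner) \<Rightarrow> real" where
  "L2_norm u = sqrt (L2_inner u u)"

definition L2_torus :: "(real^3 \<Rightarrow> real^3) set" where
  "L2_torus = {u. periodic u \<and> u \<in> borel_measurable lebesgue \<and>
                  integrable (lebesgue_on cell) (\<lambda>x. (norm (u x))\<^sup>2)}"

text \<open>
  \<open>C\<^sup>k\<close> functions on a set \<open>S\<close>, with derivatives taken relative to \<open>S\<close>.  It is used only for
  \<open>S = UNIV\<close> and \<open>S = {0..<T} \<times> UNIV\<close>, where these derivatives are unique; for the latter,
  time derivatives at \<open>0\<close> are one-sided.
\<close>

primrec Ck_on :: "nat \<Rightarrow> 'a::euclidean_space set \<Rightarrow> ('a \<Rightarrow> 'b::real_normed_vector) \<Rightarrow> bool" where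
  "Ck_on 0 S f \<longleftrightarrow> continuous_on S f"
| "Ck_on (Suc k) S f \<longleftrightarrow>
     (\<exists>f'. (\<forall>x\<in>S. (f has_derivative f' x) (at x within S)) \<and>
           (\<forall>b\<in>Basis. Ck_on k S (\<lambda>x. f' x b)))"

definition smooth_on :: "'a::euclidean_space set \<Rightarrow> ('a \<Rightarrow> 'b::real_normed_vector) \<Rightarrow> bool" where
  "smooth_on S f \<longleftrightarrow> (\<forall>k. Ck_on k S f)"

definition divergence :: "(real^3 \<Rightarrow> real^3) \<Rightarrow> real^3 \<Rightarrow> real" where
  "divergence u x = trace (jacobian u (at x))"

definition smooth_solenoidal :: "(real^3 \<Rightarrow> real^3) set" where
  "smooth_solenoidal = {u. periodic u \<and> smooth_on UNIV u \<and> (\<forall>x. divergence u x = 0) \<and>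
                           (LINT x|lebesgue_on cell. u x) = 0}"

text \<open>The closure of \<open>smooth_solenoidal\<close> in \<open>L\<^sup>2\<close>.\<close>

definition H_space :: "(real^3 \<Rightarrow> real^3) set" where
  "H_space = {u \<in> L2_torus. \<forall>\<epsilon>>0. \<exists>\<psi>\<in>smooth_solenoidal. L2_norm (\<lambda>x. u x - \<psi> x) < \<epsilon>}"

text \<open>
  Divergence-free test functions with compact support in \<open>[0,T[ \<times> \<T>\<^sup>3\<close>: since the torus is
  compact, this means that they vanish for times close to \<open>T\<close>; nothing is imposed at time \<open>0\<close>.
  Values at times outside \<open>{0..<T}\<close> are irrelevant.
\<close>

definition test_functions :: "real \<Rightarrow> (real \<Rightarrow> real^3 \<Rightarrow> real^3) set" where
  "test_functions T = {\<phi>.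
     (\<forall>t\<in>{0..<T}. periodic (\<phi> t)) \<and>
     smooth_on ({0..<T} \<times> UNIV) (\<lambda>(t, x). \<phi> t x) \<and>
     (\<exists>\<tau><T. \<forall>t\<in>{0..<T}. t > \<tau> \<longrightarrow> (\<forall>x. \<phi> t x = 0)) \<and>
     (\<forall>t\<in>{0..<T}. \<forall>x. divergence (\<phi> t) x = 0)}"

definition tensor :: "real^3 \<Rightarrow> real^3 \<Rightarrow> real^3^3" where
  "tensor a b = (\<chi> i j. a $ i * b $ j)"

text \<open>
  Membership in \<open>L\<^sup>\<infinity>(0,T;H)\<close> for a jointly measurable field.
\<close>

definition Linf_H :: "real \<Rightarrow> (real \<Rightarrow> real^3 \<Rightarrow> real^3) \<Rightarrow> bool" where
  "Linf_H T v \<longleftrightarrow> (\<exists>C. AE t in lebesgue_on {0<..<T}. v t \<in> H_space \<and> L2_norm (v t) \<le> C)"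

definition euler_weak_solution ::
    "real \<Rightarrow> (real^3 \<Rightarrow> real^3) \<Rightarrow> (real \<Rightarrow> real^3 \<Rightarrow> real^3) \<Rightarrow> bool" where
  "euler_weak_solution T v0 v \<longleftrightarrow>
     (\<forall>t\<in>{0<..<T}. periodic (v t)) \<and>
     (\<lambda>(t, x). v t x) \<in> borel_measurable (lebesgue_on ({0<..<T} \<times> UNIV)) \<and>
     Linf_H T v \<and>
     (\<forall>\<phi>\<in>test_functions T.
        (LINT t|lebesgue_on {0<..<T}.
            L2_inner (v t) (\<lambda>x. vector_derivative (\<lambda>s. \<phi> s x) (at t))
          + L2_inner (\<lambda>x. tensor (v t x) (v t x)) (\<lambda>x. jacobian (\<phi> t) (at x)))
        = - L2_inner v0 (\<phi> 0))"

text \<open>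
  \<open>w\<close> is the representative of \<open>v\<close> that is weakly continuous from \<open>{0..T}\<close> into \<open>L\<^sup>2\<close> and
  takes the value \<open>v0\<close> at time \<open>0\<close>; it is determined, up to null sets in \<open>x\<close>, at every time.
\<close>

definition weakly_continuous_representative ::
    "real \<Rightarrow> (real^3 \<Rightarrow> real^3) \<Rightarrow> (real \<Rightarrow> real^3 \<Rightarrow> real^3) \<Rightarrow> (real \<Rightarrow> real^3 \<Rightarrow> real^3) \<Rightarrow> bool"
  where
  "weakly_continuous_representative T v0 v w \<longleftrightarrow>
     (AE t in lebesgue_on {0<..<T}. AE x in lebesgue. w t x = v t x) \<and>
     (\<forall>t\<in>{0..T}. w t \<in> L2_torus) \<and>
     (\<forall>g\<in>L2_torus. continuous_on {0..T} (\<lambda>t. L2_inner (w t) g)) \<and>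
     (AE x in lebesgue. w 0 x = v0 x)"

text \<open>
  Membership in \<open>L\<^sup>\<beta>(0,T; C\<^sup>\<alpha>\<^sub>\<omega>)\<close>.  The points \<open>x\<close>, \<open>y\<close> range over all of
  \<open>real ^ 3\<close>; for periodic functions and non-decreasing \<open>\<omega>\<close> this is the same as using the distance
  on the torus.
\<close>

definition Lp_Holder ::
    "real \<Rightarrow> real \<Rightarrow> (real \<Rightarrow> real) \<Rightarrow> real \<Rightarrow> (real \<Rightarrow> real^3 \<Rightarrow> real^3) \<Rightarrow> bool" where
  "Lp_Holder \<beta> T \<omega> \<alpha> v \<longleftrightarrow>
     (\<exists>f. (\<forall>t\<in>{0..T}. 0 \<le> f t) \<and>
          (AE t in lebesgue_on {0..T}. \<forall>x y.
             norm (v t x - v t y) \<le> f t * \<omega> (norm (x - y)) * norm (x - y) powr \<alpha>) \<and>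
          integrable (lebesgue_on {0..T}) (\<lambda>t. f t powr \<beta>))"

end

theory Submission
  imports Defs
begin

text \<open>
  Let \<open>K\<close> be an even non-negative kernel of mass one on the torus and consider the energy at the
  scale of \<open>K\<close>, the quadratic form \<open>E\<^sub>K(u) = \<integral>\<integral> K(x - y) u(x) \<cdot> u(y)\<close>.  Testing the equation with the
  solenoidal field \<open>K * v\<close> shows that \<open>E\<^sub>K(v(t))\<close> changes at the rate \<open>2 \<integral> v \<otimes> v : \<nabla>(K * v)\<close>, and
  expanding the cubic expression below gives, for solenoidal \<open>v\<close>, the identity of Duchon and Robert
  \<open>\<integral>\<integral> \<nabla>K(x - y) \<cdot> (v(x) - v(y)) |v(x) - v(y)|\<^sup>2 = -4 \<integral> v \<otimes> v : \<nabla>(K * v)\<close>  (\<open>flux_identity\<close>).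
  So the energy flux through the scale of \<open>K\<close> is controlled by cubes of increments.

  Put \<open>p = 1 / \<alpha>\<close>, a number in \<open>[1, 3]\<close>.  The cube of an increment \<open>d\<close> is at most
  \<open>d\<^sup>p (1 + d\<^sup>2)\<close>; the Hoelder condition turns \<open>d\<^sup>p\<close> into \<open>f(t)\<^sup>p \<omega>(|x - y|)\<^sup>p |x - y|\<close>, and \<open>d\<^sup>2\<close> is
  integrable because \<open>v(t)\<close> is square-integrable.  Since \<open>\<integral> |\<nabla>K(z)| |z|\<close> stays bounded while \<open>K\<close>
  concentrates, and \<open>\<omega>\<close> vanishes at \<open>0\<close>, the flux is at most \<open>o(1) f(t)\<^sup>p (1 + \<parallel>v(t)\<parallel>\<^sup>2)\<close>
  (\<open>flux_bound\<close>), whose time integral tends to \<open>0\<close>.  Hence \<open>E\<^sub>K(w(t)) - E\<^sub>K(v0)\<close> tends to \<open>0\<close> for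
  every \<open>t\<close> (\<open>energy_scale_limit\<close>).

  On \<open>H\<close> the energies \<open>E\<^sub>K\<close> converge to the full energy (\<open>energy_tendsto\<close>), and \<open>E\<^sub>K(u) \<le> \<parallel>u\<parallel>\<^sup>2\<close> for
  every square-integrable \<open>u\<close>.  Therefore \<open>\<parallel>w(t)\<parallel> \<ge> \<parallel>v0\<parallel>\<close> for every \<open>t\<close>, with equality whenever
  \<open>w(t)\<close> agrees with a member of \<open>H\<close>, that is for almost every \<open>t\<close>; weak continuity of \<open>w\<close> gives the
  converse inequality at the remaining times.

  The kernel is \<open>K(z) = c \<Prod> cos\<^sup>2\<^sup>m\<^sup>+\<^sup>2(z\<^sub>i / 2)\<close>, a trigonometric polynomial.  By the addition theorems
  \<open>K(x - y)\<close> is a finite sum of products \<open>a(x) b(y)\<close>.  This makes mollified fields smooth and periodic,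
  reduces all double integrals in space to products of single ones, and makes the mollification of
  \<open>w(t)\<close> depend on \<open>t\<close> only through finitely many functions, which weak continuity makes continuous.
\<close>

section \<open>The periodicity cell\<close>

lemma square_sum3_le: "(a + b + c)\<^sup>2 \<le> 3 * (a\<^sup>2 + b\<^sup>2 + c\<^sup>2 :: real)"
  using zero_le_power2[of "a - b"] zero_le_power2[of "b - c"] zero_le_power2[of "a - c"]
  by (simp add: power2_eq_square algebra_simps)

lemma cell_eq_cbox: "cell = cbox 0 (\<chi> i. 2 * pi)"
  by (auto simp: cell_def mem_box_cart)

lemma cell_lebesgue [simp, measurable]: "cell \<in> sets lebesgue"
  by (simp add: cell_eq_cbox)

abbreviation cellM :: "(real^3) measure" where "cellM \<equiv> lebesgue_on cell"

lemma finite_measure_cell: "finite_measure cellM"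
proof
  have "emeasure lborel cell < \<infinity>"
    by (simp add: cell_eq_cbox emeasure_lborel_cbox_eq)
  then show "emeasure cellM (space cellM) \<noteq> \<infinity>"
    by (simp add: emeasure_restrict_space cell_eq_cbox less_top)
qed

lemma integrable_const_cell [simp]: "integrable cellM (\<lambda>x. c :: real)"
  using finite_measure.integrable_const[OF finite_measure_cell] .

lemma integrable_mult_bounded:
  fixes f g :: "'a \<Rightarrow> real"
  assumes g: "integrable M g" and f: "f \<in> borel_measurable M" and B: "\<And>x. \<bar>f x\<bar> \<le> B"
  shows "integrable M (\<lambda>x. f x * g x)"
proof (rule Bochner_Integration.integrable_bound[where f = "\<lambda>x. B * g x"])
  show "integrable M (\<lambda>x. B * g x)"
    using g by simp
  show "(\<lambda>x. f x * g x) \<in> borel_measurable M"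
    using f borel_measurable_integrable[OF g] by measurable
  show "AE x in M. norm (f x * g x) \<le> norm (B * g x)"
    using order_trans[OF B abs_ge_self] by (auto simp: abs_mult intro!: mult_right_mono AE_I2)
qed

lemma sum_axis: "(\<Sum>j\<in>UNIV. (axis k 1 :: real^3) $ j * f j) = f k"
proof -
  have "(\<Sum>j\<in>UNIV. (axis k 1 :: real^3) $ j * f j) = (\<Sum>j\<in>UNIV. if j = k then f j else 0)"
    by (rule sum.cong) (auto simp: axis_def)
  then show ?thesis by simp
qed

section \<open>Trigonometric polynomials\<close>

text \<open>
  Real trigonometric polynomials, generated as an algebra and not as a span of exponentials: each
  property below is then an induction over sums and products.
\<close>

inductive trig_poly :: "(real^3 \<Rightarrow> real) \<Rightarrow> bool" where
  const: "trig_poly (\<lambda>x. c)"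
| cos: "trig_poly (\<lambda>x. cos (x $ i))"
| sin: "trig_poly (\<lambda>x. sin (x $ i))"
| add: "trig_poly f \<Longrightarrow> trig_poly g \<Longrightarrow> trig_poly (\<lambda>x. f x + g x)"
| mult: "trig_poly f \<Longrightarrow> trig_poly g \<Longrightarrow> trig_poly (\<lambda>x. f x * g x)"

lemma trig_poly_uminus: "trig_poly f \<Longrightarrow> trig_poly (\<lambda>x. - f x)"
  using trig_poly.mult[OF trig_poly.const[of "-1"], of f] by simp

lemma trig_poly_diff: "trig_poly f \<Longrightarrow> trig_poly g \<Longrightarrow> trig_poly (\<lambda>x. f x - g x)"
  using trig_poly.add[of f, OF _ trig_poly_uminus[of g]] by simp

lemma trig_poly_sum: "(\<And>i. i \<in> I \<Longrightarrow> trig_poly (f i)) \<Longrightarrow> trig_poly (\<lambda>x. \<Sum>i\<in>I. f i x)"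
  by (induction I rule: infinite_finite_induct) (auto intro: trig_poly.const trig_poly.add)

lemma trig_poly_prod: "(\<And>i. i \<in> I \<Longrightarrow> trig_poly (f i)) \<Longrightarrow> trig_poly (\<lambda>x. \<Prod>i\<in>I. f i x)"
  by (induction I rule: infinite_finite_induct) (auto intro: trig_poly.const trig_poly.mult)

lemma trig_poly_power: "trig_poly f \<Longrightarrow> trig_poly (\<lambda>x. f x ^ n)"
  by (induction n) (auto intro: trig_poly.const trig_poly.mult)

lemma trig_poly_divide: "trig_poly f \<Longrightarrow> trig_poly (\<lambda>x. f x / c)"
  using trig_poly.mult[OF _ trig_poly.const, of f "1/c"] by simp

lemmas trig_poly_intros = trig_poly.intros trig_poly_uminus trig_poly_diff trig_poly_sum
  trig_poly_prod trig_poly_power trig_poly_divide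

lemma trig_poly_continuous: "trig_poly f \<Longrightarrow> continuous_on S f"
  by (induction rule: trig_poly.induct) (auto intro!: continuous_intros)

lemma trig_poly_bounded: "trig_poly f \<Longrightarrow> \<exists>B. \<forall>x. \<bar>f x\<bar> \<le> B"
proof (induction rule: trig_poly.induct)
  case (cos i) then show ?case by (auto intro!: exI[of _ 1])
next
  case (sin i) then show ?case by (auto intro!: exI[of _ 1])
next
  case (add f g)
  then obtain B C where "\<And>x. \<bar>f x\<bar> \<le> B" "\<And>x. \<bar>g x\<bar> \<le> C" by blast
  then show ?case by (intro exI[of _ "B + C"]) (metis abs_triangle_ineq add_mono order_trans)
next
  case (mult f g)
  then obtain B C where "\<And>x. \<bar>f x\<bar> \<le> B" "\<And>x. \<bar>g x\<bar> \<le> C" by blast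
  then show ?case
    by (intro exI[of _ "B * C"]) (auto simp: abs_mult intro!: mult_mono intro: order_trans[OF abs_ge_zero])
qed auto

lemma trig_poly_periodic: "trig_poly f \<Longrightarrow> periodic f"
proof (induction rule: trig_poly.induct)
  case (cos i)
  have "cos ((x + axis j (2 * pi)) $ i) = cos (x $ i)" for x :: "real^3" and j
    by (cases "i = j") (auto simp: axis_def)
  then show ?case by (simp only: periodic_def) simp
next
  case (sin i)
  have "sin ((x + axis j (2 * pi)) $ i) = sin (x $ i)" for x :: "real^3" and j
    by (cases "i = j") (auto simp: axis_def)
  then show ?case by (simp only: periodic_def) simp
qed (auto simp: periodic_def)

lemma trig_poly_measurable [measurable_dest]:
  "trig_poly f \<Longrightarrow> f \<in> borel_measurable borel"
  by (intro borel_measurable_continuous_onI trig_poly_continuous)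

lemma trig_poly_measurable_lebesgue: "trig_poly f \<Longrightarrow> f \<in> borel_measurable lebesgue"
  using trig_poly_measurable by (intro measurable_completion) simp

lemma trig_poly_measurable_cell: "trig_poly f \<Longrightarrow> f \<in> borel_measurable cellM"
  by (intro measurable_restrict_space1 trig_poly_measurable_lebesgue)

lemma trig_poly_mult_integrable:
  "trig_poly f \<Longrightarrow> integrable cellM g \<Longrightarrow> integrable cellM (\<lambda>x. f x * g x)"
  using trig_poly_bounded trig_poly_measurable_cell by (blast intro: integrable_mult_bounded)

lemma trig_poly_has_derivative:
  "trig_poly f \<Longrightarrow> \<exists>f'. (\<forall>x. (f has_derivative f' x) (at x)) \<and> (\<forall>h. trig_poly (\<lambda>x. f' x h))"
proof (induction rule: trig_poly.induct)
  case (const c)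
  then show ?case
    by (intro exI[of _ "\<lambda>x h. 0"]) (auto intro: trig_poly.const)
next
  case (cos i)
  have "((\<lambda>x. cos (x $ i)) has_derivative (\<lambda>h. - sin (x $ i) * h $ i)) (at x)" for x :: "real^3"
    by (auto intro!: derivative_eq_intros bounded_linear_imp_has_derivative bounded_linear_vec_nth)
  then show ?case
    by (intro exI[of _ "\<lambda>x h. - sin (x $ i) * h $ i"]) (auto intro!: trig_poly_intros)
next
  case (sin i)
  have "((\<lambda>x. sin (x $ i)) has_derivative (\<lambda>h. cos (x $ i) * h $ i)) (at x)" for x :: "real^3"
    by (auto intro!: derivative_eq_intros bounded_linear_imp_has_derivative bounded_linear_vec_nth)
  then show ?case
    by (intro exI[of _ "\<lambda>x h. cos (x $ i) * h $ i"]) (auto intro!: trig_poly_intros)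
next
  case (add f g)
  then obtain f' g' where "\<And>x. (f has_derivative f' x) (at x)" "\<And>h. trig_poly (\<lambda>x. f' x h)"
    "\<And>x. (g has_derivative g' x) (at x)" "\<And>h. trig_poly (\<lambda>x. g' x h)" by blast
  then show ?case
    by (intro exI[of _ "\<lambda>x h. f' x h + g' x h"]) (auto intro: trig_poly.add has_derivative_add)
next
  case (mult f g)
  then obtain f' g' where "\<And>x. (f has_derivative f' x) (at x)" "\<And>h. trig_poly (\<lambda>x. f' x h)"
    "\<And>x. (g has_derivative g' x) (at x)" "\<And>h. trig_poly (\<lambda>x. g' x h)" by blast
  then show ?case
    by (intro exI[of _ "\<lambda>x h. f x * g' x h + f' x h * g x"])
       (auto intro!: trig_poly.add trig_poly.mult has_derivative_mult mult.hyps)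
qed

section \<open>Degenerate kernels\<close>

text \<open>
  The degenerate kernels of the theory of integral equations.  The predicates \<open>A\<close> and \<open>B\<close> say which
  functions may occur as left and as right factors.
\<close>

inductive degenerate ::
  "(('a \<Rightarrow> real) \<Rightarrow> bool) \<Rightarrow> (('a \<Rightarrow> real) \<Rightarrow> bool) \<Rightarrow> ('a \<Rightarrow> 'a \<Rightarrow> real) \<Rightarrow> bool" for A B where
  prod: "A a \<Longrightarrow> B b \<Longrightarrow> degenerate A B (\<lambda>x y. a x * b y)"
| add: "degenerate A B F \<Longrightarrow> degenerate A B G \<Longrightarrow> degenerate A B (\<lambda>x y. F x y + G x y)"

definition trig_module :: "((real^3 \<Rightarrow> real) \<Rightarrow> bool) \<Rightarrow> bool" where
  "trig_module A \<longleftrightarrow> (\<forall>f a. trig_poly f \<longrightarrow> A a \<longrightarrow> A (\<lambda>x. f x * a x))"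

lemma trig_module_trig_poly: "trig_module trig_poly"
  by (auto simp: trig_module_def intro: trig_poly.mult)

lemma trig_module_integrable: "trig_module (integrable cellM)"
  by (auto simp: trig_module_def intro: trig_poly_mult_integrable)

lemma degenerate_mult_prod:
  assumes "trig_module A" "trig_module B" "trig_poly f" "trig_poly g" "degenerate A B F"
  shows "degenerate A B (\<lambda>x y. f x * g y * F x y)"
  using assms(5)
proof (induction rule: degenerate.induct)
  case (prod a b)
  have "(\<lambda>x y. f x * g y * (a x * b y)) = (\<lambda>x y. (f x * a x) * (g y * b y))"
    by (simp add: mult_ac)
  moreover have "degenerate A B (\<lambda>x y. (f x * a x) * (g y * b y))"
    using assms prod by (intro degenerate.prod) (auto simp: trig_module_def)
  ultimately show ?case by simp
next
  case (add F G)
  then show ?case by (simp add: distrib_left degenerate.add)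
qed

text \<open>
  The addition theorems of sine and cosine separate the variables of \<open>f (x - y)\<close>; products are
  absorbed one factor at a time.
\<close>

lemma degenerate_trig_mult:
  assumes AB: "trig_module A" "trig_module B" and f: "trig_poly f" and F: "degenerate A B F"
  shows "degenerate A B (\<lambda>x y. f (x - y) * F x y)"
  using f F
proof (induction arbitrary: F rule: trig_poly.induct)
  case (const c)
  then show ?case
    using degenerate_mult_prod[OF AB trig_poly.const[of c] trig_poly.const[of 1]] by simp
next
  case (cos i)
  have "degenerate A B (\<lambda>x y. cos (x $ i) * cos (y $ i) * F x y + sin (x $ i) * sin (y $ i) * F x y)"
    using cos by (intro degenerate.add degenerate_mult_prod AB trig_poly_intros)
  then show ?case
    by (simp add: cos_diff distrib_right)
next
  case (sin i)
  have "degenerate A B (\<lambda>x y. sin (x $ i) * cos (y $ i) * F x y + cos (x $ i) * (- sin (y $ i)) * F x y)"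
    using sin by (intro degenerate.add degenerate_mult_prod AB trig_poly_intros)
  then show ?case
    by (simp add: sin_diff distrib_right left_diff_distrib)
next
  case (add f g)
  then show ?case by (simp add: distrib_right degenerate.add)
next
  case (mult f g)
  then have "degenerate A B (\<lambda>x y. f (x - y) * (g (x - y) * F x y))" by blast
  then show ?case by (simp add: mult.assoc)
qed

abbreviation deg_int :: "(real^3 \<Rightarrow> real^3 \<Rightarrow> real) \<Rightarrow> bool" where
  "deg_int \<equiv> degenerate (integrable cellM) (integrable cellM)"

definition dbl :: "(real^3 \<Rightarrow> real^3 \<Rightarrow> real) \<Rightarrow> real" where
  "dbl F = (LINT x|cellM. LINT y|cellM. F x y)"

lemma deg_int_trig:
  "trig_poly f \<Longrightarrow> integrable cellM P \<Longrightarrow> integrable cellM R \<Longrightarrow>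
    deg_int (\<lambda>x y. f (x - y) * (P x * R y))"
  by (intro degenerate_trig_mult trig_module_integrable degenerate.prod)

lemma deg_int_cmult: assumes "deg_int F" shows "deg_int (\<lambda>x y. c * F x y)"
  using degenerate_mult_prod[OF trig_module_integrable trig_module_integrable
      trig_poly.const[of c] trig_poly.const[of 1] assms] by simp

lemma deg_int_diff: "deg_int F \<Longrightarrow> deg_int G \<Longrightarrow> deg_int (\<lambda>x y. F x y - G x y)"
  using degenerate.add[OF _ deg_int_cmult[of G "-1"]] by simp

lemma deg_int_sum: "finite I \<Longrightarrow> (\<And>i. i \<in> I \<Longrightarrow> deg_int (F i)) \<Longrightarrow> deg_int (\<lambda>x y. \<Sum>i\<in>I. F i x y)"
proof (induction I rule: finite_induct)
  case empty
  show ?case using deg_int_trig[OF trig_poly.const[of 0], of "\<lambda>_. 0" "\<lambda>_. 0"] by simp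
qed (simp add: degenerate.add)

lemma deg_int_integrable_inner: "deg_int F \<Longrightarrow> integrable cellM (\<lambda>y. F x y)"
  by (induction rule: degenerate.induct) auto

lemma deg_int_integrable_outer: "deg_int F \<Longrightarrow> integrable cellM (\<lambda>x. LINT y|cellM. F x y)"
  by (induction rule: degenerate.induct) (auto simp: deg_int_integrable_inner)

lemma dbl_add: "deg_int F \<Longrightarrow> deg_int G \<Longrightarrow> dbl (\<lambda>x y. F x y + G x y) = dbl F + dbl G"
  by (simp add: dbl_def deg_int_integrable_inner deg_int_integrable_outer)

lemma dbl_diff: "deg_int F \<Longrightarrow> deg_int G \<Longrightarrow> dbl (\<lambda>x y. F x y - G x y) = dbl F - dbl G"
  by (simp add: dbl_def deg_int_integrable_inner deg_int_integrable_outer)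

lemma dbl_cmult: "dbl (\<lambda>x y. c * F x y) = c * dbl F"
  by (simp add: dbl_def)

lemma dbl_sum: "finite I \<Longrightarrow> (\<And>i. i \<in> I \<Longrightarrow> deg_int (F i)) \<Longrightarrow> dbl (\<lambda>x y. \<Sum>i\<in>I. F i x y) = (\<Sum>i\<in>I. dbl (F i))"
  by (simp add: dbl_def deg_int_integrable_inner deg_int_integrable_outer)

lemma dbl_mono:
  assumes "deg_int F" "deg_int G" "\<And>x y. x \<in> cell \<Longrightarrow> y \<in> cell \<Longrightarrow> F x y \<le> G x y"
  shows "dbl F \<le> dbl G"
  unfolding dbl_def using assms
  by (intro integral_mono deg_int_integrable_inner deg_int_integrable_outer) auto

lemma dbl_prod: "dbl (\<lambda>x y. a x * b y) = (LINT x|cellM. a x) * (LINT y|cellM. b y)"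
  by (simp add: dbl_def)

text \<open>
  A degenerate double integral is a sum of products of single integrals, so the order of integration
  is irrelevant without any appeal to Fubini's theorem.
\<close>

lemma dbl_swap: "deg_int F \<Longrightarrow> deg_int (\<lambda>x y. F y x) \<and> dbl (\<lambda>x y. F y x) = dbl F"
proof (induction rule: degenerate.induct)
  case (prod a b)
  then show ?case
    using degenerate.prod[of "integrable cellM" b "integrable cellM" a] dbl_prod[of b a] dbl_prod[of a b]
    by (simp add: mult.commute)
next
  case (add F G)
  then show ?case by (simp add: degenerate.add dbl_add)
qed

lemma degenerate_integral_trig_poly:
  "degenerate trig_poly (integrable cellM) F \<Longrightarrow>
    (\<forall>x. integrable cellM (F x)) \<and> trig_poly (\<lambda>x. LINT y|cellM. F x y)"
  by (induction rule: degenerate.induct) (auto intro: trig_poly_intros)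

text \<open>
  Only the left factors are differentiated, so no limit has to be taken under the integral sign.
\<close>

lemma degenerate_integral_has_derivative:
  "degenerate trig_poly (integrable cellM) F \<Longrightarrow>
    \<exists>F'. (\<forall>x y. ((\<lambda>x. F x y) has_derivative F' x y) (at x)) \<and>
      (\<forall>x h. integrable cellM (\<lambda>y. F' x y h)) \<and>
      (\<forall>x. ((\<lambda>x. LINT y|cellM. F x y) has_derivative (\<lambda>h. LINT y|cellM. F' x y h)) (at x))"
proof (induction rule: degenerate.induct)
  case (prod a b)
  then obtain a' where "\<And>x. (a has_derivative a' x) (at x)" "\<And>h. trig_poly (\<lambda>x. a' x h)"
    using trig_poly_has_derivative by blast
  then show ?case
    using prod by (intro exI[of _ "\<lambda>x y h. a' x h * b y"]) (auto intro!: has_derivative_mult_left)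
next
  case (add F G)
  then obtain F' G' where
    "\<And>x y. ((\<lambda>x. F x y) has_derivative F' x y) (at x)" "\<And>x h. integrable cellM (\<lambda>y. F' x y h)"
    "\<And>x. ((\<lambda>x. LINT y|cellM. F x y) has_derivative (\<lambda>h. LINT y|cellM. F' x y h)) (at x)"
    "\<And>x y. ((\<lambda>x. G x y) has_derivative G' x y) (at x)" "\<And>x h. integrable cellM (\<lambda>y. G' x y h)"
    "\<And>x. ((\<lambda>x. LINT y|cellM. G x y) has_derivative (\<lambda>h. LINT y|cellM. G' x y h)) (at x)"
    by blast
  moreover have "integrable cellM (F x)" "integrable cellM (G x)" for x
    using add.hyps degenerate_integral_trig_poly by blast+
  ultimately show ?case
    by (intro exI[of _ "\<lambda>x y h. F' x y h + G' x y h"]) (auto intro!: has_derivative_add)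
qed

definition conv :: "(real^3 \<Rightarrow> real) \<Rightarrow> (real^3 \<Rightarrow> real) \<Rightarrow> real^3 \<Rightarrow> real" where
  "conv f r x = (LINT y|cellM. f (x - y) * r y)"

lemma degenerate_conv:
  assumes "trig_poly f" "integrable cellM r"
  shows "degenerate trig_poly (integrable cellM) (\<lambda>x y. f (x - y) * r y)"
  using degenerate_trig_mult[OF trig_module_trig_poly trig_module_integrable assms(1)
      degenerate.prod[of trig_poly "\<lambda>_. 1" _ r]] assms
  by (simp add: trig_poly.const)

lemma conv_trig_poly: "trig_poly f \<Longrightarrow> integrable cellM r \<Longrightarrow> trig_poly (conv f r)"
  using degenerate_integral_trig_poly[OF degenerate_conv] unfolding conv_def[abs_def] by blast

lemma conv_integrable: "trig_poly f \<Longrightarrow> integrable cellM r \<Longrightarrow> integrable cellM (\<lambda>y. f (x - y) * r y)"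
  using degenerate_integral_trig_poly[OF degenerate_conv] by blast

text \<open>
  The degenerate form of the kernel yields some derivative under the integral; it is the expected
  one because derivatives are unique.
\<close>

lemma conv_has_derivative:
  assumes f: "trig_poly f" and r: "integrable cellM r"
    and f': "\<And>x. (f has_derivative f' x) (at x)"
  shows "(conv f r has_derivative (\<lambda>h. conv (\<lambda>z. f' z h) r x)) (at x)"
proof -
  obtain F' where F': "\<And>x y. ((\<lambda>x. f (x - y) * r y) has_derivative F' x y) (at x)"
    "\<And>x. ((\<lambda>x. LINT y|cellM. f (x - y) * r y) has_derivative (\<lambda>h. LINT y|cellM. F' x y h)) (at x)"
    using degenerate_integral_has_derivative[OF degenerate_conv[OF f r]] by blast
  have "F' x y = (\<lambda>h. f' (x - y) h * r y)" for x y
  proof (rule has_derivative_unique[OF F'(1)])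
    have "((\<lambda>x. f (x - y)) has_derivative f' (x - y)) (at x)"
      using has_derivative_compose[of "\<lambda>x. x - y" "\<lambda>h. h" x UNIV f "f' (x - y)"] f'
        has_derivative_diff[OF has_derivative_ident has_derivative_const, of y "at x"] by simp
    then show "((\<lambda>x. f (x - y) * r y) has_derivative (\<lambda>h. f' (x - y) h * r y)) (at x)"
      by (rule has_derivative_mult_left)
  qed
  then show ?thesis
    using F'(2)[of x] unfolding conv_def by simp
qed

section \<open>A trigonometric approximate identity\<close>

text \<open>
  This is \<open>cos\<^sup>2(s / 2)\<close>.
\<close>

definition hcos :: "real \<Rightarrow> real" where
  "hcos s = (1 + cos s) / 2"

lemma hcos_nonneg [simp]: "0 \<le> hcos s" and hcos_le_1 [simp]: "hcos s \<le> 1"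
proof -
  have "0 \<le> 1 + cos s" "1 + cos s \<le> 2"
    using cos_ge_minus_one[of s] cos_le_one[of s] by linarith+
  then show "0 \<le> hcos s" "hcos s \<le> 1" by (simp_all add: hcos_def)
qed

lemma hcos_minus [simp]: "hcos (- s) = hcos s"
  by (simp add: hcos_def)

lemma cos_eq_hcos: "cos s = 2 * hcos s - 1"
  by (simp add: hcos_def field_simps)

lemma hcos_continuous [continuous_intros]:
  assumes "continuous_on S f" shows "continuous_on S (\<lambda>x. hcos (f x))"
proof -
  have "continuous_on UNIV hcos"
    unfolding hcos_def[abs_def] by (auto intro!: continuous_intros)
  then show ?thesis
    using assms by (rule continuous_on_compose2) auto
qed

lemma sin_squared_hcos: "(sin s)\<^sup>2 = 4 * hcos s * (1 - hcos s)"
  unfolding sin_squared_eq cos_eq_hcos by (simp add: power2_eq_square algebra_simps)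

text \<open>
  The integrals of the powers of \<open>hcos\<close> over a period, defined by Wallis' recurrence because only
  ratios of consecutive values matter later.
\<close>

primrec wallis :: "nat \<Rightarrow> real" where
  "wallis 0 = 2 * pi"
| "wallis (Suc n) = (2 * real n + 1) / (2 * real n + 2) * wallis n"

lemma wallis_pos: "0 < wallis n"
  by (induction n) (auto intro!: mult_pos_pos divide_pos_pos)

text \<open>
  Integrating the derivative of \<open>- sin (x - y) hcos\<^sup>n(x - y)\<close> over a period gives the recurrence.
  Stating the claim for every translate \<open>x\<close> costs nothing, since the initial value does not see \<open>x\<close>;
  it replaces the invariance of integrals over a period under translations.
\<close>

lemma hcos_power_has_integral:
  "((\<lambda>y. hcos (x - y) ^ n) has_integral wallis n) {0..2 * pi}"
proof (induction n)
  case 0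
  show ?case using has_integral_const_real[of "1::real" 0 "2 * pi"] by simp
next
  case (Suc n)
  let ?F = "\<lambda>y. - sin (x - y) * hcos (x - y) ^ n"
  let ?f = "\<lambda>y. (2 * real n + 2) * hcos (x - y) ^ Suc n - (2 * real n + 1) * hcos (x - y) ^ n"
  have d: "(?F has_vector_derivative ?f y) (at y within S)" for y S
  proof -
    have "(?F has_real_derivative cos (x - y) * hcos (x - y) ^ n
        - sin (x - y) * (real n * hcos (x - y) ^ (n - 1) * (sin (x - y) / 2))) (at y within S)"
      unfolding hcos_def by (auto intro!: derivative_eq_intros)
    moreover have "cos (x - y) * hcos (x - y) ^ n
        - sin (x - y) * (real n * hcos (x - y) ^ (n - 1) * (sin (x - y) / 2)) = ?f y"
    proof -
      have "sin (x - y) * (real n * hcos (x - y) ^ (n - 1) * (sin (x - y) / 2))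
          = real n * (sin (x - y))\<^sup>2 * hcos (x - y) ^ (n - 1) / 2"
        by (simp add: power2_eq_square)
      also have "\<dots> = 2 * real n * (1 - hcos (x - y)) * (hcos (x - y) * hcos (x - y) ^ (n - 1))"
        by (simp add: sin_squared_hcos)
      also have "\<dots> = 2 * real n * (1 - hcos (x - y)) * hcos (x - y) ^ n"
        by (cases n) simp_all
      finally have "sin (x - y) * (real n * hcos (x - y) ^ (n - 1) * (sin (x - y) / 2))
        = 2 * real n * (1 - hcos (x - y)) * hcos (x - y) ^ n" .
      then show ?thesis
        by (simp only: cos_eq_hcos) (simp add: algebra_simps)
    qed
    ultimately show ?thesis
      by (simp add: has_real_derivative_iff_has_vector_derivative)
  qed
  have "(?f has_integral (?F (2 * pi) - ?F 0)) {0..2 * pi}"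
    by (rule fundamental_theorem_of_calculus) (use pi_ge_zero d in \<open>simp_all only:, linarith?\<close>)
  moreover have "?F (2 * pi) - ?F 0 = 0"
    by (simp add: hcos_def sin_diff cos_diff)
  ultimately have "(?f has_integral 0) {0..2 * pi}" by simp
  from has_integral_add[OF this has_integral_mult_right[OF Suc.IH, of "2 * real n + 1"]]
  have "((\<lambda>y. (2 * real n + 2) * hcos (x - y) ^ Suc n) has_integral (2 * real n + 1) * wallis n) {0..2 * pi}"
    by simp
  from has_integral_mult_right[OF this, of "1 / (2 * real n + 2)"]
  have "((\<lambda>y. 1 / (2 * real n + 2) * ((2 * real n + 2) * hcos (x - y) ^ Suc n)) has_integral wallis (Suc n)) {0..2 * pi}"
    by simp
  moreover have "1 / (2 * real n + 2) * ((2 * real n + 2) * c) = c" for c :: real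
    by (simp add: field_simps)
  ultimately show ?case
    by (simp only:)
qed

text \<open>
  Tonelli's theorem for products of functions of one coordinate.
\<close>

lemma integral_cell_prod:
  fixes f :: "3 \<Rightarrow> real \<Rightarrow> real"
  assumes cont: "\<And>i. continuous_on UNIV (f i)" and nn: "\<And>i s. 0 \<le> f i s"
    and int: "\<And>i. (f i has_integral c i) {0..2 * pi}"
  shows "(LINT x|cellM. (\<Prod>i\<in>UNIV. f i (x $ i))) = (\<Prod>i\<in>UNIV. c i)"
proof -
  let ?g = "\<lambda>x::real^3. \<Prod>i\<in>UNIV. f i (x $ i)"
  have f_meas [measurable]: "f i \<in> borel_measurable borel" for i
    using cont by (intro borel_measurable_continuous_onI)
  have "continuous_on UNIV (\<lambda>x::real^3. f i (x $ i))" for i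
    by (rule continuous_on_compose2[OF cont]) (auto intro!: continuous_intros)
  then have g_cont: "continuous_on UNIV ?g"
    by (rule continuous_on_prod)
  then have g_meas [measurable]: "?g \<in> borel_measurable borel"
    by (intro borel_measurable_continuous_onI)
  have c_nn: "0 \<le> c i" for i
    using has_integral_nonneg[OF int] nn by blast
  define idx where "idx b = (THE i. b = (axis i 1 :: real^3))" for b
  have idx: "idx (axis i 1) = i" for i
    unfolding idx_def by (rule the_equality) (auto simp: axis_eq_axis)
  have prod_Basis: "(\<Prod>b\<in>Basis. h (idx b) (x \<bullet> b)) = (\<Prod>i\<in>UNIV. h i (x $ i))"
    for h :: "3 \<Rightarrow> real \<Rightarrow> 'c::comm_monoid_mult" and x :: "real^3"
  proof -
    have B: "(Basis :: (real^3) set) = range (\<lambda>i. axis i 1)"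
      by (auto simp: Basis_vec_def)
    have "inj (\<lambda>i::3. axis i (1::real))"
      by (auto simp: inj_def axis_eq_axis)
    then show ?thesis
      unfolding B by (simp add: prod.reindex idx inner_axis)
  qed
  have "(\<integral>\<^sup>+x. ennreal (?g x) \<partial>cellM) = (\<integral>\<^sup>+x. ennreal (?g x) * indicator cell x \<partial>lborel)"
    by (simp add: nn_integral_restrict_space nn_integral_completion)
  also have "\<dots> = (\<integral>\<^sup>+x. (\<Prod>i\<in>UNIV. ennreal (f i (x $ i)) * indicator {0..2 * pi} (x $ i)) \<partial>lborel)"
  proof (intro nn_integral_cong)
    fix x :: "real^3"
    have "indicator cell x = (\<Prod>i\<in>UNIV. indicator {0..2 * pi} (x $ i) :: ennreal)"
    proof (cases "x \<in> cell")
      case True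
      then show ?thesis by (auto simp: cell_def)
    next
      case False
      then obtain i where "x $ i \<notin> {0..2 * pi}" by (auto simp: cell_def)
      then show ?thesis using False 
        by (subst prod_zero) (auto intro!: bexI[of _ i] simp: indicator_def)
    qed
    then show "ennreal (?g x) * indicator cell x =
        (\<Prod>i\<in>UNIV. ennreal (f i (x $ i)) * indicator {0..2 * pi} (x $ i))"
      by (simp add: prod.distrib prod_ennreal nn)
  qed
  also have "\<dots> = (\<integral>\<^sup>+x. (\<Prod>b\<in>Basis. ennreal (f (idx b) (x \<bullet> b)) * indicator {0..2 * pi} (x \<bullet> b)) \<partial>lborel)"
    using prod_Basis[of "\<lambda>i s. ennreal (f i s) * indicator {0..2 * pi} s"] by simp
  also have "\<dots> = (\<Prod>b\<in>Basis. (\<integral>\<^sup>+s. ennreal (f (idx b) s) * indicator {0..2 * pi} s \<partial>lborel))"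
    by (rule nn_integral_lborel_prod) auto
  also have "\<dots> = (\<Prod>b\<in>Basis. ennreal (c (idx b)))"
    by (intro prod.cong refl nn_integral_has_integral_lebesgue' int) (auto simp: nn)
  also have "\<dots> = (\<Prod>i\<in>UNIV. ennreal (c i))"
    using prod_Basis[of "\<lambda>i s. ennreal (c i)" 0] by simp
  also have "\<dots> = ennreal (\<Prod>i\<in>UNIV. c i)"
    by (simp add: prod_ennreal c_nn)
  finally have nn_int: "(\<integral>\<^sup>+x. ennreal (?g x) \<partial>cellM) = ennreal (\<Prod>i\<in>UNIV. c i)" .
  have "(LINT x|cellM. ?g x) = enn2real (\<integral>\<^sup>+x. ennreal (?g x) \<partial>cellM)"
  proof (rule integral_eq_nn_integral)
    show "?g \<in> borel_measurable cellM"
      by (intro measurable_restrict_space1 measurable_completion) simp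
  qed (auto intro!: prod_nonneg nn)
  then show ?thesis
    using nn_int by (simp add: prod_nonneg c_nn)
qed

definition hprod :: "nat \<Rightarrow> real^3 \<Rightarrow> real" where
  "hprod m z = (\<Prod>i\<in>UNIV. hcos (z $ i) ^ m)"

lemma trig_poly_hcos: "trig_poly (\<lambda>z. hcos (z $ i))"
  unfolding hcos_def by (intro trig_poly_intros)

lemma trig_poly_hprod: "trig_poly (hprod m)"
  unfolding hprod_def[abs_def] by (intro trig_poly_intros trig_poly_hcos)

lemma hprod_nonneg [simp]: "0 \<le> hprod m z"
  by (auto simp: hprod_def intro!: prod_nonneg)

lemma hcos_moment_has_integral:
  "((\<lambda>y. hcos (x - y) ^ m * (1 - hcos (x - y))) has_integral wallis m / (2 * real m + 2)) {0..2 * pi}"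
  "((\<lambda>y. hcos (x - y) ^ m * (1 - hcos (x - y))\<^sup>2) has_integral
      3 * wallis m / ((2 * real m + 2) * (2 * real m + 4))) {0..2 * pi}"
proof -
  have "((\<lambda>y. hcos (x - y) ^ m - hcos (x - y) ^ Suc m) has_integral wallis m - wallis (Suc m)) {0..2 * pi}"
    by (intro has_integral_diff hcos_power_has_integral)
  moreover have "wallis m - wallis (Suc m) = wallis m / (2 * real m + 2)"
    by (simp add: field_simps)
  moreover have "(\<lambda>y. hcos (x - y) ^ m - hcos (x - y) ^ Suc m) = (\<lambda>y. hcos (x - y) ^ m * (1 - hcos (x - y)))"
    by (auto simp: algebra_simps)
  ultimately show "((\<lambda>y. hcos (x - y) ^ m * (1 - hcos (x - y))) has_integral wallis m / (2 * real m + 2)) {0..2 * pi}"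
    by (simp only:)
  have "((\<lambda>y. hcos (x - y) ^ m - 2 * hcos (x - y) ^ Suc m + hcos (x - y) ^ Suc (Suc m)) has_integral
      wallis m - 2 * wallis (Suc m) + wallis (Suc (Suc m))) {0..2 * pi}"
    by (intro has_integral_add has_integral_diff has_integral_mult_right hcos_power_has_integral)
  moreover have "wallis m - 2 * wallis (Suc m) + wallis (Suc (Suc m))
      = 3 * wallis m / ((2 * real m + 2) * (2 * real m + 4))"
  proof -
    have "2 * real m + 2 \<noteq> 0" "2 * real m + 4 \<noteq> 0" by linarith+
    then show ?thesis by (simp add: divide_simps) (simp add: algebra_simps)
  qed
  moreover have "(\<lambda>y. hcos (x - y) ^ m - 2 * hcos (x - y) ^ Suc m + hcos (x - y) ^ Suc (Suc m))
      = (\<lambda>y. hcos (x - y) ^ m * (1 - hcos (x - y))\<^sup>2)"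
    by (auto simp: power2_eq_square algebra_simps)
  ultimately show "((\<lambda>y. hcos (x - y) ^ m * (1 - hcos (x - y))\<^sup>2) has_integral
      3 * wallis m / ((2 * real m + 2) * (2 * real m + 4))) {0..2 * pi}"
    by (simp only:)
qed

lemma integral_hprod: "(LINT y|cellM. hprod m (x - y)) = wallis m ^ 3"
proof -
  have "(LINT y|cellM. (\<Prod>i\<in>UNIV. hcos (x $ i - y $ i) ^ m)) = (\<Prod>i\<in>(UNIV::3 set). wallis m)"
    by (rule integral_cell_prod) (auto intro!: continuous_intros hcos_power_has_integral)
  then show ?thesis by (simp add: hprod_def)
qed

lemma prod_one_factor:
  fixes f g :: "3 \<Rightarrow> real"
  shows "(\<Prod>i\<in>UNIV. if i = k then f i * g i else f i) = (\<Prod>i\<in>UNIV. f i) * g k"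
  by (simp add: prod.remove[of UNIV k])

lemma integral_hprod_moment:
  "(LINT y|cellM. hprod m (x - y) * (1 - hcos (x $ k - y $ k))) = wallis m ^ 3 / (2 * real m + 2)"
  "(LINT y|cellM. hprod m (x - y) * (1 - hcos (x $ k - y $ k))\<^sup>2)
    = 3 * wallis m ^ 3 / ((2 * real m + 2) * (2 * real m + 4))"
proof -
  have gen: "(LINT y|cellM. hprod m (x - y) * g (x $ k - y $ k)) = wallis m ^ 2 * c"
    if g: "((\<lambda>y. hcos (x $ k - y) ^ m * g (x $ k - y)) has_integral c) {0..2 * pi}"
      and nn: "\<And>s. 0 \<le> g s" and cont: "continuous_on UNIV g" for g c
  proof -
    let ?f = "\<lambda>i s. if i = k then hcos (x $ i - s) ^ m * g (x $ i - s) else hcos (x $ i - s) ^ m"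
    have "(LINT y|cellM. (\<Prod>i\<in>UNIV. ?f i (y $ i))) = (\<Prod>i\<in>UNIV. if i = k then c else wallis m)"
    proof (rule integral_cell_prod)
      fix i
      show "continuous_on UNIV (?f i)"
        by (cases "i = k") (auto intro!: continuous_intros continuous_on_compose2[OF cont])
      show "0 \<le> ?f i s" for s
        by (simp add: nn)
      show "(?f i has_integral (if i = k then c else wallis m)) {0..2 * pi}"
        using g by (cases "i = k") (auto intro: hcos_power_has_integral)
    qed
    moreover have "(\<Prod>i\<in>(UNIV::3 set). if i = k then c else wallis m) = wallis m ^ 2 * c"
      by (simp add: prod.remove[of UNIV k])
    moreover have "(\<Prod>i\<in>UNIV. ?f i (y $ i)) = hprod m (x - y) * g (x $ k - y $ k)" for y
      by (simp add: prod_one_factor hprod_def)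
    ultimately show ?thesis by simp
  qed
  show "(LINT y|cellM. hprod m (x - y) * (1 - hcos (x $ k - y $ k))) = wallis m ^ 3 / (2 * real m + 2)"
    by (subst gen[OF hcos_moment_has_integral(1)])
       (auto intro!: continuous_intros simp: power2_eq_square power3_eq_cube)
  show "(LINT y|cellM. hprod m (x - y) * (1 - hcos (x $ k - y $ k))\<^sup>2)
    = 3 * wallis m ^ 3 / ((2 * real m + 2) * (2 * real m + 4))"
    by (subst gen[OF hcos_moment_has_integral(2)])
       (auto intro!: continuous_intros simp: power2_eq_square power3_eq_cube)
qed

text \<open>
  An approximate identity of width about \<open>m\<^sup>-\<^sup>1\<^sup>/\<^sup>2\<close>.  The exponent is \<open>Suc m\<close> so that a derivative still
  carries the power \<open>m\<close> of every factor.
\<close>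

definition kern :: "nat \<Rightarrow> real^3 \<Rightarrow> real" where
  "kern m z = hprod (Suc m) z / wallis (Suc m) ^ 3"

text \<open>
  The partial derivative of \<open>kern m\<close> in direction \<open>j\<close>.
\<close>

definition dkern :: "nat \<Rightarrow> 3 \<Rightarrow> real^3 \<Rightarrow> real" where
  "dkern m j z = - (real (Suc m) / 2 * sin (z $ j) * hcos (z $ j) ^ m
      * (\<Prod>i\<in>UNIV - {j}. hcos (z $ i) ^ Suc m)) / wallis (Suc m) ^ 3"

text \<open>
  The value \<open>\<Sum> sin\<^sup>2(z\<^sub>i / 2)\<close>, which is comparable to the squared distance of \<open>z\<close> to the lattice
  \<open>2\<pi>\<int>\<^sup>3\<close> and, unlike it, is a trigonometric polynomial.
\<close>

definition tdist2 :: "real^3 \<Rightarrow> real" where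
  "tdist2 z = (\<Sum>i\<in>UNIV. 1 - hcos (z $ i))"

lemma tdist2_nonneg [simp]: "0 \<le> tdist2 z"
  by (auto simp: tdist2_def intro!: sum_nonneg)

lemma trig_poly_kern: "trig_poly (kern m)"
  unfolding kern_def[abs_def] by (intro trig_poly_intros trig_poly_hprod)

lemma trig_poly_dkern: "trig_poly (dkern m j)"
  unfolding dkern_def[abs_def] by (intro trig_poly_intros trig_poly_hcos)

lemma trig_poly_tdist2: "trig_poly tdist2"
  unfolding tdist2_def[abs_def] by (intro trig_poly_intros trig_poly_hcos)

lemma kern_nonneg [simp]: "0 \<le> kern m z"
  using wallis_pos[of "Suc m"] by (auto simp: kern_def intro!: divide_nonneg_nonneg simp del: wallis.simps)

lemma kern_minus [simp]: "kern m (- z) = kern m z"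
  by (simp add: kern_def hprod_def)

lemma dkern_minus [simp]: "dkern m j (- z) = - dkern m j z"
  by (simp add: dkern_def)

lemma kern_has_derivative:
  "(kern m has_derivative (\<lambda>h. \<Sum>j\<in>UNIV. h $ j * dkern m j z)) (at z)"
proof -
  have h: "((\<lambda>z. hcos (z $ i) ^ Suc m) has_derivative
      (\<lambda>h. - (real (Suc m) / 2 * sin (z $ i) * hcos (z $ i) ^ m) * h $ i)) (at z)" for i
    unfolding hcos_def
    by (auto intro!: derivative_eq_intros bounded_linear_imp_has_derivative bounded_linear_vec_nth
        simp del: power_Suc)
  have "((\<lambda>z. \<Prod>i\<in>UNIV. hcos (z $ i) ^ Suc m) has_derivative
      (\<lambda>h. \<Sum>i\<in>UNIV. (- (real (Suc m) / 2 * sin (z $ i) * hcos (z $ i) ^ m) * h $ i)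
        * (\<Prod>j\<in>UNIV - {i}. hcos (z $ j) ^ Suc m))) (at z)"
    by (rule has_derivative_prod) (rule h)
  from has_derivative_mult_right[OF this, of "1 / wallis (Suc m) ^ 3"]
  show ?thesis
    unfolding kern_def[abs_def] hprod_def dkern_def
    by (simp add: sum_distrib_left mult_ac sum_divide_distrib)
qed

lemma integral_kern: "(LINT y|cellM. kern m (x - y)) = 1"
  using integral_hprod[of "Suc m" x] wallis_pos[of "Suc m"] by (simp add: kern_def del: wallis.simps)

lemma trig_poly_shift_integrable:
  assumes "trig_poly f" shows "integrable cellM (\<lambda>y. f (x - y))"
  using conv_integrable[OF assms, of "\<lambda>_. 1"] by simp

lemma integral_kern_tdist2: "(LINT y|cellM. kern m (x - y) * tdist2 (x - y)) = 3 / (2 * real m + 4)"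
proof -
  have "(LINT y|cellM. kern m (x - y) * tdist2 (x - y))
      = (LINT y|cellM. (\<Sum>k\<in>UNIV. hprod (Suc m) (x - y) * (1 - hcos (x $ k - y $ k)) / wallis (Suc m) ^ 3))"
    by (simp add: kern_def tdist2_def sum_distrib_left sum_divide_distrib del: wallis.simps)
  also have "\<dots> = (\<Sum>k\<in>UNIV. (LINT y|cellM. hprod (Suc m) (x - y) * (1 - hcos (x $ k - y $ k)) / wallis (Suc m) ^ 3))"
  proof (rule Bochner_Integration.integral_sum)
    fix k :: 3
    have "trig_poly (\<lambda>z. hprod (Suc m) z * (1 - hcos (z $ k)) / wallis (Suc m) ^ 3)"
      by (intro trig_poly_intros trig_poly_hprod trig_poly_hcos)
    from trig_poly_shift_integrable[OF this, of x]
    show "integrable cellM (\<lambda>y. hprod (Suc m) (x - y) * (1 - hcos (x $ k - y $ k)) / wallis (Suc m) ^ 3)"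
      by simp
  qed
  also have "\<dots> = 3 / (2 * real m + 4)"
    using wallis_pos[of "Suc m"] by (simp add: integral_hprod_moment del: wallis.simps)
  finally show ?thesis .
qed

text \<open>
  A trigonometric polynomial that dominates the gradient of \<open>kern m\<close> up to a factor comparable to the
  distance from the lattice.  It stands in for the absolute value of the gradient, which is not a
  trigonometric polynomial.
\<close>

definition majorant :: "nat \<Rightarrow> real^3 \<Rightarrow> real" where
  "majorant m z = real (Suc m) * hprod m z / wallis (Suc m) ^ 3"

lemma trig_poly_majorant: "trig_poly (majorant m)"
  unfolding majorant_def[abs_def] by (intro trig_poly_intros trig_poly_hprod)

lemma majorant_nonneg [simp]: "0 \<le> majorant m z"
  using wallis_pos[of "Suc m"]
  by (auto simp: majorant_def intro!: divide_nonneg_nonneg mult_nonneg_nonneg simp del: wallis.simps)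

text \<open>
  The point is \<open>|sin z\<^sub>j| / 2 = |sin(z\<^sub>j / 2) cos(z\<^sub>j / 2)| \<le> |sin(z\<^sub>j / 2)|\<close>: the derivative of a power of
  \<open>hcos\<close> gains one factor of the size of the distance.
\<close>

lemma dkern_le_majorant: "\<bar>dkern m j z\<bar> \<le> majorant m z * sqrt (tdist2 z)"
proof -
  have W: "0 < wallis (Suc m) ^ 3"
    by (rule zero_less_power[OF wallis_pos])
  have "1 - hcos (z $ j) \<le> tdist2 z"
    unfolding tdist2_def by (rule member_le_sum) auto
  moreover have "(sin (z $ j) / 2)\<^sup>2 \<le> 1 - hcos (z $ j)"
    using mult_right_mono[OF hcos_le_1[of "z $ j"], of "1 - hcos (z $ j)"]
    by (simp add: power_divide sin_squared_hcos)
  ultimately have "sqrt ((sin (z $ j) / 2)\<^sup>2) \<le> sqrt (tdist2 z)"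
    by (intro real_sqrt_le_mono) linarith
  then have s: "\<bar>sin (z $ j)\<bar> / 2 \<le> sqrt (tdist2 z)"
    by simp
  have "(\<Prod>i\<in>UNIV - {j}. hcos (z $ i) ^ Suc m) \<le> (\<Prod>i\<in>UNIV - {j}. hcos (z $ i) ^ m)"
    by (rule prod_mono) (auto intro!: mult_left_le_one_le)
  then have "hcos (z $ j) ^ m * (\<Prod>i\<in>UNIV - {j}. hcos (z $ i) ^ Suc m) \<le> hprod m z"
    by (simp add: hprod_def prod.remove[of UNIV j] mult_left_mono)
  with s have "(\<bar>sin (z $ j)\<bar> / 2) * (hcos (z $ j) ^ m * (\<Prod>i\<in>UNIV - {j}. hcos (z $ i) ^ Suc m))
      \<le> sqrt (tdist2 z) * hprod m z"
    by (rule mult_mono) (auto intro!: mult_nonneg_nonneg prod_nonneg)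
  then have "real (Suc m) * ((\<bar>sin (z $ j)\<bar> / 2) * (hcos (z $ j) ^ m * (\<Prod>i\<in>UNIV - {j}. hcos (z $ i) ^ Suc m))) / wallis (Suc m) ^ 3
      \<le> real (Suc m) * (sqrt (tdist2 z) * hprod m z) / wallis (Suc m) ^ 3"
    using W by (intro divide_right_mono mult_left_mono) auto
  moreover have "\<bar>dkern m j z\<bar> = real (Suc m) * ((\<bar>sin (z $ j)\<bar> / 2) * (hcos (z $ j) ^ m * (\<Prod>i\<in>UNIV - {j}. hcos (z $ i) ^ Suc m))) / wallis (Suc m) ^ 3"
    using W unfolding dkern_def by (simp add: abs_mult abs_prod del: wallis.simps power_Suc)
  ultimately show ?thesis
    by (simp add: majorant_def mult_ac del: wallis.simps)
qed

lemma wallis_ratio: "wallis m ^ 3 \<le> 8 * wallis (Suc m) ^ 3"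
proof -
  have "wallis m \<le> 2 * wallis (Suc m)"
    using wallis_pos[of m] by (simp add: field_simps)
  then have "wallis m ^ 3 \<le> (2 * wallis (Suc m)) ^ 3"
    using wallis_pos[of m] by (intro power_mono) auto
  then show ?thesis by (simp add: power_mult_distrib del: wallis.simps)
qed

text \<open>
  The gradient of an approximate identity of width \<open>\<delta>\<close> has mass of order \<open>1 / \<delta>\<close>, so its first
  moment is bounded and its higher moments vanish with \<open>\<delta>\<close>.  By \<open>dkern_le_majorant\<close> the two integrals
  below dominate the first and the third moment; a vanishing higher moment expresses concentration.
\<close>

lemma integral_majorant_tdist2: "(LINT y|cellM. majorant m (x - y) * tdist2 (x - y)) \<le> 12"
  and integral_majorant_tdist4: "(LINT y|cellM. majorant m (x - y) * (tdist2 (x - y))\<^sup>2) \<le> 108 / (real m + 2)"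
proof -
  define W where "W = wallis (Suc m) ^ 3"
  have W: "0 < W"
    unfolding W_def by (rule zero_less_power[OF wallis_pos])
  have w: "wallis m ^ 3 \<le> 8 * W"
    unfolding W_def by (rule wallis_ratio)
  have int: "integrable cellM (\<lambda>y. f (x - y))" if "trig_poly f" for f
    using that by (rule trig_poly_shift_integrable)
  have t: "trig_poly (\<lambda>z. hprod m z * (1 - hcos (z $ k)) ^ r)" for k r
    by (intro trig_poly_intros trig_poly_hprod trig_poly_hcos)
  have t2: "trig_poly (\<lambda>z. majorant m z * tdist2 z ^ r)" for r
    by (intro trig_poly_intros trig_poly_majorant trig_poly_tdist2)
  have "(LINT y|cellM. majorant m (x - y) * tdist2 (x - y))
      = (LINT y|cellM. (\<Sum>k\<in>UNIV. (real (Suc m) / W) * (hprod m (x - y) * (1 - hcos (x $ k - y $ k)))))"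
    by (simp add: majorant_def tdist2_def sum_distrib_left W_def[symmetric] mult_ac del: wallis.simps)
  also have "\<dots> = (\<Sum>k\<in>UNIV. (real (Suc m) / W) * (LINT y|cellM. hprod m (x - y) * (1 - hcos (x $ k - y $ k))))"
    using int[OF t[of _ 1]] by (subst Bochner_Integration.integral_sum) auto
  also have "\<dots> = 3 / 2 * (wallis m ^ 3 / W)"
    unfolding integral_hprod_moment using W by (simp add: divide_simps)
  also have "\<dots> \<le> 3 / 2 * 8"
    using w W by (intro mult_left_mono) (auto simp: field_simps)
  finally show "(LINT y|cellM. majorant m (x - y) * tdist2 (x - y)) \<le> 12" by simp
  have sq: "(tdist2 z)\<^sup>2 \<le> 3 * (\<Sum>k\<in>UNIV. (1 - hcos (z $ k))\<^sup>2)" for z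
  proof -
    show ?thesis unfolding tdist2_def sum_3 by (rule square_sum3_le)
  qed
  have "(LINT y|cellM. majorant m (x - y) * (tdist2 (x - y))\<^sup>2)
      \<le> (LINT y|cellM. majorant m (x - y) * (3 * (\<Sum>k\<in>UNIV. (1 - hcos ((x - y) $ k))\<^sup>2)))"
  proof (intro integral_mono mult_left_mono sq)
    show "integrable cellM (\<lambda>y. majorant m (x - y) * (tdist2 (x - y))\<^sup>2)"
      by (rule int[OF t2])
    have "trig_poly (\<lambda>z. majorant m z * (3 * (\<Sum>k\<in>UNIV. (1 - hcos (z $ k))\<^sup>2)))"
      by (intro trig_poly_intros trig_poly_majorant trig_poly_hcos)
    from int[OF this]
    show "integrable cellM (\<lambda>y. majorant m (x - y) * (3 * (\<Sum>k\<in>UNIV. (1 - hcos ((x - y) $ k))\<^sup>2)))" .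
  qed auto
  also have "\<dots> = (LINT y|cellM. (\<Sum>k\<in>UNIV. (3 * real (Suc m) / W) * (hprod m (x - y) * (1 - hcos (x $ k - y $ k))\<^sup>2)))"
    by (intro Bochner_Integration.integral_cong refl) (simp add: majorant_def sum_distrib_left W_def[symmetric] field_simps del: wallis.simps)
  also have "\<dots> = (\<Sum>k\<in>UNIV. (3 * real (Suc m) / W) * (LINT y|cellM. hprod m (x - y) * (1 - hcos (x $ k - y $ k))\<^sup>2))"
    using int[OF t[of _ 2]] by (subst Bochner_Integration.integral_sum) auto
  also have "\<dots> = 27 / (2 * (2 * real m + 4)) * (wallis m ^ 3 / W)"
    unfolding integral_hprod_moment using W by (simp add: divide_simps) (simp add: algebra_simps)
  also have "\<dots> \<le> 27 / (2 * (2 * real m + 4)) * 8"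
    using w W by (intro mult_left_mono) (auto simp: field_simps)
  also have "\<dots> \<le> 108 / (real m + 2)"
    by (simp add: divide_simps)
  finally show "(LINT y|cellM. majorant m (x - y) * (tdist2 (x - y))\<^sup>2) \<le> 108 / (real m + 2)" .
qed

lemma periodic_shift_int:
  assumes "periodic u" shows "u (x + (\<chi> i. 2 * pi * of_int (k i))) = u x"
proof -
  have nat: "u (x + real n *\<^sub>R axis i (2 * pi)) = u x" for n i x
  proof (induction n arbitrary: x)
    case (Suc n)
    have "u (x + real (Suc n) *\<^sub>R axis i (2 * pi)) = u ((x + real n *\<^sub>R axis i (2 * pi)) + axis i (2 * pi))"
      by (simp add: algebra_simps scaleR_add_left)
    then show ?case using assms Suc by (simp add: periodic_def)
  qed simp
  have int: "u (x + of_int n *\<^sub>R axis i (2 * pi)) = u x" for n :: int and i x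
  proof (cases "n \<ge> 0")
    case True
    then show ?thesis using nat[of x "nat n" i] by simp
  next
    case False
    then show ?thesis using nat[of "x + of_int n *\<^sub>R axis i (2 * pi)" "nat (- n)" i]
      by (simp add: add.assoc scaleR_add_left[symmetric] del: scaleR_minus_left)
  qed
  have "x + (\<chi> i. 2 * pi * of_int (k i)) = x + of_int (k 1) *\<^sub>R axis 1 (2 * pi)
      + of_int (k 2) *\<^sub>R axis 2 (2 * pi) + of_int (k 3) *\<^sub>R axis 3 (2 * pi)"
    by (simp add: vec_eq_iff forall_3 axis_def)
  then show ?thesis by (simp only: int)
qed

text \<open>
  In terms of \<open>t = s / 2\<close> this is \<open>|t| \<le> 3 |sin t|\<close> for \<open>|t| < 2\<close>, from Taylor's formula
  \<open>|sin t - t| \<le> |t|\<^sup>3 / 6\<close>.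
\<close>

lemma square_le_hcos:
  assumes "\<bar>s\<bar> \<le> pi" shows "s\<^sup>2 \<le> 36 * (1 - hcos s)"
proof -
  define t where "t = s / 2"
  have t: "\<bar>t\<bar> < 2"
    using assms pi_half_less_two by (simp add: t_def)
  obtain c where "sin t = (\<Sum>m<3. sin_coeff m * t ^ m) + sin (c + 1 / 2 * real 3 * pi) / fact 3 * t ^ 3"
    using Maclaurin_sin_expansion[of t 3] by blast
  then have e: "sin t = t * (1 + sin (c + 3 / 2 * pi) * t\<^sup>2 / 6)"
    by (simp add: sin_coeff_def numeral_eq_Suc fact_reduce algebra_simps)
  have "t\<^sup>2 \<le> 4"
    using t abs_le_square_iff[of t 2] by simp
  then have "\<bar>sin (c + 3 / 2 * pi)\<bar> * t\<^sup>2 \<le> 1 * 4"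
    by (intro mult_mono) auto
  then have "\<bar>sin (c + 3 / 2 * pi) * t\<^sup>2\<bar> \<le> 4"
    by (simp add: abs_mult)
  then have "1 / 3 \<le> 1 + sin (c + 3 / 2 * pi) * t\<^sup>2 / 6"
    by linarith
  then have "(1 / 3)\<^sup>2 \<le> (1 + sin (c + 3 / 2 * pi) * t\<^sup>2 / 6)\<^sup>2"
    by (intro power_mono) auto
  then have "t\<^sup>2 * (1 / 3)\<^sup>2 \<le> (sin t)\<^sup>2"
    unfolding e power_mult_distrib by (intro mult_left_mono) auto
  moreover have "1 - hcos s = (sin t)\<^sup>2"
    using cos_double_sin[of t] by (simp add: hcos_def t_def field_simps)
  ultimately show ?thesis
    by (simp add: t_def power_divide)
qed

text \<open>
  On the torus \<open>x\<close> may be replaced by the translate nearest to \<open>y\<close>, where each coordinate difference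
  lies in \<open>[-\<pi>, \<pi>]\<close> and the distance is controlled by \<open>tdist2\<close>.
\<close>

lemma periodic_representative:
  assumes "periodic u"
  obtains x' where "u x' = u x" "norm (x' - y) \<le> 6 * sqrt (tdist2 (x - y))"
proof -
  define k where "k i = - round ((x $ i - y $ i) / (2 * pi))" for i
  define x' where "x' = x + (\<chi> i. 2 * pi * of_int (k i))"
  have r: "\<bar>(x' - y) $ i\<bar> \<le> pi" for i
  proof -
    have "\<bar>of_int (round ((x $ i - y $ i) / (2 * pi))) - (x $ i - y $ i) / (2 * pi)\<bar> \<le> 1 / 2"
      by (rule of_int_round_abs_le)
    then have "(2 * pi) * \<bar>of_int (round ((x $ i - y $ i) / (2 * pi))) - (x $ i - y $ i) / (2 * pi)\<bar> \<le> (2 * pi) * (1 / 2)"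
      by (intro mult_left_mono) auto
    then have "\<bar>(2 * pi) * (of_int (round ((x $ i - y $ i) / (2 * pi))) - (x $ i - y $ i) / (2 * pi))\<bar> \<le> pi"
      by (simp add: abs_mult)
    moreover have "(2 * pi) * (of_int (round ((x $ i - y $ i) / (2 * pi))) - (x $ i - y $ i) / (2 * pi))
        = (2 * pi) * of_int (round ((x $ i - y $ i) / (2 * pi))) - (x $ i - y $ i)"
      by (subst right_diff_distrib) simp
    ultimately have "\<bar>(2 * pi) * of_int (round ((x $ i - y $ i) / (2 * pi))) - (x $ i - y $ i)\<bar> \<le> pi"
      by (simp only:)
    then show ?thesis
      by (simp add: x'_def k_def)
  qed
  have h: "hcos ((x' - y) $ i) = hcos ((x - y) $ i)" for i
  proof -
    have "(x' - y) $ i = (x - y) $ i + 2 * pi * of_int (k i)"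
      by (simp add: x'_def)
    then show ?thesis
      by (simp only: hcos_def cos_add sin_int_2pin cos_int_2pin) simp
  qed
  have n: "(norm (x' - y))\<^sup>2 = (\<Sum>i\<in>UNIV. ((x' - y) $ i)\<^sup>2)"
    by (simp add: norm_vec_def L2_set_def sum_nonneg)
  have "(norm (x' - y))\<^sup>2 \<le> 36 * tdist2 (x - y)"
    unfolding n tdist2_def sum_distrib_left
    by (rule sum_mono) (metis square_le_hcos r h)
  then have "norm (x' - y) \<le> sqrt (36 * tdist2 (x - y))"
    by (rule real_le_rsqrt)
  then have "norm (x' - y) \<le> 6 * sqrt (tdist2 (x - y))"
    by (simp add: real_sqrt_mult)
  then show ?thesis
    using that[of x'] periodic_shift_int[OF assms] by (simp add: x'_def)
qed

section \<open>Integration by parts on the torus\<close>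

lemma continuous_integrable_cell:
  fixes f :: "real^3 \<Rightarrow> real"
  assumes "continuous_on UNIV f" shows "integrable cellM f"
  using assms continuous_imp_integrable[of "0::real^3" "\<chi> i. 2 * pi" f] continuous_on_subset
  by (auto simp: cell_eq_cbox)

text \<open>
  Lengthen the cell by \<open>s\<close> in direction \<open>i\<close> and cut this box once at \<open>x\<^sub>i = s\<close> and once at
  \<open>x\<^sub>i = 2\<pi>\<close>.  The two thin slabs that are cut off are translates of one another by a period.
\<close>

lemma periodic_integral_shift:
  fixes h :: "real^3 \<Rightarrow> real"
  assumes cont: "continuous_on UNIV h" and per: "periodic h" and s: "0 \<le> s" "s \<le> 2 * pi"
  shows "integral cell (\<lambda>x. h (x + axis i s)) = integral cell h"
proof -
  define b :: "real^3" where "b = (\<chi> i. 2 * pi)"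
  have cell: "cell = cbox 0 b" by (simp add: cell_eq_cbox b_def)
  have int: "h integrable_on cbox c d" for c d
    using cont continuous_on_subset by (blast intro: integrable_continuous)
  let ?e = "axis i 1 :: real^3" and ?H = "\<lambda>c d. integral (cbox c d) h"
  have e: "?e \<in> Basis" by simp
  have ax: "(axis i r :: real^3) $ j = (if i = j then r else 0)" for r j
    by (auto simp: axis_def)
  have split: "?H 0 (b + axis i s) = ?H 0 d + ?H c (b + axis i s)"
    if "cbox 0 (b + axis i s) \<inter> {x. x \<bullet> ?e \<le> r} = cbox 0 d"
       "cbox 0 (b + axis i s) \<inter> {x. x \<bullet> ?e \<ge> r} = cbox c (b + axis i s)" for c d r
    using has_integral_split[of h "?H 0 d" 0 "b + axis i s" ?e r "?H c (b + axis i s)"] that e int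
    by (auto intro!: integral_unique integrable_integral)
  have 1: "?H 0 (b + axis i s) = ?H 0 (b + axis i (s - 2 * pi)) + ?H (axis i s) (b + axis i s)"
  proof (rule split[of s]; rule set_eqI)
    fix x
    show "x \<in> cbox 0 (b + axis i s) \<inter> {x. x \<bullet> ?e \<le> s} \<longleftrightarrow> x \<in> cbox 0 (b + axis i (s - 2 * pi))"
      using s by (simp add: mem_box_cart inner_axis b_def ax) (smt (verit) pi_gt_zero)
    show "x \<in> cbox 0 (b + axis i s) \<inter> {x. x \<bullet> ?e \<ge> s} \<longleftrightarrow> x \<in> cbox (axis i s) (b + axis i s)"
      using s by (simp add: mem_box_cart inner_axis b_def ax) (smt (verit) pi_gt_zero)
  qed
  have 2: "?H 0 (b + axis i s) = ?H 0 b + ?H (axis i (2 * pi)) (b + axis i s)"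
  proof (rule split[of "2 * pi"]; rule set_eqI)
    fix x
    show "x \<in> cbox 0 (b + axis i s) \<inter> {x. x \<bullet> ?e \<le> 2 * pi} \<longleftrightarrow> x \<in> cbox 0 b"
      using s by (simp add: mem_box_cart inner_axis b_def ax) (smt (verit) pi_gt_zero)
    show "x \<in> cbox 0 (b + axis i s) \<inter> {x. x \<bullet> ?e \<ge> 2 * pi} \<longleftrightarrow> x \<in> cbox (axis i (2 * pi)) (b + axis i s)"
      using s by (simp add: mem_box_cart inner_axis b_def ax) (smt (verit) pi_gt_zero)
  qed
  have shift: "integral (cbox c d) (\<lambda>x. h (x + v)) = ?H (c + v) (d + v)" for c d v
    using has_integral_shift_cbox_iff[of h v _ c d] integrable_integral[OF int[of "c + v" "d + v"]]
    by (intro integral_unique) (simp add: o_def add.commute)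
  have "?H (axis i (2 * pi)) (b + axis i s) = integral (cbox 0 (b + axis i (s - 2 * pi))) (\<lambda>x. h (x + axis i (2 * pi)))"
  proof -
    have "b + axis i (s - 2 * pi) + axis i (2 * pi) = b + axis i s"
      by (simp add: vec_eq_iff ax)
    then show ?thesis by (subst shift) (simp only: add_0)
  qed
  also have "\<dots> = ?H 0 (b + axis i (s - 2 * pi))"
    using per by (simp add: periodic_def)
  finally show ?thesis
    using 1 2 shift[of 0 b "axis i s"] by (simp add: cell)
qed

text \<open>
  The integral of \<open>g\<close> over a shifted cell does not depend on the shift; its derivative at shift \<open>0\<close> is
  the integral of the partial derivative.
\<close>

lemma integral_partial_derivative_periodic:
  fixes g :: "real^3 \<Rightarrow> real"
  assumes per: "periodic g" and g': "\<And>x. (g has_derivative g' x) (at x)"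
    and cont: "continuous_on UNIV (\<lambda>x. g' x (axis i 1))"
  shows "(LINT x|cellM. g' x (axis i 1)) = 0"
proof -
  let ?G = "\<lambda>x. g' x (axis i 1)"
  have g_cont: "continuous_on UNIV g"
    by (intro continuous_at_imp_continuous_on ballI has_derivative_continuous[OF g'])
  define e :: "real^3" where "e = axis i 1"
  have ax: "axis i s = s *\<^sub>R e" for s
    by (simp add: vec_eq_iff axis_def e_def)
  have "((\<lambda>s. integral (cbox 0 (\<chi> i. 2 * pi)) (\<lambda>x. g (x + axis i s))) has_vector_derivative
      integral (cbox 0 (\<chi> i. 2 * pi)) (\<lambda>x. ?G (x + axis i 0))) (at 0 within {0..1})"
  proof (rule leibniz_rule_vector_derivative)
    fix s :: real and x :: "real^3"
    have "((\<lambda>s. g (x + axis i s)) has_derivative (\<lambda>h. g' (x + axis i s) (h *\<^sub>R e))) (at s within {0..1})"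
      by (rule has_derivative_compose[OF _ g']) (auto simp: ax intro!: derivative_eq_intros)
    moreover have "g' (x + axis i s) (h *\<^sub>R e) = h *\<^sub>R ?G (x + axis i s)" for h
      using linear_scale[OF has_derivative_linear[OF g']] by (simp add: e_def)
    ultimately show "((\<lambda>s. g (x + axis i s)) has_vector_derivative ?G (x + axis i s)) (at s within {0..1})"
      by (simp add: has_vector_derivative_def)
  next
    fix s :: real
    show "(\<lambda>x. g (x + axis i s)) integrable_on cbox 0 (\<chi> i. 2 * pi)"
      by (intro integrable_continuous continuous_on_compose2[OF g_cont]) (auto intro!: continuous_intros)
  next
    show "continuous_on ({0..1} \<times> cbox 0 (\<chi> i. 2 * pi)) (\<lambda>(s, x). ?G (x + axis i s))"
    proof -
      have "continuous_on S (\<lambda>p. snd p + axis i (fst p))" for S :: "(real \<times> (real^3)) set"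
        unfolding ax by (intro continuous_intros)
      from continuous_on_compose2[OF cont this] show ?thesis
        by (simp add: case_prod_beta)
    qed
  qed auto
  then have d: "((\<lambda>s. integral cell (\<lambda>x. g (x + axis i s))) has_vector_derivative integral cell ?G) (at 0 within {0..1})"
    by (simp only: cell_eq_cbox ax scaleR_zero_left add_0_right)
  have "((\<lambda>s. integral cell g) has_vector_derivative integral cell ?G) (at 0 within {0..1})"
  proof (rule has_vector_derivative_transform[OF _ _ d])
    fix s :: real assume "s \<in> {0..1}"
    then show "integral cell g = integral cell (\<lambda>x. g (x + axis i s))"
      using periodic_integral_shift[OF g_cont per, of s i] pi_gt3 by auto
  qed simp
  moreover have "((\<lambda>s. integral cell g) has_vector_derivative 0) (at 0 within {0..1})"
    by (rule has_vector_derivative_const)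
  ultimately have "integral cell ?G = 0"
    by (intro vector_derivative_unique_within[of 0 "{0..1}"]) (auto simp: trivial_limit_within islimpt_Icc)
  then show ?thesis
    using lebesgue_integral_eq_integral[of cell ?G] continuous_integrable_cell[OF cont] by simp
qed

section \<open>Square-integrable fields\<close>

lemma L2_torus_measurable:
  assumes "u \<in> L2_torus" shows "(\<lambda>x. u x $ i) \<in> borel_measurable cellM"
proof -
  have "u \<in> borel_measurable cellM"
    using assms by (intro measurable_restrict_space1) (simp add: L2_torus_def)
  then show ?thesis
    using borel_measurable_continuous_onI[of "\<lambda>v::real^3. v $ i"]
    by (rule measurable_compose) (auto intro!: continuous_intros)
qed

lemma L2_torus_integrable_norm2: "u \<in> L2_torus \<Longrightarrow> integrable cellM (\<lambda>x. (norm (u x))\<^sup>2)"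
  by (simp add: L2_torus_def)

lemma L2_torus_integrable_mult:
  assumes u: "u \<in> L2_torus" and w: "w \<in> L2_torus"
  shows "integrable cellM (\<lambda>x. u x $ i * w x $ j)"
proof (rule Bochner_Integration.integrable_bound[where f = "\<lambda>x. (norm (u x))\<^sup>2 + (norm (w x))\<^sup>2"])
  show "integrable cellM (\<lambda>x. (norm (u x))\<^sup>2 + (norm (w x))\<^sup>2)"
    using u w by (simp add: L2_torus_integrable_norm2)
  show "(\<lambda>x. u x $ i * w x $ j) \<in> borel_measurable cellM"
    using L2_torus_measurable[OF u] L2_torus_measurable[OF w] by measurable
  have "\<bar>u x $ i * w x $ j\<bar> \<le> (norm (u x))\<^sup>2 + (norm (w x))\<^sup>2" for x
  proof -
    have "\<bar>u x $ i * w x $ j\<bar> \<le> norm (u x) * norm (w x)"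
      unfolding abs_mult by (intro mult_mono component_le_norm_cart) auto
    also have "\<dots> \<le> (norm (u x))\<^sup>2 + (norm (w x))\<^sup>2"
    proof -
      have "0 \<le> norm (u x) * norm (w x)" by simp
      then show ?thesis using sum_squares_bound[of "norm (u x)" "norm (w x)"] by linarith
    qed
    finally show ?thesis .
  qed
  then show "AE x in cellM. norm (u x $ i * w x $ j) \<le> norm ((norm (u x))\<^sup>2 + (norm (w x))\<^sup>2)"
    by (auto intro!: AE_I2)
qed

lemma L2_torus_const: "(\<lambda>x. c) \<in> L2_torus"
  by (simp add: L2_torus_def periodic_def)

lemma L2_torus_integrable:
  assumes "u \<in> L2_torus" shows "integrable cellM (\<lambda>x. u x $ i)"
  using L2_torus_integrable_mult[OF assms L2_torus_const[of "axis i 1"], of i i] by (simp add: axis_def)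

lemma norm2_vec: "(norm (a :: real^3))\<^sup>2 = (\<Sum>i\<in>UNIV. a $ i * a $ i)"
  unfolding power2_norm_eq_inner by (simp add: inner_vec_def)

lemma L2_inner_integrable: "u \<in> L2_torus \<Longrightarrow> w \<in> L2_torus \<Longrightarrow> integrable cellM (\<lambda>x. u x \<bullet> w x)"
  unfolding inner_vec_def by (auto intro: L2_torus_integrable_mult)

lemma L2_inner_sum: 
  "u \<in> L2_torus \<Longrightarrow> w \<in> L2_torus \<Longrightarrow> L2_inner u w = (\<Sum>i\<in>UNIV. LINT x|cellM. u x $ i * w x $ i)"
  unfolding inner_vec_def L2_inner_def by (simp add: L2_torus_integrable_mult)

lemma L2_norm_power2: "(L2_norm u)\<^sup>2 = (LINT x|cellM. (norm (u x))\<^sup>2)"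
  unfolding L2_norm_def L2_inner_def
  by (subst real_sqrt_pow2) (auto simp: power2_norm_eq_inner intro!: integral_nonneg_AE)

lemma L2_norm_nonneg [simp]: "0 \<le> L2_norm u"
  unfolding L2_norm_def L2_inner_def by (auto intro!: integral_nonneg_AE)

lemma continuous_L2_torus:
  assumes "continuous_on UNIV u" "periodic u" shows "u \<in> L2_torus"
proof -
  have "u \<in> borel_measurable borel"
    using assms(1) by (rule borel_measurable_continuous_onI)
  then have "u \<in> borel_measurable lebesgue"
    by (intro measurable_completion) simp
  moreover have "integrable cellM (\<lambda>x. (norm (u x))\<^sup>2)"
    using assms(1) by (intro continuous_integrable_cell continuous_intros)
  ultimately show ?thesis
    using assms(2) by (simp add: L2_torus_def)
qed

lemma L2_torus_diff:
  assumes "u \<in> L2_torus" "w \<in> L2_torus" shows "(\<lambda>x. u x - w x) \<in> L2_torus"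
proof -
  have "integrable cellM (\<lambda>x. \<Sum>i\<in>UNIV. u x $ i * u x $ i - 2 * (u x $ i * w x $ i) + w x $ i * w x $ i)"
    by (intro Bochner_Integration.integrable_sum Bochner_Integration.integrable_add
        Bochner_Integration.integrable_diff integrable_mult_right L2_torus_integrable_mult assms)
  moreover have "(norm (u x - w x))\<^sup>2 = (\<Sum>i\<in>UNIV. u x $ i * u x $ i - 2 * (u x $ i * w x $ i) + w x $ i * w x $ i)" for x
    unfolding norm2_vec by (simp add: algebra_simps)
  ultimately show ?thesis
    using assms by (auto simp: L2_torus_def periodic_def)
qed

lemma smooth_solenoidal_continuous:
  assumes "\<psi> \<in> smooth_solenoidal" shows "continuous_on UNIV \<psi>"
proof -
  have "Ck_on 0 UNIV \<psi>"
    using assms unfolding smooth_solenoidal_def smooth_on_def by blast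
  then show ?thesis by simp
qed

lemma smooth_solenoidal_L2: "\<psi> \<in> smooth_solenoidal \<Longrightarrow> \<psi> \<in> L2_torus"
  using continuous_L2_torus[OF smooth_solenoidal_continuous] by (simp add: smooth_solenoidal_def)

lemma H_space_L2: "u \<in> H_space \<Longrightarrow> u \<in> L2_torus"
  by (simp add: H_space_def)

lemma divergence_eq_sum:
  assumes "(u has_derivative u') (at x)"
  shows "divergence u x = (\<Sum>i\<in>UNIV. u' (axis i 1) $ i)"
  using frechet_derivative_at[OF assms]
  by (simp add: divergence_def trace_def jacobian_def matrix_def)

text \<open>
  Gradients are orthogonal to solenoidal fields: sum the integrals of the derivatives
  \<open>\<partial>\<^sub>i(g \<psi>\<^sub>i)\<close>.
\<close>

lemma solenoidal_orthogonal:
  assumes \<psi>: "\<psi> \<in> smooth_solenoidal" and g: "trig_poly g" and g': "\<And>x. (g has_derivative g' x) (at x)"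
    and cont: "\<And>i. continuous_on UNIV (\<lambda>x. g' x (axis i 1))"
  shows "(LINT x|cellM. (\<Sum>i\<in>UNIV. g' x (axis i 1) * \<psi> x $ i)) = 0"
proof -
  have "Ck_on (Suc 0) UNIV \<psi>"
    using \<psi> unfolding smooth_solenoidal_def smooth_on_def by blast
  then obtain \<psi>' where \<psi>': "\<And>x. (\<psi> has_derivative \<psi>' x) (at x)"
    and \<psi>'c: "\<And>b. b \<in> Basis \<Longrightarrow> continuous_on UNIV (\<lambda>x. \<psi>' x b)"
    by auto
  have comp: "((\<lambda>x. \<psi> x $ i) has_derivative (\<lambda>h. \<psi>' x h $ i)) (at x)" for i x
    by (rule bounded_linear.has_derivative[OF bounded_linear_vec_nth \<psi>'])
  have div: "(\<Sum>i\<in>UNIV. \<psi>' x (axis i 1) $ i) = 0" for x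
    using \<psi> divergence_eq_sum[OF \<psi>'] by (auto simp: smooth_solenoidal_def)
  have gc: "continuous_on UNIV g"
    using g by (rule trig_poly_continuous)
  have \<psi>c: "continuous_on UNIV \<psi>"
    using \<psi> by (rule smooth_solenoidal_continuous)
  let ?D = "\<lambda>i x. g x * \<psi>' x (axis i 1) $ i + g' x (axis i 1) * \<psi> x $ i"
  have Dc: "continuous_on UNIV (?D i)" for i
    using cont gc \<psi>c \<psi>'c[of "axis i 1"] by (auto intro!: continuous_intros)
  have D0: "(LINT x|cellM. ?D i x) = 0" for i
  proof (rule integral_partial_derivative_periodic[where g = "\<lambda>x. g x * \<psi> x $ i"
        and g' = "\<lambda>x h. g x * \<psi>' x h $ i + g' x h * \<psi> x $ i"])
    show "periodic (\<lambda>x. g x * \<psi> x $ i)"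
      using trig_poly_periodic[OF g] \<psi> by (auto simp: periodic_def smooth_solenoidal_def)
    show "((\<lambda>x. g x * \<psi> x $ i) has_derivative (\<lambda>h. g x * \<psi>' x h $ i + g' x h * \<psi> x $ i)) (at x)" for x
      by (rule has_derivative_mult[OF g' comp])
  qed (rule Dc)
  have "(\<Sum>i\<in>UNIV. g' x (axis i 1) * \<psi> x $ i) = (\<Sum>i\<in>UNIV. ?D i x)" for x
    using div[of x] by (simp add: sum.distrib sum_distrib_left[symmetric])
  then show ?thesis
    using D0 by (simp add: continuous_integrable_cell[OF Dc])
qed

text \<open>
  Orthogonality passes to limits in \<open>L\<^sup>2\<close>.  The remainder is estimated by
  \<open>G \<cdot> d \<le> e |G|\<^sup>2 + |d|\<^sup>2 / e\<close> with \<open>\<parallel>d\<parallel> < e\<close>, which avoids products of norms.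
\<close>

lemma H_space_orthogonal:
  assumes u: "u \<in> H_space" and g: "trig_poly g" and g': "\<And>x. (g has_derivative g' x) (at x)"
    and g't: "\<And>i. trig_poly (\<lambda>x. g' x (axis i 1))"
  shows "(LINT x|cellM. (\<Sum>i\<in>UNIV. g' x (axis i 1) * u x $ i)) = 0"
proof -
  have uL: "u \<in> L2_torus" using u by (rule H_space_L2)
  define G where "G = (\<lambda>x. \<chi> i. g' x (axis i 1))"
  have Gc: "continuous_on UNIV G"
    unfolding G_def by (intro continuous_on_vec_lambda trig_poly_continuous g't)
  have Gp: "periodic G"
    using trig_poly_periodic[OF g't] unfolding G_def periodic_def by (simp add: vec_eq_iff)
  have GL: "G \<in> L2_torus"
    by (rule continuous_L2_torus[OF Gc Gp])
  let ?I = "LINT x|cellM. G x \<bullet> u x" and ?N = "(L2_norm G)\<^sup>2"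
  have N: "0 \<le> ?N" by simp
  have "\<bar>?I\<bar> \<le> e * (?N + 1)" if e: "e > 0" for e
  proof -
    obtain \<psi> where \<psi>: "\<psi> \<in> smooth_solenoidal" and d: "L2_norm (\<lambda>x. u x - \<psi> x) < e"
      using u e unfolding H_space_def by blast
    let ?w = "\<lambda>x. u x - \<psi> x"
    have wL: "?w \<in> L2_torus"
      by (rule L2_torus_diff[OF uL smooth_solenoidal_L2[OF \<psi>]])
    have "(LINT x|cellM. G x \<bullet> \<psi> x) = 0"
      using solenoidal_orthogonal[OF \<psi> g g' trig_poly_continuous[OF g't]] by (simp add: G_def inner_vec_def)
    moreover have "?I = (LINT x|cellM. G x \<bullet> ?w x) + (LINT x|cellM. G x \<bullet> \<psi> x)"
      using L2_inner_integrable[OF GL wL] L2_inner_integrable[OF GL smooth_solenoidal_L2[OF \<psi>]]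
      by (simp add: inner_diff_right flip: Bochner_Integration.integral_add)
    ultimately have I: "?I = (LINT x|cellM. G x \<bullet> ?w x)" by simp
    have "\<bar>?I\<bar> \<le> (LINT x|cellM. \<bar>G x \<bullet> ?w x\<bar>)"
      unfolding I by (rule integral_abs_bound)
    also have "\<dots> \<le> (LINT x|cellM. e * (norm (G x))\<^sup>2 + (1 / e) * (norm (?w x))\<^sup>2)"
    proof (rule integral_mono)
      show "integrable cellM (\<lambda>x. \<bar>G x \<bullet> ?w x\<bar>)"
        using L2_inner_integrable[OF GL wL] by (rule Bochner_Integration.integrable_abs)
      show "integrable cellM (\<lambda>x. e * (norm (G x))\<^sup>2 + (1 / e) * (norm (?w x))\<^sup>2)"
        using L2_torus_integrable_norm2[OF GL] L2_torus_integrable_norm2[OF wL] by simp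
      fix x
      have "\<bar>G x \<bullet> ?w x\<bar> \<le> norm (G x) * norm (?w x)"
        by (rule Cauchy_Schwarz_ineq2)
      also have "\<dots> \<le> e * (norm (G x))\<^sup>2 + (1 / e) * (norm (?w x))\<^sup>2"
      proof -
        have "2 * (norm (G x) * norm (?w x)) * e \<le> (e * norm (G x))\<^sup>2 + (norm (?w x))\<^sup>2"
          using sum_squares_bound[of "e * norm (G x)" "norm (?w x)"] by (simp add: algebra_simps)
        moreover have "0 \<le> norm (G x) * norm (?w x) * e"
          using e by simp
        ultimately have "(norm (G x) * norm (?w x)) * e \<le> (e * norm (G x))\<^sup>2 + (norm (?w x))\<^sup>2"
          by linarith
        then show ?thesis
          using e by (simp add: field_simps power2_eq_square)
      qed
      finally show "\<bar>G x \<bullet> ?w x\<bar> \<le> e * (norm (G x))\<^sup>2 + (1 / e) * (norm (?w x))\<^sup>2" .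
    qed
    also have "\<dots> = e * ?N + (1 / e) * (L2_norm ?w)\<^sup>2"
      using L2_torus_integrable_norm2[OF GL] L2_torus_integrable_norm2[OF wL] by (simp add: L2_norm_power2)
    also have "\<dots> \<le> e * ?N + (1 / e) * e\<^sup>2"
      using e d by (intro add_left_mono mult_left_mono power_mono) auto
    also have "\<dots> = e * (?N + 1)"
      using e by (simp add: power2_eq_square distrib_left)
    finally show ?thesis .
  qed
  then have 1: "\<bar>?I\<bar> \<le> (e / (?N + 1)) * (?N + 1)" if "e > 0" for e
    using that N by (simp only: divide_pos_pos add_nonneg_pos zero_less_one)
  have 2: "(e / (?N + 1)) * (?N + 1) = e" for e
    using N by (simp add: add_nonneg_eq_0_iff)
  have "\<bar>?I\<bar> \<le> 0 + e" if "e > 0" for e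
    using 1[OF that] by (simp only: 2 add_0)
  then have "\<bar>?I\<bar> \<le> 0"
    by (rule field_le_epsilon)
  then show ?thesis by (simp add: G_def inner_vec_def)
qed

section \<open>The energy at a finite scale\<close>

lemma trig_poly_reflect_shift: "trig_poly f \<Longrightarrow> trig_poly (\<lambda>y. f (x - y))"
proof (induction rule: trig_poly.induct)
  case (cos i)
  have "trig_poly (\<lambda>y. cos (x $ i) * cos (y $ i) + sin (x $ i) * sin (y $ i))"
    by (intro trig_poly_intros)
  then show ?case by (simp add: cos_diff)
next
  case (sin i)
  have "trig_poly (\<lambda>y. sin (x $ i) * cos (y $ i) - cos (x $ i) * sin (y $ i))"
    by (intro trig_poly_intros)
  then show ?case by (simp add: sin_diff)
qed (auto intro: trig_poly_intros)

text \<open>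
  Members of \<open>H\<close> have a solenoidal mollification: the sum is the divergence at \<open>x\<close> of \<open>kern m * u\<close>, and
  equally the scalar product of \<open>u\<close> with the gradient of \<open>y \<mapsto> - kern m (x - y)\<close>.
\<close>

lemma H_space_conv_dkern:
  assumes "u \<in> H_space" shows "(\<Sum>j\<in>UNIV. conv (dkern m j) (\<lambda>y. u y $ j) x) = 0"
proof -
  let ?g' = "\<lambda>y h. \<Sum>j\<in>UNIV. (- h $ j) * dkern m j (x - y)"
  have ax: "?g' y (axis i 1) = - dkern m i (x - y)" for y i
    by (simp add: sum_negf sum_axis)
  have d: "((\<lambda>y. kern m (x - y)) has_derivative ?g' y) (at y)" for y
  proof -
    have "((\<lambda>y. x - y) has_derivative (\<lambda>h. - h)) (at y)"
      by (auto intro!: derivative_eq_intros)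
    from has_derivative_compose[OF this kern_has_derivative] show ?thesis by simp
  qed
  have "(LINT y|cellM. (\<Sum>i\<in>UNIV. ?g' y (axis i 1) * u y $ i)) = 0"
  proof (rule H_space_orthogonal[OF assms trig_poly_reflect_shift[OF trig_poly_kern] d])
    show "trig_poly (\<lambda>y. ?g' y (axis i 1))" for i
      unfolding ax by (intro trig_poly_uminus trig_poly_reflect_shift trig_poly_dkern)
  qed
  then have "(LINT y|cellM. (\<Sum>i\<in>UNIV. - (dkern m i (x - y) * u y $ i))) = 0"
    unfolding ax by (simp only: mult_minus_left)
  moreover have "integrable cellM (\<lambda>y. dkern m i (x - y) * u y $ i)" for i
    by (rule conv_integrable[OF trig_poly_dkern L2_torus_integrable[OF H_space_L2[OF assms]]])
  ultimately show ?thesis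
    by (simp add: conv_def sum_negf)
qed

lemma dbl_left: "dbl (\<lambda>x y. f (x - y) * (P x * 1)) = (LINT x|cellM. P x * (LINT y|cellM. f (x - y)))"
  by (simp add: dbl_def mult.commute)

lemma dbl_conv: "dbl (\<lambda>x y. f (x - y) * (P x * R y)) = (LINT x|cellM. P x * conv f R x)"
  unfolding dbl_def conv_def by (simp add: mult.left_commute)

lemma dbl_even:
  assumes "trig_poly f" "integrable cellM P" "integrable cellM R" "\<And>z. f (- z) = f z"
  shows "dbl (\<lambda>x y. f (x - y) * (P x * R y)) = dbl (\<lambda>x y. f (x - y) * (R x * P y))"
proof -
  have "f (y - x) = f (x - y)" for x y
    using assms(4)[of "x - y"] by simp
  then show ?thesis
    using dbl_swap[OF deg_int_trig[OF assms(1-3)]] by (simp add: mult_ac)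
qed

lemma dbl_odd:
  assumes "trig_poly f" "integrable cellM P" "integrable cellM R" "\<And>z. f (- z) = - f z"
  shows "dbl (\<lambda>x y. f (x - y) * (P x * R y)) = - dbl (\<lambda>x y. f (x - y) * (R x * P y))"
proof -
  have "f (y - x) * (P y * R x) = (-1) * (f (x - y) * (R x * P y))" for x y
    using assms(4)[of "x - y"] by simp
  then have "dbl (\<lambda>x y. f (x - y) * (P x * R y)) = dbl (\<lambda>x y. (-1) * (f (x - y) * (R x * P y)))"
    using dbl_swap[OF deg_int_trig[OF assms(1-3)]] by (simp only:)
  then show ?thesis by (rule trans[OF _ trans[OF dbl_cmult mult_minus1]])
qed

text \<open>
  The scalar product of \<open>u\<close> with its mollification by \<open>kern m\<close>, written as a double integral.
\<close>

definition energy :: "nat \<Rightarrow> (real^3 \<Rightarrow> real^3) \<Rightarrow> real" where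
  "energy m u = (\<Sum>i\<in>UNIV. dbl (\<lambda>x y. kern m (x - y) * (u x $ i * u y $ i)))"

text \<open>
  Expand the square and use that the kernel has mass one in either variable.  The identity shows at
  once that the energy at a finite scale is at most the full energy, and that the defect measures how
  much \<open>u\<close> varies over the width of the kernel.
\<close>

lemma
  assumes u: "u \<in> L2_torus"
  shows deg_int_energy_gap: "deg_int (\<lambda>x y. kern m (x - y) * (norm (u x - u y))\<^sup>2)"
    and energy_gap: "dbl (\<lambda>x y. kern m (x - y) * (norm (u x - u y))\<^sup>2) = 2 * (L2_norm u)\<^sup>2 - 2 * energy m u"
proof -
  note k = deg_int_trig[OF trig_poly_kern]
  let ?A = "\<lambda>i x y. kern m (x - y) * ((u x $ i * u x $ i) * 1)"
  let ?B = "\<lambda>i x y. kern m (x - y) * (1 * (u y $ i * u y $ i))"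
  let ?C = "\<lambda>i x y. 2 * (kern m (x - y) * (u x $ i * u y $ i))"
  have A: "deg_int (?A i)" and B: "deg_int (?B i)" and C: "deg_int (?C i)" for i
    by (intro k deg_int_cmult L2_torus_integrable_mult L2_torus_integrable u integrable_const_cell)+
  have AB: "deg_int (\<lambda>x y. ?A i x y + ?B i x y)" and ABC: "deg_int (\<lambda>x y. ?A i x y + ?B i x y - ?C i x y)" for i
    by (intro degenerate.add deg_int_diff A B C)+
  have eq: "kern m (x - y) * (norm (u x - u y))\<^sup>2 = (\<Sum>i\<in>UNIV. ?A i x y + ?B i x y - ?C i x y)" for x y
    unfolding norm2_vec sum_distrib_left by (intro sum.cong refl) (simp add: algebra_simps)
  show "deg_int (\<lambda>x y. kern m (x - y) * (norm (u x - u y))\<^sup>2)"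
    unfolding eq by (intro deg_int_sum ABC) simp
  have dA: "dbl (?A i) = (LINT x|cellM. u x $ i * u x $ i)" for i
    using dbl_left[of "kern m" "\<lambda>x. u x $ i * u x $ i"] by (simp only: integral_kern mult_1_right)
  have dB: "dbl (?B i) = (LINT x|cellM. u x $ i * u x $ i)" for i
    using dbl_even[OF trig_poly_kern, of "\<lambda>_. 1" "\<lambda>x. u x $ i * u x $ i" m] dA[of i]
    by (simp add: L2_torus_integrable_mult u)
  have N: "(L2_norm u)\<^sup>2 = (\<Sum>i\<in>UNIV. LINT x|cellM. u x $ i * u x $ i)"
    using L2_inner_sum[OF u u] unfolding L2_norm_power2 L2_inner_def power2_norm_eq_inner .
  have "dbl (\<lambda>x y. kern m (x - y) * (norm (u x - u y))\<^sup>2) = (\<Sum>i\<in>UNIV. dbl (?A i) + dbl (?B i) - dbl (?C i))"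
    unfolding eq using ABC AB A B C by (simp add: dbl_sum dbl_diff dbl_add)
  also have "\<dots> = 2 * (L2_norm u)\<^sup>2 - 2 * energy m u"
    unfolding dA dB dbl_cmult N energy_def by (simp add: sum_subtractf sum_distrib_left)
  finally show "dbl (\<lambda>x y. kern m (x - y) * (norm (u x - u y))\<^sup>2) = 2 * (L2_norm u)\<^sup>2 - 2 * energy m u" .
qed

lemma energy_le: assumes "u \<in> L2_torus" shows "energy m u \<le> (L2_norm u)\<^sup>2"
proof -
  have "0 \<le> dbl (\<lambda>x y. kern m (x - y) * (norm (u x - u y))\<^sup>2)"
    unfolding dbl_def by (intro integral_nonneg_AE AE_I2 mult_nonneg_nonneg) auto
  then show ?thesis using energy_gap[OF assms] by simp
qed

lemma tdist2_le: "tdist2 z \<le> 3"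
proof -
  have "tdist2 z \<le> (\<Sum>i\<in>(UNIV::3 set). 1)"
    unfolding tdist2_def by (intro sum_mono) simp
  then show ?thesis by simp
qed

lemma norm_cell_le: "x \<in> cell \<Longrightarrow> norm x \<le> 24"
proof -
  assume x: "x \<in> cell"
  have "norm x \<le> (\<Sum>i\<in>UNIV. \<bar>x $ i\<bar>)"
    by (rule norm_le_l1_cart)
  also have "\<dots> \<le> (\<Sum>i\<in>(UNIV::3 set). 2 * pi)"
    using x by (intro sum_mono) (auto simp: cell_def)
  also have "\<dots> \<le> 24"
    using pi_less_4 by simp
  finally show ?thesis .
qed

text \<open>
  Uniform continuity in a form adapted to moments of the kernel: increments over distances above some
  \<open>\<delta>\<close> are bounded, and there \<open>tdist2\<close> is bounded below.
\<close>

lemma continuous_periodic_modulus: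
  assumes c: "continuous_on UNIV \<psi>" and p: "periodic \<psi>" and \<epsilon>: "\<epsilon> > 0"
  obtains D where "D \<ge> 0"
    "\<And>x y. x \<in> cell \<Longrightarrow> y \<in> cell \<Longrightarrow> (norm (\<psi> x - \<psi> y :: real^3))\<^sup>2 \<le> \<epsilon> + D * tdist2 (x - y)"
proof -
  \<comment> \<open>The ball contains the cell, which lies in the ball of radius 24, and all points within 12 of it.\<close>
  let ?K = "cball (0::real^3) 50"
  have "uniformly_continuous_on ?K \<psi>"
    using c by (intro compact_uniformly_continuous continuous_on_subset[OF c]) auto
  then obtain \<delta> where \<delta>: "\<delta> > 0"
    and d: "\<And>x y. x \<in> ?K \<Longrightarrow> y \<in> ?K \<Longrightarrow> dist y x < \<delta> \<Longrightarrow> dist (\<psi> y) (\<psi> x) < sqrt \<epsilon>"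
    using \<epsilon> unfolding uniformly_continuous_on_def by (metis real_sqrt_gt_zero)
  have "bounded (\<psi> ` ?K)"
    using c by (intro compact_imp_bounded compact_continuous_image continuous_on_subset[OF c]) auto
  then obtain B where B: "\<And>x. x \<in> ?K \<Longrightarrow> norm (\<psi> x) \<le> B"
    unfolding bounded_iff by blast
  define D where "D = (2 * B)\<^sup>2 * (36 / \<delta>\<^sup>2)"
  have "D \<ge> 0" by (simp add: D_def)
  moreover have "(norm (\<psi> x - \<psi> y))\<^sup>2 \<le> \<epsilon> + D * tdist2 (x - y)" if x: "x \<in> cell" and y: "y \<in> cell" for x y
  proof -
    obtain x' where x': "\<psi> x' = \<psi> x" "norm (x' - y) \<le> 6 * sqrt (tdist2 (x - y))"
      using periodic_representative[OF p] by blast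
    have "6 * sqrt (tdist2 (x - y)) \<le> 6 * sqrt (4)"
      using tdist2_le[of "x - y"] by (intro mult_left_mono real_sqrt_le_mono) auto
    then have "norm (x' - y) \<le> 12"
      using x'(2) by simp
    then have K: "x' \<in> ?K" "y \<in> ?K"
      using norm_cell_le[OF y] norm_triangle_sub[of x' y] by auto
    have T: "0 \<le> D * tdist2 (x - y)"
      using \<open>D \<ge> 0\<close> by simp
    show ?thesis
    proof (cases "norm (x' - y) < \<delta>")
      case True
      then have "norm (\<psi> x - \<psi> y) \<le> sqrt \<epsilon>"
        using d[OF K(2) K(1)] x'(1) by (simp add: dist_norm)
      then have "(norm (\<psi> x - \<psi> y))\<^sup>2 \<le> (sqrt \<epsilon>)\<^sup>2"
        by (intro power_mono) auto
      then show ?thesis using T \<epsilon> by simp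
    next
      case False
      then have "\<delta> \<le> 6 * sqrt (tdist2 (x - y))"
        using x'(2) by simp
      then have "\<delta>\<^sup>2 \<le> (6 * sqrt (tdist2 (x - y)))\<^sup>2"
        using \<delta> by (intro power_mono) auto
      then have 1: "1 \<le> 36 / \<delta>\<^sup>2 * tdist2 (x - y)"
        using \<delta> by (simp add: power_mult_distrib field_simps)
      have "norm (\<psi> x - \<psi> y) \<le> 2 * B"
        using B[OF K(1)] B[OF K(2)] x'(1) norm_triangle_ineq4[of "\<psi> x" "\<psi> y"] by simp
      then have "(norm (\<psi> x - \<psi> y))\<^sup>2 \<le> (2 * B)\<^sup>2 * 1"
        by (simp only: mult_1_right) (rule power_mono, auto)
      also have "\<dots> \<le> (2 * B)\<^sup>2 * (36 / \<delta>\<^sup>2 * tdist2 (x - y))"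
        by (intro mult_left_mono 1) auto
      finally show ?thesis using \<epsilon> by (simp add: D_def mult_ac)
    qed
  qed
  ultimately show ?thesis using that by blast
qed

definition cell_volume :: real where "cell_volume = (LINT x|cellM. 1)"

lemma cell_volume_nonneg: "0 \<le> cell_volume"
  unfolding cell_volume_def by (rule integral_nonneg_AE) auto

text \<open>
  In the double integral of \<open>energy_gap\<close> replace \<open>u\<close> by a smooth field close to it in \<open>L\<^sup>2\<close>.  The error
  does not grow with \<open>m\<close> because the kernel has mass one, and for the smooth field the increments are
  small at the scale of the kernel.
\<close>

lemma energy_tendsto:
  assumes u: "u \<in> H_space" shows "(\<lambda>m. energy m u) \<longlonglongrightarrow> (L2_norm u)\<^sup>2"
proof -
  have uL: "u \<in> L2_torus" using u by (rule H_space_L2)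
  have gap: "\<exists>N. \<forall>m\<ge>N. (L2_norm u)\<^sup>2 - energy m u \<le> \<epsilon> * (6 + 3 * cell_volume)" if \<epsilon>: "\<epsilon> > 0" for \<epsilon>
  proof -
    obtain \<psi> where \<psi>: "\<psi> \<in> smooth_solenoidal" and d: "L2_norm (\<lambda>x. u x - \<psi> x) < sqrt \<epsilon>"
      using u \<epsilon> real_sqrt_gt_zero unfolding H_space_def by blast
    let ?w = "\<lambda>x. u x - \<psi> x"
    have wL: "?w \<in> L2_torus"
      by (rule L2_torus_diff[OF uL smooth_solenoidal_L2[OF \<psi>]])
    have w2: "(L2_norm ?w)\<^sup>2 \<le> \<epsilon>"
      using d power_mono[of "L2_norm ?w" "sqrt \<epsilon>" 2] \<epsilon> by simp
    have "periodic \<psi>" using \<psi> by (simp add: smooth_solenoidal_def)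
    then obtain D where D: "D \<ge> 0" and
      mod: "\<And>x y. x \<in> cell \<Longrightarrow> y \<in> cell \<Longrightarrow> (norm (\<psi> x - \<psi> y))\<^sup>2 \<le> \<epsilon> + D * tdist2 (x - y)"
      using continuous_periodic_modulus[OF smooth_solenoidal_continuous[OF \<psi>] _ \<epsilon>] by blast
    have bound: "(L2_norm u)\<^sup>2 - energy m u \<le> 3 * \<epsilon> + 3 / 2 * (\<epsilon> + D * (3 / (2 * real m + 4))) * cell_volume" for m
    proof -
      let ?n = "\<lambda>x. (norm (?w x))\<^sup>2"
      let ?A = "\<lambda>x y. 3 * (kern m (x - y) * (?n x * 1))"
      let ?B = "\<lambda>x y. 3 * (kern m (x - y) * (1 * ?n y))"
      let ?k = "\<lambda>z. 3 * (kern m z * (\<epsilon> + D * tdist2 z))"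
      let ?C = "\<lambda>x y. ?k (x - y) * (1 * 1)"
      have n: "integrable cellM ?n"
        by (rule L2_torus_integrable_norm2[OF wL])
      have A: "deg_int ?A" and B: "deg_int ?B"
        by (intro deg_int_cmult deg_int_trig trig_poly_kern n integrable_const_cell)+
      have C: "deg_int ?C"
        by (intro deg_int_trig trig_poly_intros trig_poly_kern trig_poly_tdist2 integrable_const_cell)
      have "dbl (\<lambda>x y. kern m (x - y) * (norm (u x - u y))\<^sup>2) \<le> dbl (\<lambda>x y. ?A x y + ?B x y + ?C x y)"
      proof (rule dbl_mono[OF deg_int_energy_gap[OF uL]])
        show "deg_int (\<lambda>x y. ?A x y + ?B x y + ?C x y)"
          by (intro degenerate.add A B C)
        fix x y :: "real^3" assume x: "x \<in> cell" and y: "y \<in> cell"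
        have "norm (u x - u y) \<le> norm (?w x) + norm (?w y) + norm (\<psi> x - \<psi> y)"
        proof -
          have "norm (u x - u y) = norm (?w x - ?w y + (\<psi> x - \<psi> y))"
            by (rule arg_cong[of _ _ norm]) simp
          then show ?thesis
            using norm_triangle_ineq[of "?w x - ?w y" "\<psi> x - \<psi> y"] norm_triangle_ineq4[of "?w x" "?w y"]
            by linarith
        qed
        then have "(norm (u x - u y))\<^sup>2 \<le> (norm (?w x) + norm (?w y) + norm (\<psi> x - \<psi> y))\<^sup>2"
          by (intro power_mono) auto
        also have "\<dots> \<le> 3 * (?n x + ?n y + (norm (\<psi> x - \<psi> y))\<^sup>2)"
          by (rule square_sum3_le)
        also have "\<dots> \<le> 3 * (?n x + ?n y + (\<epsilon> + D * tdist2 (x - y)))"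
          using mod[OF x y] by simp
        finally have "kern m (x - y) * (norm (u x - u y))\<^sup>2 \<le> kern m (x - y) * (3 * (?n x + ?n y + (\<epsilon> + D * tdist2 (x - y))))"
          by (intro mult_left_mono) auto
        then show "kern m (x - y) * (norm (u x - u y))\<^sup>2 \<le> ?A x y + ?B x y + ?C x y"
          by (simp add: algebra_simps)
      qed
      also have "\<dots> = dbl ?A + dbl ?B + dbl ?C"
        using A B C by (simp add: dbl_add degenerate.add)
      also have "dbl ?A = 3 * (L2_norm ?w)\<^sup>2"
        using dbl_left[of "kern m" ?n] by (simp only: dbl_cmult integral_kern L2_norm_power2 mult_1_right)
      also have "dbl ?B = 3 * (L2_norm ?w)\<^sup>2"
        using dbl_even[OF trig_poly_kern integrable_const_cell n kern_minus] dbl_left[of "kern m" ?n]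
        by (simp only: dbl_cmult integral_kern L2_norm_power2 mult_1_right)
      also have "dbl ?C = 3 * (\<epsilon> + D * (3 / (2 * real m + 4))) * cell_volume"
      proof -
        have "(LINT y|cellM. ?k (x - y)) = 3 * (\<epsilon> + D * (3 / (2 * real m + 4)))" for x
        proof -
          have i1: "integrable cellM (\<lambda>y. kern m (x - y))"
            by (rule trig_poly_shift_integrable[OF trig_poly_kern])
          have i2: "integrable cellM (\<lambda>y. kern m (x - y) * tdist2 (x - y))"
            by (rule trig_poly_shift_integrable[OF trig_poly.mult[OF trig_poly_kern trig_poly_tdist2]])
          have "(LINT y|cellM. ?k (x - y)) = (LINT y|cellM. 3 * \<epsilon> * kern m (x - y) + 3 * D * (kern m (x - y) * tdist2 (x - y)))"
            by (intro Bochner_Integration.integral_cong refl) (simp add: algebra_simps)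
          also have "\<dots> = 3 * (\<epsilon> + D * (3 / (2 * real m + 4)))"
            using i1 i2 by (simp add: integral_kern integral_kern_tdist2)
          finally show ?thesis .
        qed
        then have "dbl (\<lambda>x y. ?k (x - y) * (1 * 1)) = (LINT x|cellM. 1 * (3 * (\<epsilon> + D * (3 / (2 * real m + 4)))))"
          using dbl_left[of ?k "\<lambda>_. 1"] by (simp only:)
        then show ?thesis
          by (simp add: cell_volume_def mult_ac)
      qed
      finally have "2 * (L2_norm u)\<^sup>2 - 2 * energy m u \<le> 6 * (L2_norm ?w)\<^sup>2 + 3 * (\<epsilon> + D * (3 / (2 * real m + 4))) * cell_volume"
        using energy_gap[OF uL, of m] by simp
      moreover have "3 / 2 * (\<epsilon> + D * (3 / (2 * real m + 4))) * cell_volume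
          = (3 * (\<epsilon> + D * (3 / (2 * real m + 4))) * cell_volume) / 2"
        by (simp add: field_simps)
      ultimately show ?thesis
        using w2 by linarith
    qed
    obtain N :: nat where N: "D * 3 / \<epsilon> < real N"
      using reals_Archimedean2 by blast
    have "(L2_norm u)\<^sup>2 - energy m u \<le> \<epsilon> * (6 + 3 * cell_volume)" if "m \<ge> N" for m
    proof -
      have "D * 3 < \<epsilon> * real N"
        using N \<epsilon> by (simp add: field_simps)
      also have "\<dots> \<le> \<epsilon> * (2 * real m + 4)"
        using that \<epsilon> by (intro mult_left_mono) auto
      finally have "D * (3 / (2 * real m + 4)) \<le> \<epsilon>"
        by (simp add: field_simps)
      then have "3 / 2 * (\<epsilon> + D * (3 / (2 * real m + 4))) * cell_volume \<le> 3 / 2 * (\<epsilon> + \<epsilon>) * cell_volume"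
        using cell_volume_nonneg by (intro mult_right_mono mult_left_mono add_left_mono) auto
      then show ?thesis
        using bound[of m] \<epsilon> by (simp add: algebra_simps)
    qed
    then show ?thesis by blast
  qed
  show ?thesis
  proof (rule LIMSEQ_I)
    fix r :: real assume r: "r > 0"
    let ?c = "6 + 3 * cell_volume"
    have c: "?c > 0" using cell_volume_nonneg by simp
    obtain N where N: "\<And>m. m \<ge> N \<Longrightarrow> (L2_norm u)\<^sup>2 - energy m u \<le> r / (2 * ?c) * ?c"
      using gap[of "r / (2 * ?c)"] r c by (auto simp del: times_divide_eq_left)
    have "norm (energy m u - (L2_norm u)\<^sup>2) < r" if "m \<ge> N" for m
    proof -
      have "r / (2 * ?c) * ?c = r / 2"
        using c by (simp add: field_simps)
      then have "(L2_norm u)\<^sup>2 - energy m u \<le> r / 2"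
        using N[OF that] by (simp only:)
      then show ?thesis
        using energy_le[OF uL, of m] r by simp
    qed
    then show "\<exists>N. \<forall>m\<ge>N. norm (energy m u - (L2_norm u)\<^sup>2) < r" by blast
  qed
qed

section \<open>The energy flux through a finite scale\<close>

text \<open>
  The integral \<open>\<integral> u \<otimes> u : \<nabla>(K * u)\<close> with \<open>K = kern m\<close>: half the rate of change of \<open>energy m\<close> along a
  solution.
\<close>

definition flux :: "nat \<Rightarrow> (real^3 \<Rightarrow> real^3) \<Rightarrow> real" where
  "flux m u = (\<Sum>j\<in>UNIV. \<Sum>i\<in>UNIV. LINT x|cellM. u x $ j * u x $ i * conv (dkern m j) (\<lambda>y. u y $ i) x)"

text \<open>
  Differentiate the constant function \<open>K * 1 = 1\<close>.
\<close>

lemma integral_dkern: "(LINT y|cellM. dkern m j (x - y)) = 0"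
proof -
  have "(conv (kern m) (\<lambda>_. 1) has_derivative (\<lambda>h. conv (\<lambda>z. \<Sum>j\<in>UNIV. h $ j * dkern m j z) (\<lambda>_. 1) x)) (at x)"
    by (rule conv_has_derivative[OF trig_poly_kern integrable_const_cell kern_has_derivative])
  moreover have "conv (kern m) (\<lambda>_. 1) = (\<lambda>_. 1)"
    by (simp add: conv_def integral_kern fun_eq_iff)
  ultimately have "((\<lambda>_. 1) has_derivative (\<lambda>h. conv (\<lambda>z. \<Sum>j\<in>UNIV. h $ j * dkern m j z) (\<lambda>_. 1) x)) (at x)"
    by simp
  from has_derivative_unique[OF this has_derivative_const]
  have "conv (\<lambda>z. \<Sum>k\<in>UNIV. (axis j 1 :: real^3) $ k * dkern m k z) (\<lambda>_. 1) x = 0"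
    by metis
  then show ?thesis by (simp add: conv_def sum_axis)
qed

text \<open>
  The identity of Duchon and Robert.  Of the six terms of the expansion, the two in which one of
  the variables is absent vanish because \<open>\<nabla>K\<close> has mean zero; the two in which the component \<open>u\<^sub>j\<close>
  stands alone in its variable (\<open>?C\<close> and \<open>?D\<close>) vanish after summation over \<open>j\<close>, since the mollified
  field is solenoidal; the other two (\<open>?B\<close> and \<open>?E\<close>) agree up to sign because \<open>\<nabla>K\<close> is odd.
\<close>

lemma
  assumes u: "u \<in> L2_torus"
    and prod3: "\<And>i j k. integrable cellM (\<lambda>x. u x $ i * u x $ j * u x $ k)"
    and div: "\<And>x. (\<Sum>j\<in>UNIV. conv (dkern m j) (\<lambda>y. u y $ j) x) = 0"
  defines "\<Theta> \<equiv> \<lambda>x y. \<Sum>j\<in>UNIV. dkern m j (x - y) * ((u x $ j - u y $ j) * (norm (u x - u y))\<^sup>2)"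
  shows deg_int_flux: "deg_int \<Theta>" and flux_identity: "dbl \<Theta> = - 4 * flux m u"
proof -
  note k = deg_int_trig[OF trig_poly_dkern]
  note i1 = L2_torus_integrable[OF u]
  note i2 = L2_torus_integrable_mult[OF u u]
  let ?A = "\<lambda>j i x y. dkern m j (x - y) * ((u x $ j * u x $ i * u x $ i) * 1)"
  let ?B = "\<lambda>j i x y. dkern m j (x - y) * ((u x $ j * u x $ i) * u y $ i)"
  let ?C = "\<lambda>j i x y. dkern m j (x - y) * (u x $ j * (u y $ i * u y $ i))"
  let ?D = "\<lambda>j i x y. dkern m j (x - y) * ((u x $ i * u x $ i) * u y $ j)"
  let ?E = "\<lambda>j i x y. dkern m j (x - y) * (u x $ i * (u y $ j * u y $ i))"
  let ?F = "\<lambda>j i x y. dkern m j (x - y) * (1 * (u y $ j * u y $ i * u y $ i))"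
  have deg: "deg_int (?A j i)" "deg_int (?B j i)" "deg_int (?C j i)" "deg_int (?D j i)"
    "deg_int (?E j i)" "deg_int (?F j i)" for j i
    by (intro k i1 i2 prod3 integrable_const_cell)+
  let ?T = "\<lambda>j i x y. ?A j i x y - 2 * ?B j i x y + ?C j i x y - ?D j i x y + 2 * ?E j i x y - ?F j i x y"
  have degT: "deg_int (?T j i)" for j i
    by (intro degenerate.add deg_int_diff deg_int_cmult deg)
  have eq: "\<Theta> = (\<lambda>x y. \<Sum>j\<in>UNIV. \<Sum>i\<in>UNIV. ?T j i x y)"
    unfolding \<Theta>_def norm2_vec sum_distrib_left
    by (intro ext sum.cong refl) (simp add: algebra_simps)
  have degT': "deg_int (\<lambda>x y. \<Sum>i\<in>UNIV. ?T j i x y)" for j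
    by (intro deg_int_sum degT) simp
  show "deg_int \<Theta>"
    unfolding eq by (intro deg_int_sum degT) auto
  have dA: "dbl (?A j i) = 0" for j i
    using dbl_left[of "dkern m j" "\<lambda>x. u x $ j * u x $ i * u x $ i"]
    by (simp only: integral_dkern mult_zero_right) simp
  have dF: "dbl (?F j i) = 0" for j i
    using dbl_odd[OF trig_poly_dkern integrable_const_cell prod3 dkern_minus] dA[of j i]
    by (simp only: minus_zero)
  have dE: "dbl (?E j i) = - dbl (?B j i)" for j i
    by (rule dbl_odd[OF trig_poly_dkern i1 i2 dkern_minus])
  have dC: "dbl (?C j i) = - dbl (?D j i)" for j i
    by (rule dbl_odd[OF trig_poly_dkern i1 i2 dkern_minus])
  have dD: "(\<Sum>j\<in>UNIV. dbl (?D j i)) = 0" for i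
  proof -
    have "(\<Sum>j\<in>UNIV. dbl (?D j i)) = (\<Sum>j\<in>UNIV. LINT x|cellM. (u x $ i * u x $ i) * conv (dkern m j) (\<lambda>y. u y $ j) x)"
      by (intro sum.cong refl dbl_conv)
    also have "\<dots> = (LINT x|cellM. (\<Sum>j\<in>UNIV. (u x $ i * u x $ i) * conv (dkern m j) (\<lambda>y. u y $ j) x))"
    proof (rule Bochner_Integration.integral_sum[symmetric])
      fix j :: 3
      show "integrable cellM (\<lambda>x. (u x $ i * u x $ i) * conv (dkern m j) (\<lambda>y. u y $ j) x)"
        using trig_poly_mult_integrable[OF conv_trig_poly[OF trig_poly_dkern i1] i2] by (simp add: mult.commute)
    qed
    also have "\<dots> = 0"
      unfolding sum_distrib_left[symmetric] div by simp
    finally show ?thesis .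
  qed
  have dT: "dbl (?T j i) = - 4 * dbl (?B j i) - 2 * dbl (?D j i)" for j i
  proof -
    have "dbl (?T j i) = dbl (?A j i) - 2 * dbl (?B j i) + dbl (?C j i) - dbl (?D j i) + 2 * dbl (?E j i) - dbl (?F j i)"
      using deg[of j i] by (simp only: dbl_add dbl_diff dbl_cmult degenerate.add deg_int_diff deg_int_cmult)
    then show ?thesis unfolding dA dF dE dC by simp
  qed
  have "dbl \<Theta> = (\<Sum>j\<in>UNIV. \<Sum>i\<in>UNIV. dbl (?T j i))"
    unfolding eq using degT degT' by (simp only: dbl_sum finite)
  also have "\<dots> = - 4 * (\<Sum>j\<in>UNIV. \<Sum>i\<in>UNIV. dbl (?B j i)) - 2 * (\<Sum>j\<in>UNIV. \<Sum>i\<in>UNIV. dbl (?D j i))"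
    unfolding dT by (simp only: sum_subtractf sum_distrib_left)
  also have "(\<Sum>j\<in>UNIV. \<Sum>i\<in>UNIV. dbl (?D j i)) = 0"
    by (subst sum.swap) (simp only: dD sum.neutral_const)
  also have "(\<Sum>j\<in>UNIV. \<Sum>i\<in>UNIV. dbl (?B j i)) = flux m u"
    unfolding flux_def by (intro sum.cong refl dbl_conv)
  finally show "dbl \<Theta> = - 4 * flux m u" by simp
qed

text \<open>
  Near \<open>0\<close> the modulus is small; elsewhere it is bounded by its value at \<open>18\<close> and \<open>s\<^sup>2\<close> is bounded below.
  The form of the bound matches the two moments of \<open>majorant\<close>; the factor \<open>6\<close> is that of
  \<open>periodic_representative\<close>.
\<close>

lemma modulus_powr_bound:
  fixes \<omega> :: "real \<Rightarrow> real"
  assumes nn: "\<And>s. s > 0 \<Longrightarrow> \<omega> s \<ge> 0" and mono: "mono_on {0<..} \<omega>"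
    and lim: "(\<omega> \<longlongrightarrow> 0) (at_right 0)" and p: "p > 0" and \<epsilon>: "\<epsilon> > 0"
  obtains D where "D \<ge> 0" "\<And>s. 0 < s \<Longrightarrow> s \<le> 3 \<Longrightarrow> \<omega> (6 * s) powr p \<le> \<epsilon> + D * s\<^sup>2"
proof -
  have "eventually (\<lambda>s. \<omega> s < \<epsilon> powr (1 / p)) (at_right 0)"
    using order_tendstoD(2)[OF lim, of "\<epsilon> powr (1 / p)"] \<epsilon> by simp
  then obtain b where b: "b > 0" "\<And>s. 0 < s \<Longrightarrow> s < b \<Longrightarrow> \<omega> s < \<epsilon> powr (1 / p)"
    unfolding eventually_at_right_field by blast
  define D where "D = \<omega> 18 powr p * (36 / b\<^sup>2)"
  have "D \<ge> 0" by (simp add: D_def)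
  moreover have "\<omega> (6 * s) powr p \<le> \<epsilon> + D * s\<^sup>2" if s: "0 < s" "s \<le> 3" for s
  proof (cases "6 * s < b")
    case True
    then have "\<omega> (6 * s) powr p \<le> (\<epsilon> powr (1 / p)) powr p"
      using b(2)[of "6 * s"] s p nn[of "6 * s"] by (intro powr_mono2) auto
    also have "\<dots> = \<epsilon>"
      using \<epsilon> p by (simp add: powr_powr)
    finally show ?thesis using \<open>D \<ge> 0\<close> by (simp add: add_increasing2)
  next
    case False
    then have "b\<^sup>2 \<le> (6 * s)\<^sup>2"
      using b(1) by (intro power_mono) auto
    then have 1: "1 \<le> 36 / b\<^sup>2 * s\<^sup>2"
      using b(1) by (simp add: power_mult_distrib field_simps)
    have "\<omega> (6 * s) powr p \<le> \<omega> 18 powr p * 1"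
      using mono_onD[OF mono, of "6 * s" 18] s nn[of "6 * s"] p by (auto intro!: powr_mono2)
    also have "\<dots> \<le> \<omega> 18 powr p * (36 / b\<^sup>2 * s\<^sup>2)"
      by (intro mult_left_mono 1) auto
    finally show ?thesis using \<epsilon> by (simp add: D_def mult_ac)
  qed
  ultimately show ?thesis using that by blast
qed

text \<open>
  Splits a cube into the power \<open>p = 1 / \<alpha>\<close>, for which the Hoelder condition is integrable in time, and
  a remainder that the energy controls: one uses \<open>a\<^sup>3 \<le> a\<^sup>p\<close> for \<open>a \<le> 1\<close> and \<open>a \<le> a\<^sup>p\<close> for \<open>a \<ge> 1\<close>.
\<close>

lemma cube_le_powr:
  assumes "0 \<le> (a::real)" "1 \<le> p" "p \<le> 3" shows "a ^ 3 \<le> a powr p * (1 + a\<^sup>2)"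
proof (cases "a = 0")
  case False
  then have a: "a > 0" using assms by simp
  have p3: "a ^ 3 = a powr 3"
    using a by (simp add: powr_numeral)
  show ?thesis
  proof (cases "a \<le> 1")
    case True
    then have "a powr 3 \<le> a powr p"
      using a assms by (intro powr_mono') auto
    also have "\<dots> \<le> a powr p * (1 + a\<^sup>2)"
      by (simp add: algebra_simps)
    finally show ?thesis using p3 by simp
  next
    case False
    then have "a powr 1 \<le> a powr p"
      using assms by (intro powr_mono) auto
    then have "a powr 1 * a\<^sup>2 \<le> a powr p * a\<^sup>2"
      by (intro mult_right_mono) auto
    moreover have "a ^ 3 = a powr 1 * a\<^sup>2"
      using a by (simp add: power3_eq_cube power2_eq_square)
    ultimately show ?thesis by (simp add: distrib_left add_increasing)
  qed
qed simp

text \<open>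
  Apply the Hoelder condition to \<open>y\<close> and the translate of \<open>x\<close> nearest to it.  Raising it to the power
  \<open>1 / \<alpha>\<close> makes the dependence on the distance linear.  The extra factor \<open>sqrt (tdist2 (x - y))\<close> is the
  one that \<open>dkern_le_majorant\<close> provides.
\<close>

lemma holder_increment_bound:
  fixes u :: "real^3 \<Rightarrow> real^3" and \<omega> :: "real \<Rightarrow> real"
  assumes \<alpha>: "1 / 3 \<le> \<alpha>" "\<alpha> \<le> 1"
    and nn: "\<And>s. s > 0 \<Longrightarrow> \<omega> s \<ge> 0" and mono: "mono_on {0<..} \<omega>"
    and F: "F \<ge> 0" and per: "periodic u"
    and h: "\<And>x y. norm (u x - u y) \<le> F * \<omega> (norm (x - y)) * norm (x - y) powr \<alpha>"
    and D: "\<And>s. 0 < s \<Longrightarrow> s \<le> 3 \<Longrightarrow> \<omega> (6 * s) powr (1 / \<alpha>) \<le> \<epsilon> + D * s\<^sup>2"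
  shows "sqrt (tdist2 (x - y)) * norm (u x - u y) ^ 3
    \<le> F powr (1 / \<alpha>) * (6 * (\<epsilon> * tdist2 (x - y) + D * (tdist2 (x - y))\<^sup>2)) * (1 + 2 * (norm (u x))\<^sup>2 + 2 * (norm (u y))\<^sup>2)"
proof -
  define p where "p = 1 / \<alpha>"
  define S where "S = sqrt (tdist2 (x - y))"
  define a where "a = norm (u x - u y)"
  have p: "1 \<le> p" "p \<le> 3" and \<alpha>p: "\<alpha> * p = 1"
    using \<alpha> by (auto simp: p_def field_simps)
  have S2: "S\<^sup>2 = tdist2 (x - y)"
    by (simp add: S_def)
  have S4: "(tdist2 (x - y))\<^sup>2 = S ^ 4"
    by (simp flip: S2 add: power_mult[symmetric])
  have "S \<le> sqrt 9"
    unfolding S_def using tdist2_le[of "x - y"] by (intro real_sqrt_le_mono) auto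
  then have S3: "0 \<le> S" "S \<le> 3"
    by (auto simp: S_def)
  obtain x' where x': "u x' = u x" "norm (x' - y) \<le> 6 * S"
    using periodic_representative[OF per] unfolding S_def by blast
  have ap: "S * a powr p \<le> F powr p * (6 * (\<epsilon> * S\<^sup>2 + D * S ^ 4))"
  proof (cases "x' = y \<or> S = 0")
    case True
    then have "a = 0"
      using x' unfolding a_def by auto
    show ?thesis
    proof (cases "S = 0")
      case False
      then have "0 \<le> \<epsilon> + D * S\<^sup>2"
        using D[of S] S3 by (intro order_trans[OF powr_ge_zero]) auto
      then have "0 \<le> F powr p * (6 * (S\<^sup>2 * (\<epsilon> + D * S\<^sup>2)))"
        by simp
      then show ?thesis using \<open>a = 0\<close> by (simp add: algebra_simps power4_eq_xxxx power2_eq_square)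
    qed simp
  next
    case False
    let ?r = "norm (x' - y)"
    have r: "?r > 0" and S: "S > 0" using False S3 by auto
    have "\<omega> ?r \<le> \<omega> (6 * S)"
      using mono_onD[OF mono, of ?r "6 * S"] r S x'(2) by simp
    then have "F * \<omega> ?r * ?r powr \<alpha> \<le> F * \<omega> (6 * S) * (6 * S) powr \<alpha>"
      using x'(2) r S \<alpha> F nn[of "6 * S"] nn[of ?r] by (intro mult_mono powr_mono2) auto
    then have "a \<le> F * \<omega> (6 * S) * (6 * S) powr \<alpha>"
      using h[of x' y] x'(1) by (simp add: a_def)
    then have "a powr p \<le> (F * \<omega> (6 * S) * (6 * S) powr \<alpha>) powr p"
      using p by (intro powr_mono2) (auto simp: a_def)
    also have "\<dots> = F powr p * \<omega> (6 * S) powr p * (6 * S)"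
      using F S nn[of "6 * S"] \<alpha>p by (simp add: powr_mult powr_powr)
    also have "\<dots> \<le> F powr p * (\<epsilon> + D * S\<^sup>2) * (6 * S)"
      using D[of S] S S3 by (intro mult_right_mono mult_left_mono) (auto simp: p_def)
    finally have "S * a powr p \<le> S * (F powr p * (\<epsilon> + D * S\<^sup>2) * (6 * S))"
      using S by (intro mult_left_mono) auto
    then show ?thesis
      by (simp add: algebra_simps power4_eq_xxxx power2_eq_square)
  qed
  have a2: "1 + a\<^sup>2 \<le> 1 + 2 * (norm (u x))\<^sup>2 + 2 * (norm (u y))\<^sup>2"
  proof -
    have "a\<^sup>2 \<le> (norm (u x) + norm (u y))\<^sup>2"
      unfolding a_def by (intro power_mono norm_triangle_ineq4) auto
    also have "\<dots> \<le> 2 * (norm (u x))\<^sup>2 + 2 * (norm (u y))\<^sup>2"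
      using sum_squares_bound[of "norm (u x)" "norm (u y)"] by (simp add: power2_sum)
    finally show ?thesis by simp
  qed
  have "S * a ^ 3 \<le> S * (a powr p * (1 + a\<^sup>2))"
    using cube_le_powr[of a p] p S3 by (intro mult_left_mono) (auto simp: a_def)
  also have "\<dots> = (S * a powr p) * (1 + a\<^sup>2)" by simp
  also have "\<dots> \<le> (F powr p * (6 * (\<epsilon> * S\<^sup>2 + D * S ^ 4))) * (1 + 2 * (norm (u x))\<^sup>2 + 2 * (norm (u y))\<^sup>2)"
    by (rule mult_mono[OF ap a2 order_trans[OF _ ap]]) (use S3 in auto)
  finally show ?thesis
    unfolding S4 unfolding S2 unfolding p_def a_def S_def .
qed

text \<open>
  By \<open>flux_identity\<close> and the pointwise bounds, four times the flux is at most a double integral of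
  \<open>P (x - y)\<close> against \<open>1 + 2 |u(x)|\<^sup>2 + 2 |u(y)|\<^sup>2\<close>, where \<open>P\<close> is a non-negative trigonometric polynomial;
  this double integral is at most the mass of \<open>P\<close> times single integrals.
\<close>

lemma flux_bound_aux:
  fixes u :: "real^3 \<Rightarrow> real^3" and \<omega> :: "real \<Rightarrow> real"
  assumes \<alpha>: "1 / 3 \<le> \<alpha>" "\<alpha> \<le> 1"
    and nn: "\<And>s. s > 0 \<Longrightarrow> \<omega> s \<ge> 0" and mono: "mono_on {0<..} \<omega>"
    and F: "F \<ge> 0" and u: "u \<in> H_space"
    and h: "\<And>x y. norm (u x - u y) \<le> F * \<omega> (norm (x - y)) * norm (x - y) powr \<alpha>"
    and D: "\<And>s. 0 < s \<Longrightarrow> s \<le> 3 \<Longrightarrow> \<omega> (6 * s) powr (1 / \<alpha>) \<le> \<epsilon> + D * s\<^sup>2"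
    and nn2: "0 \<le> \<epsilon>" "0 \<le> D"
  shows "\<bar>flux m u\<bar> \<le> F powr (1 / \<alpha>) * (54 * \<epsilon> + 486 * D / (real m + 2)) * (cell_volume + 4 * (L2_norm u)\<^sup>2)"
proof -
  have uL: "u \<in> L2_torus" using u by (rule H_space_L2)
  then have per: "periodic u" by (simp add: L2_torus_def)
  note i1 = L2_torus_integrable[OF uL]
  note i2 = L2_torus_integrable_mult[OF uL uL]
  note n2 = L2_torus_integrable_norm2[OF uL]
  define B where "B = norm (u 0) + F * \<omega> 24 * 24 powr \<alpha>"
  have B: "norm (u x) \<le> B" if x: "x \<in> cell" for x
  proof (cases "x = 0")
    case True
    then show ?thesis using F nn[of 24] by (simp add: B_def)
  next
    case False
    have "F * \<omega> (norm x) * norm x powr \<alpha> \<le> F * \<omega> 24 * 24 powr \<alpha>"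
      using False norm_cell_le[OF x] nn[of "norm x"] nn[of 24] F \<alpha> mono_onD[OF mono, of "norm x" 24]
      by (intro mult_mono powr_mono2) auto
    then show ?thesis
      using h[of x 0] norm_triangle_sub[of "u x" "u 0"] by (simp add: B_def)
  qed
  have prod3: "integrable cellM (\<lambda>x. u x $ i * u x $ j * u x $ k)" for i j k
  proof (rule Bochner_Integration.integrable_bound[where f = "\<lambda>x. B * (u x $ j * u x $ k)"])
    show "integrable cellM (\<lambda>x. B * (u x $ j * u x $ k))"
      using i2 by simp
    show "(\<lambda>x. u x $ i * u x $ j * u x $ k) \<in> borel_measurable cellM"
      by (intro borel_measurable_times L2_torus_measurable uL)
    have "\<bar>u x $ i\<bar> \<le> \<bar>B\<bar>" if "x \<in> cell" for x
      using B[OF that] component_le_norm_cart[of "u x" i] by linarith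
    then show "AE x in cellM. norm (u x $ i * u x $ j * u x $ k) \<le> norm (B * (u x $ j * u x $ k))"
      by (intro AE_I2) (auto simp: abs_mult mult.assoc intro!: mult_right_mono)
  qed
  \<comment> \<open>The factor 18 in \<open>P\<close> is 3, for the sum over \<open>j\<close>, times the 6 of \<open>holder_increment_bound\<close>.\<close>
  define \<Theta> where "\<Theta> = (\<lambda>x y. \<Sum>j\<in>UNIV. dkern m j (x - y) * ((u x $ j - u y $ j) * (norm (u x - u y))\<^sup>2))"
  have deg\<Theta>: "deg_int \<Theta>" and id: "dbl \<Theta> = - 4 * flux m u"
    unfolding \<Theta>_def using deg_int_flux[OF uL prod3 H_space_conv_dkern[OF u]]
      flux_identity[OF uL prod3 H_space_conv_dkern[OF u]] by auto
  define P where "P = (\<lambda>z. 18 * (\<epsilon> * (majorant m z * tdist2 z) + D * (majorant m z * (tdist2 z)\<^sup>2)))"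
  have tP: "trig_poly P"
    unfolding P_def by (intro trig_poly_intros trig_poly_majorant trig_poly_tdist2)
  have P0: "0 \<le> P z" for z
    unfolding P_def using nn2 by simp
  have Peven: "P (- z) = P z" for z
    by (simp add: P_def majorant_def hprod_def tdist2_def)
  let ?Fp = "F powr (1 / \<alpha>)"
  let ?n = "\<lambda>x. (norm (u x))\<^sup>2"
  let ?X = "\<lambda>x y. P (x - y) * ((1 + 2 * ?n x) * 1)"
  let ?Y = "\<lambda>x y. P (x - y) * (1 * (2 * ?n y))"
  let ?G = "\<lambda>x y. ?Fp * (?X x y + ?Y x y)"
  have iX: "integrable cellM (\<lambda>x. 1 + 2 * ?n x)" "integrable cellM (\<lambda>x. 2 * ?n x)"
    using n2 by auto
  have X: "deg_int ?X" and Y: "deg_int ?Y"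
    by (intro deg_int_trig tP iX integrable_const_cell)+
  have G: "deg_int ?G"
    by (intro deg_int_cmult degenerate.add X Y)
  have pt: "\<bar>\<Theta> x y\<bar> \<le> ?G x y" for x y
  proof -
    let ?a = "norm (u x - u y)" and ?S = "sqrt (tdist2 (x - y))"
    have "\<bar>\<Theta> x y\<bar> \<le> (\<Sum>j\<in>(UNIV::3 set). majorant m (x - y) * ?S * (?a * ?a\<^sup>2))"
      unfolding \<Theta>_def
    proof (rule order_trans[OF sum_abs], rule sum_mono)
      fix j
      have "\<bar>u x $ j - u y $ j\<bar> \<le> ?a"
        using component_le_norm_cart[of "u x - u y" j] by simp
      then show "\<bar>dkern m j (x - y) * ((u x $ j - u y $ j) * ?a\<^sup>2)\<bar> \<le> majorant m (x - y) * ?S * (?a * ?a\<^sup>2)"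
        unfolding abs_mult by (intro mult_mono dkern_le_majorant) auto
    qed
    also have "\<dots> = 3 * majorant m (x - y) * (?S * ?a ^ 3)"
      by (simp add: power3_eq_cube power2_eq_square)
    also have "\<dots> \<le> 3 * majorant m (x - y) * (?Fp * (6 * (\<epsilon> * tdist2 (x - y) + D * (tdist2 (x - y))\<^sup>2)) * (1 + 2 * ?n x + 2 * ?n y))"
      using holder_increment_bound[OF \<alpha> nn mono F per h D] by (intro mult_left_mono) auto
    also have "\<dots> = ?G x y"
      by (simp add: P_def algebra_simps)
    finally show ?thesis .
  qed
  have "dbl \<Theta> \<le> dbl ?G"
    using pt by (intro dbl_mono deg\<Theta> G) (auto simp: abs_le_iff)
  moreover have "dbl (\<lambda>x y. (-1) * \<Theta> x y) \<le> dbl ?G"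
    using pt by (intro dbl_mono deg_int_cmult deg\<Theta> G) (auto simp: abs_le_iff)
  ultimately have *: "4 * \<bar>flux m u\<bar> \<le> dbl ?G"
    unfolding dbl_cmult id by auto
  define c where "c = 18 * (12 * \<epsilon> + 108 * D / (real m + 2))"
  have intP: "(LINT y|cellM. P (x - y)) \<le> c" for x
  proof -
    have i: "integrable cellM (\<lambda>y. majorant m (x - y) * tdist2 (x - y))"
      "integrable cellM (\<lambda>y. majorant m (x - y) * (tdist2 (x - y))\<^sup>2)"
      using trig_poly_shift_integrable[OF trig_poly.mult[OF trig_poly_majorant trig_poly_tdist2]]
        trig_poly_shift_integrable[OF trig_poly.mult[OF trig_poly_majorant trig_poly_power[OF trig_poly_tdist2]]] by auto
    have "(LINT y|cellM. P (x - y)) = 18 * (\<epsilon> * (LINT y|cellM. majorant m (x - y) * tdist2 (x - y))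
        + D * (LINT y|cellM. majorant m (x - y) * (tdist2 (x - y))\<^sup>2))"
      unfolding P_def using i by simp
    also have "\<dots> \<le> 18 * (\<epsilon> * 12 + D * (108 / (real m + 2)))"
      using nn2 integral_majorant_tdist2 integral_majorant_tdist4
      by (intro mult_left_mono add_mono) auto
    finally show ?thesis by (simp add: c_def mult_ac)
  qed
  have left: "dbl (\<lambda>x y. P (x - y) * (f x * 1)) \<le> c * (LINT x|cellM. f x)"
    if f: "integrable cellM f" "\<And>x. 0 \<le> f x" for f
  proof -
    have "(LINT x|cellM. f x * (LINT y|cellM. P (x - y))) \<le> (LINT x|cellM. f x * c)"
    proof (rule integral_mono)
      show "integrable cellM (\<lambda>x. f x * (LINT y|cellM. P (x - y)))"
        using trig_poly_mult_integrable[OF conv_trig_poly[OF tP integrable_const_cell[of 1]] f(1)]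
        by (simp add: conv_def mult.commute)
      show "integrable cellM (\<lambda>x. f x * c)" using f by simp
      show "f x * (LINT y|cellM. P (x - y)) \<le> f x * c" for x
        by (intro mult_left_mono intP f)
    qed
    then show ?thesis
      using dbl_left[of P f] by (simp add: mult.commute)
  qed
  have "dbl ?G = ?Fp * (dbl ?X + dbl ?Y)"
    using X Y by (simp only: dbl_cmult dbl_add)
  also have "dbl ?Y = dbl (\<lambda>x y. P (x - y) * ((2 * ?n x) * 1))"
    by (rule dbl_even[OF tP integrable_const_cell iX(2) Peven])
  also have "?Fp * (dbl ?X + dbl (\<lambda>x y. P (x - y) * ((2 * ?n x) * 1)))
      \<le> ?Fp * (c * (LINT x|cellM. 1 + 2 * ?n x) + c * (LINT x|cellM. 2 * ?n x))"
    by (intro mult_left_mono add_mono left iX) auto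
  also have "\<dots> = ?Fp * c * (cell_volume + 4 * (L2_norm u)\<^sup>2)"
    using n2 by (simp add: cell_volume_def L2_norm_power2 algebra_simps)
  finally have "4 * \<bar>flux m u\<bar> \<le> ?Fp * c * (cell_volume + 4 * (L2_norm u)\<^sup>2)"
    using * by linarith
  moreover have "c = 4 * (54 * \<epsilon> + 486 * D / (real m + 2))"
    by (simp add: c_def field_simps)
  then have "?Fp * c * (cell_volume + 4 * (L2_norm u)\<^sup>2)
      = 4 * (?Fp * (54 * \<epsilon> + 486 * D / (real m + 2)) * (cell_volume + 4 * (L2_norm u)\<^sup>2))"
    by (simp only: mult_ac)
  ultimately show ?thesis
    by linarith
qed

lemma flux_bound:
  fixes \<omega> :: "real \<Rightarrow> real"
  assumes \<alpha>: "1 / 3 \<le> \<alpha>" "\<alpha> \<le> 1"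
    and nn: "\<And>s. s > 0 \<Longrightarrow> \<omega> s \<ge> 0" and mono: "mono_on {0<..} \<omega>"
    and lim: "(\<omega> \<longlongrightarrow> 0) (at_right 0)" and \<epsilon>: "\<epsilon> > 0"
  shows "\<exists>N. \<forall>m\<ge>N. \<forall>u F. u \<in> H_space \<longrightarrow> 0 \<le> F \<longrightarrow>
      (\<forall>x y. norm (u x - u y) \<le> F * \<omega> (norm (x - y)) * norm (x - y) powr \<alpha>) \<longrightarrow>
      \<bar>flux m u\<bar> \<le> \<epsilon> * F powr (1 / \<alpha>) * (cell_volume + 4 * (L2_norm u)\<^sup>2)"
proof -
  have e: "\<epsilon> / 108 > 0" and p: "1 / \<alpha> > 0" using \<epsilon> \<alpha> by auto
  \<comment> \<open>With \<open>\<epsilon> / 108\<close>, each of the two contributions in \<open>flux_bound_aux\<close> is at most \<open>\<epsilon> / 2\<close>.\<close>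
  obtain D where D: "D \<ge> 0" "\<And>s. 0 < s \<Longrightarrow> s \<le> 3 \<Longrightarrow> \<omega> (6 * s) powr (1 / \<alpha>) \<le> \<epsilon> / 108 + D * s\<^sup>2"
    using modulus_powr_bound[OF nn mono lim p e] by blast
  obtain N :: nat where N: "972 * D / \<epsilon> < real N"
    using reals_Archimedean2 by blast
  have "\<bar>flux m u\<bar> \<le> \<epsilon> * F powr (1 / \<alpha>) * (cell_volume + 4 * (L2_norm u)\<^sup>2)"
    if m: "m \<ge> N" and u: "u \<in> H_space" and F: "0 \<le> F"
      and h: "\<forall>x y. norm (u x - u y) \<le> F * \<omega> (norm (x - y)) * norm (x - y) powr \<alpha>" for m u F
  proof -
    have "972 * D < \<epsilon> * real N"
      using N \<epsilon> by (simp add: field_simps)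
    also have "\<dots> \<le> \<epsilon> * (real m + 2)"
      using m \<epsilon> by (intro mult_left_mono) auto
    finally have "486 * D / (real m + 2) \<le> \<epsilon> / 2"
      by (simp add: field_simps)
    then have c: "54 * (\<epsilon> / 108) + 486 * D / (real m + 2) \<le> \<epsilon>"
      by simp
    have "\<bar>flux m u\<bar> \<le> F powr (1 / \<alpha>) * (54 * (\<epsilon> / 108) + 486 * D / (real m + 2)) * (cell_volume + 4 * (L2_norm u)\<^sup>2)"
      using h e by (intro flux_bound_aux[OF \<alpha> nn mono F u _ D(2) _ D(1)]) auto
    also have "\<dots> \<le> F powr (1 / \<alpha>) * \<epsilon> * (cell_volume + 4 * (L2_norm u)\<^sup>2)"
      using c cell_volume_nonneg by (intro mult_right_mono mult_left_mono) auto
    finally show ?thesis by (simp add: mult_ac)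
  qed
  then show ?thesis by blast
qed

section \<open>Test fields with smooth cut-offs in time\<close>

text \<open>
  The functions \<open>s\<^sup>-\<^sup>m exp(-1 / s)\<close>, extended by \<open>0\<close>.  Derivatives of members of the family are linear
  combinations of members, which makes all of them smooth.
\<close>

definition flat :: "nat \<Rightarrow> real \<Rightarrow> real" where
  "flat m s = (if s > 0 then inverse s ^ m * exp (- inverse s) else 0)"

lemma flat_nonneg [simp]: "0 \<le> flat m s"
  by (simp add: flat_def)

lemma flat_tendsto_0: "(flat m \<longlongrightarrow> 0) (at 0)"
proof -
  have "((\<lambda>s. inverse s ^ m / exp (inverse s)) \<longlongrightarrow> 0) (at_right (0::real))"
    by (rule filterlim_compose[OF tendsto_power_div_exp_0 filterlim_inverse_at_top_right])
  then have "(flat m \<longlongrightarrow> 0) (at_right 0)"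
    by (rule Lim_transform_eventually)
       (auto simp: flat_def exp_minus divide_inverse eventually_at_filter)
  moreover have "(flat m \<longlongrightarrow> 0) (at_left 0)"
    by (rule Lim_transform_eventually[OF tendsto_const]) (auto simp: flat_def eventually_at_filter)
  ultimately show ?thesis by (rule filterlim_split_at[rotated])
qed

lemma flat_has_derivative: "(flat m has_real_derivative flat (m + 2) s - real m * flat (m + 1) s) (at s)"
proof -
  consider "s > 0" | "s < 0" | "s = 0" by linarith
  then show ?thesis
  proof cases
    case 1
    have "((\<lambda>s. inverse s ^ m * exp (- inverse s)) has_real_derivative
        inverse s ^ m * (exp (- inverse s) * (inverse s)\<^sup>2) - real m * inverse s ^ (m - 1) * (inverse s)\<^sup>2 * exp (- inverse s)) (at s)"
      using 1 by (auto intro!: derivative_eq_intros simp: power2_eq_square algebra_simps)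
    moreover have "inverse s ^ m * (exp (- inverse s) * (inverse s)\<^sup>2) - real m * inverse s ^ (m - 1) * (inverse s)\<^sup>2 * exp (- inverse s)
        = flat (m + 2) s - real m * flat (m + 1) s"
      using 1 by (cases m) (auto simp: flat_def power2_eq_square algebra_simps)
    ultimately have "((\<lambda>s. inverse s ^ m * exp (- inverse s)) has_real_derivative flat (m + 2) s - real m * flat (m + 1) s) (at s)"
      by simp
    then show ?thesis
      by (rule has_field_derivative_transform_within_open[where S = "{0<..}"]) (use 1 in \<open>auto simp: flat_def\<close>)
  next
    case 2
    have "((\<lambda>s. 0) has_real_derivative flat (m + 2) s - real m * flat (m + 1) s) (at s)"
      using 2 by (simp add: flat_def)
    then show ?thesis
      by (rule has_field_derivative_transform_within_open[where S = "{..<0}"]) (use 2 in \<open>auto simp: flat_def\<close>)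
  next
    case 3
    have "((\<lambda>h. (flat m (0 + h) - flat m 0) / h) \<longlongrightarrow> 0) (at 0)"
      by (rule Lim_transform_eventually[OF flat_tendsto_0[of "m + 1"]])
         (auto simp: flat_def eventually_at_filter field_simps)
    then have "(flat m has_real_derivative 0) (at 0)"
      by (simp add: DERIV_def)
    then show ?thesis using 3 by (simp add: flat_def)
  qed
qed

lemma flat_continuous: "continuous_on S f \<Longrightarrow> continuous_on S (\<lambda>x. flat m (f x))"
  by (rule continuous_on_compose2[of UNIV "flat m"])
     (auto intro!: continuous_at_imp_continuous_on DERIV_isCont[OF flat_has_derivative])

lemma cutoff_measurable: "(\<lambda>t. flat m (l * (\<tau> - t))) \<in> borel_measurable (lebesgue_on S)"
proof -
  have "continuous_on UNIV (\<lambda>t. flat m (l * (\<tau> - t)))"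
    by (intro flat_continuous continuous_intros)
  then show ?thesis
    by (intro measurable_restrict_space1 measurable_completion) (simp add: borel_measurable_continuous_onI)
qed

lemma flat_0_le: "flat 0 s \<le> 1"
  by (simp add: flat_def)

lemma cutoff_has_derivative:
  "((\<lambda>t. flat m (l * (\<tau> - t))) has_real_derivative - l * (flat (m + 2) (l * (\<tau> - t)) - real m * flat (m + 1) (l * (\<tau> - t)))) (at t within S)"
proof -
  have "((\<lambda>t. l * (\<tau> - t)) has_real_derivative - l) (at t within S)"
    by (auto intro!: derivative_eq_intros)
  from DERIV_chain2[OF flat_has_derivative this]
  show ?thesis by (simp add: mult.commute)
qed

text \<open>
  Contains the fields \<open>exp(-1 / (l (\<tau> - t))) a(x) c\<close>, cut off at time \<open>\<tau>\<close>, and is closed under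
  directional derivatives.  As \<open>l\<close> grows, the time factor approaches the indicator of \<open>t < \<tau>\<close>.
\<close>

inductive cutoff_field :: "real \<Rightarrow> real \<Rightarrow> (real \<times> (real^3) \<Rightarrow> real^3) \<Rightarrow> bool" for l \<tau> where
  prod: "trig_poly a \<Longrightarrow> cutoff_field l \<tau> (\<lambda>p. (flat m (l * (\<tau> - fst p)) * a (snd p)) *\<^sub>R c)"
| add: "cutoff_field l \<tau> f \<Longrightarrow> cutoff_field l \<tau> g \<Longrightarrow> cutoff_field l \<tau> (\<lambda>p. f p + g p)"

lemma cutoff_field_has_derivative:
  "cutoff_field l \<tau> f \<Longrightarrow> \<exists>f'. (\<forall>p. (f has_derivative f' p) (at p)) \<and> (\<forall>h. cutoff_field l \<tau> (\<lambda>p. f' p h))"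
proof (induction rule: cutoff_field.induct)
  case (prod a m c)
  obtain a' where a': "\<And>x. (a has_derivative a' x) (at x)" "\<And>h. trig_poly (\<lambda>x. a' x h)"
    using trig_poly_has_derivative[OF prod] by blast
  define d where "d t = - l * (flat (m + 2) (l * (\<tau> - t)) - real m * flat (m + 1) (l * (\<tau> - t)))" for t
  let ?g = "\<lambda>p :: real \<times> (real^3). flat m (l * (\<tau> - fst p))"
  let ?D = "\<lambda>p h. (?g p * a' (snd p) (snd h) + (fst h * d (fst p)) * a (snd p)) *\<^sub>R c"
  have "((\<lambda>p. (?g p * a (snd p)) *\<^sub>R c) has_derivative ?D p) (at p)" for p :: "real \<times> (real^3)"
  proof -
    have "((\<lambda>t. flat m (l * (\<tau> - t))) has_derivative (\<lambda>h. h * d (fst p))) (at (fst p))"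
      using cutoff_has_derivative[of m l \<tau> "fst p" UNIV]
      by (simp only: has_field_derivative_def d_def[symmetric] mult_commute_abs)
    from has_derivative_compose[OF has_derivative_fst[OF has_derivative_ident] this]
    have g: "(?g has_derivative (\<lambda>h. fst h * d (fst p))) (at p)" by simp
    have "((\<lambda>p. a (snd p)) has_derivative (\<lambda>h. a' (snd p) (snd h))) (at p)"
      by (rule has_derivative_compose[OF has_derivative_snd[OF has_derivative_ident] a'(1)])
    from has_derivative_scaleR_left[OF has_derivative_mult[OF g this]]
    show ?thesis .
  qed
  moreover have "cutoff_field l \<tau> (\<lambda>p. ?D p h)" for h
  proof -
    have "cutoff_field l \<tau> (\<lambda>p. (flat m (l * (\<tau> - fst p)) * a' (snd p) (snd h)) *\<^sub>R c
        + (flat (m + 2) (l * (\<tau> - fst p)) * a (snd p)) *\<^sub>R ((- l * fst h) *\<^sub>R c)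
        + (flat (m + 1) (l * (\<tau> - fst p)) * a (snd p)) *\<^sub>R ((l * real m * fst h) *\<^sub>R c))"
      by (intro cutoff_field.intros a' prod)
    moreover have "(flat m (l * (\<tau> - fst p)) * a' (snd p) (snd h)) *\<^sub>R c
        + (flat (m + 2) (l * (\<tau> - fst p)) * a (snd p)) *\<^sub>R ((- l * fst h) *\<^sub>R c)
        + (flat (m + 1) (l * (\<tau> - fst p)) * a (snd p)) *\<^sub>R ((l * real m * fst h) *\<^sub>R c) = ?D p h" for p
      unfolding d_def scaleR_scaleR scaleR_add_left[symmetric]
      by (rule arg_cong[where f = "\<lambda>r. r *\<^sub>R c"]) (simp add: algebra_simps)
    ultimately show ?thesis by (simp only:)
  qed
  ultimately show ?case by (intro exI[of _ ?D]) blast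
next
  case (add f g)
  then obtain f' g' where "\<And>p. (f has_derivative f' p) (at p)" "\<And>h. cutoff_field l \<tau> (\<lambda>p. f' p h)"
    "\<And>p. (g has_derivative g' p) (at p)" "\<And>h. cutoff_field l \<tau> (\<lambda>p. g' p h)" by blast
  then show ?case
    by (intro exI[of _ "\<lambda>p h. f' p h + g' p h"]) (auto intro: cutoff_field.add has_derivative_add)
qed

text \<open>
  A class of differentiable functions closed under directional derivatives consists of \<open>C\<^sup>k\<close> functions.
\<close>

lemma cutoff_field_Ck_on: "cutoff_field l \<tau> f \<Longrightarrow> Ck_on k S f"
proof (induction k arbitrary: f)
  case 0
  then obtain f' where "\<And>p. (f has_derivative f' p) (at p)"
    using cutoff_field_has_derivative[OF 0] by metis
  then have "continuous_on S f"
    by (intro continuous_at_imp_continuous_on ballI has_derivative_continuous)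
  then show ?case by simp
next
  case (Suc k)
  then obtain f' where f': "\<And>p. (f has_derivative f' p) (at p)" "\<And>h. cutoff_field l \<tau> (\<lambda>p. f' p h)"
    using cutoff_field_has_derivative[OF Suc.prems] by metis
  have "\<forall>p\<in>S. (f has_derivative f' p) (at p within S)"
    by (rule ballI) (rule has_derivative_at_withinI[OF f'(1)])
  moreover have "\<forall>b\<in>Basis. Ck_on k S (\<lambda>p. f' p b)"
    by (rule ballI) (rule Suc.IH[OF f'(2)])
  ultimately show ?case
    unfolding Ck_on.simps by (intro exI[of _ f'] conjI)
qed

definition mollified :: "nat \<Rightarrow> (real^3 \<Rightarrow> real^3) \<Rightarrow> real^3 \<Rightarrow> real^3" where
  "mollified m a x = (\<chi> i. conv (kern m) (\<lambda>y. a y $ i) x)"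

lemma conv_kern_has_derivative:
  assumes "integrable cellM r"
  shows "(conv (kern m) r has_derivative (\<lambda>h. \<Sum>j\<in>UNIV. h $ j * conv (dkern m j) r x)) (at x)"
proof -
  have eq: "conv (\<lambda>z. \<Sum>j\<in>UNIV. h $ j * dkern m j z) r x = (\<Sum>j\<in>UNIV. h $ j * conv (dkern m j) r x)" for h
  proof -
    have "conv (\<lambda>z. \<Sum>j\<in>UNIV. h $ j * dkern m j z) r x = (LINT y|cellM. (\<Sum>j\<in>UNIV. h $ j * (dkern m j (x - y) * r y)))"
      unfolding conv_def by (simp add: sum_distrib_right mult.assoc)
    also have "\<dots> = (\<Sum>j\<in>UNIV. h $ j * conv (dkern m j) r x)"
      using conv_integrable[OF trig_poly_dkern assms] by (simp add: conv_def)
    finally show ?thesis .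
  qed
  have "(conv (kern m) r has_derivative (\<lambda>h. conv (\<lambda>z. \<Sum>j\<in>UNIV. h $ j * dkern m j z) r x)) (at x)"
    by (rule conv_has_derivative[OF trig_poly_kern assms kern_has_derivative])
  then show ?thesis unfolding eq .
qed

lemma mollified_has_derivative:
  assumes "a \<in> L2_torus"
  shows "(mollified m a has_derivative (\<lambda>h. \<chi> i. \<Sum>j\<in>UNIV. h $ j * conv (dkern m j) (\<lambda>y. a y $ i) x)) (at x)"
proof -
  let ?c = "\<lambda>i. conv (kern m) (\<lambda>y. a y $ i)" and ?d = "\<lambda>i h. \<Sum>j\<in>UNIV. h $ j * conv (dkern m j) (\<lambda>y. a y $ i) x"
  have d: "(?c i has_derivative ?d i) (at x)" for i
    by (rule conv_kern_has_derivative[OF L2_torus_integrable[OF assms]])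
  have "((\<lambda>x. ?c 1 x *\<^sub>R axis 1 1 + ?c 2 x *\<^sub>R axis 2 1 + ?c 3 x *\<^sub>R axis 3 1 :: real^3) has_derivative
      (\<lambda>h. ?d 1 h *\<^sub>R axis 1 1 + ?d 2 h *\<^sub>R axis 2 1 + ?d 3 h *\<^sub>R axis 3 1)) (at x)"
    by (intro has_derivative_add has_derivative_scaleR_left d)
  moreover have "(\<lambda>x. ?c 1 x *\<^sub>R axis 1 1 + ?c 2 x *\<^sub>R axis 2 1 + ?c 3 x *\<^sub>R axis 3 1 :: real^3) = mollified m a"
    by (simp add: mollified_def fun_eq_iff vec_eq_iff forall_3 axis_def)
  moreover have "(\<lambda>h. ?d 1 h *\<^sub>R axis 1 1 + ?d 2 h *\<^sub>R axis 2 1 + ?d 3 h *\<^sub>R axis 3 1 :: real^3) = (\<lambda>h. \<chi> i. ?d i h)"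
    by (simp add: fun_eq_iff vec_eq_iff forall_3 axis_def)
  ultimately show ?thesis by (simp only:)
qed

definition weakly_solenoidal :: "nat \<Rightarrow> (real^3 \<Rightarrow> real^3) \<Rightarrow> bool" where
  "weakly_solenoidal m a \<longleftrightarrow> (\<forall>x. (\<Sum>j\<in>UNIV. conv (dkern m j) (\<lambda>y. a y $ j) x) = 0)"

lemma scaled_mollified_has_derivative:
  assumes "a \<in> L2_torus"
  shows "((\<lambda>x. r *\<^sub>R mollified m a x) has_derivative
      (\<lambda>h. r *\<^sub>R (\<chi> i. \<Sum>j\<in>UNIV. h $ j * conv (dkern m j) (\<lambda>y. a y $ i) x))) (at x)"
  by (rule has_derivative_scaleR_right[OF mollified_has_derivative[OF assms]])

lemma jacobian_scaled_mollified:
  assumes "a \<in> L2_torus"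
  shows "jacobian (\<lambda>x. r *\<^sub>R mollified m a x) (at x) = r *\<^sub>R (\<chi> i j. conv (dkern m j) (\<lambda>y. a y $ i) x)"
  using frechet_derivative_at[OF scaled_mollified_has_derivative[OF assms, of r m x], symmetric]
  by (simp add: jacobian_def matrix_def vec_eq_iff sum_axis)

text \<open>
  A mollified field is a trigonometric polynomial in each component, so it only has to be solenoidal
  to be admissible as the spatial part of a test function.
\<close>

lemma mollified_test_function:
  assumes a: "a \<in> L2_torus" and div: "weakly_solenoidal m a" and \<tau>: "\<tau> < T" and l: "l > 0"
  shows "(\<lambda>t x. flat 0 (l * (\<tau> - t)) *\<^sub>R mollified m a x) \<in> test_functions T"
proof -
  have t: "trig_poly (conv (kern m) (\<lambda>y. a y $ i))" for i
    by (rule conv_trig_poly[OF trig_poly_kern L2_torus_integrable[OF a]])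
  have "periodic (\<lambda>x. r *\<^sub>R mollified m a x)" for r
    using trig_poly_periodic[OF t] by (simp add: periodic_def mollified_def)
  moreover have "smooth_on S (\<lambda>(t, x). flat 0 (l * (\<tau> - t)) *\<^sub>R mollified m a x)" for S
  proof -
    let ?f = "\<lambda>i p. (flat 0 (l * (\<tau> - fst p)) * conv (kern m) (\<lambda>y. a y $ i) (snd p)) *\<^sub>R (axis i 1 :: real^3)"
    have "cutoff_field l \<tau> (\<lambda>p. ?f 1 p + ?f 2 p + ?f 3 p)"
      by (intro cutoff_field.intros t)
    moreover have "(\<lambda>p. ?f 1 p + ?f 2 p + ?f 3 p) = (\<lambda>(t, x). flat 0 (l * (\<tau> - t)) *\<^sub>R mollified m a x)"
      by (simp add: fun_eq_iff mollified_def vec_eq_iff forall_3 axis_def)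
    ultimately show ?thesis
      using cutoff_field_Ck_on by (simp add: smooth_on_def)
  qed
  moreover have "\<forall>t\<in>{0..<T}. t > \<tau> \<longrightarrow> (\<forall>x. flat 0 (l * (\<tau> - t)) *\<^sub>R mollified m a x = 0)"
    using l by (auto simp: flat_def zero_less_mult_iff)
  moreover have "divergence (\<lambda>x. r *\<^sub>R mollified m a x) x = 0" for r x
  proof -
    have "divergence (\<lambda>x. r *\<^sub>R mollified m a x) x = r * (\<Sum>i\<in>UNIV. conv (dkern m i) (\<lambda>y. a y $ i) x)"
      by (subst divergence_eq_sum[OF scaled_mollified_has_derivative[OF a]]) (simp add: sum_axis sum_distrib_left)
    then show ?thesis using div by (simp add: weakly_solenoidal_def)
  qed
  ultimately show ?thesis
    using \<tau> unfolding test_functions_def by blast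
qed

text \<open>
  The integral \<open>\<integral> u \<otimes> u : \<nabla>(K * a)\<close>, with separate fields \<open>a\<close> and \<open>u\<close> since the test field will be
  frozen in time.
\<close>

definition stress :: "nat \<Rightarrow> (real^3 \<Rightarrow> real^3) \<Rightarrow> (real^3 \<Rightarrow> real^3) \<Rightarrow> real" where
  "stress m a u = (LINT x|cellM. (\<Sum>i\<in>UNIV. \<Sum>j\<in>UNIV. u x $ i * u x $ j * conv (dkern m j) (\<lambda>y. a y $ i) x))"

lemma weak_formulation_mollified:
  assumes sol: "euler_weak_solution T v0 v" and a: "a \<in> L2_torus" and div: "weakly_solenoidal m a"
    and \<tau>: "\<tau> < T" and l: "l > 0"
  shows "(LINT t|lebesgue_on {0<..<T}. (- l * flat 2 (l * (\<tau> - t))) * L2_inner (v t) (mollified m a)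
      + flat 0 (l * (\<tau> - t)) * stress m a (v t)) = - flat 0 (l * \<tau>) * L2_inner v0 (mollified m a)"
proof -
  let ?\<phi> = "\<lambda>t x. flat 0 (l * (\<tau> - t)) *\<^sub>R mollified m a x"
  have e: "(LINT t|lebesgue_on {0<..<T}.
            L2_inner (v t) (\<lambda>x. vector_derivative (\<lambda>s. ?\<phi> s x) (at t))
          + L2_inner (\<lambda>x. tensor (v t x) (v t x)) (\<lambda>x. jacobian (?\<phi> t) (at x)))
        = - L2_inner v0 (?\<phi> 0)"
    by (rule sol[unfolded euler_weak_solution_def, THEN conjunct2, THEN conjunct2, THEN conjunct2,
          rule_format, OF mollified_test_function[OF a div \<tau> l]])
  have "vector_derivative (\<lambda>s. ?\<phi> s x) (at t) = (- l * flat 2 (l * (\<tau> - t))) *\<^sub>R mollified m a x" for x t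
  proof (rule vector_derivative_at)
    have "((\<lambda>s. flat 0 (l * (\<tau> - s))) has_real_derivative - l * flat 2 (l * (\<tau> - t))) (at t)"
      using cutoff_has_derivative[of 0 l \<tau> t UNIV] by (simp add: numeral_2_eq_2)
    from has_vector_derivative_scaleR[OF this has_vector_derivative_const]
    show "((\<lambda>s. ?\<phi> s x) has_vector_derivative (- l * flat 2 (l * (\<tau> - t))) *\<^sub>R mollified m a x) (at t)"
      by simp
  qed
  then have 1: "L2_inner (v t) (\<lambda>x. vector_derivative (\<lambda>s. ?\<phi> s x) (at t)) = (- l * flat 2 (l * (\<tau> - t))) * L2_inner (v t) (mollified m a)" for t
    by (simp add: L2_inner_def)
  have 2: "L2_inner (\<lambda>x. tensor (v t x) (v t x)) (\<lambda>x. jacobian (?\<phi> t) (at x)) = flat 0 (l * (\<tau> - t)) * stress m a (v t)" for t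
    unfolding jacobian_scaled_mollified[OF a] L2_inner_def inner_scaleR_right stress_def
    by (simp add: inner_vec_def tensor_def)
  have 3: "- L2_inner v0 (?\<phi> 0) = - flat 0 (l * \<tau>) * L2_inner v0 (mollified m a)"
    by (simp add: L2_inner_def)
  show ?thesis using e unfolding 1 2 3 .
qed

lemma integrable_indicator_times:
  fixes f :: "real \<Rightarrow> real"
  assumes "integrable (lebesgue_on S) f" "A \<in> sets borel"
  shows "integrable (lebesgue_on S) (\<lambda>t. indicator A t * f t)"
proof (rule integrable_mult_bounded[OF assms(1), where B = 1])
  show "(indicator A :: real \<Rightarrow> real) \<in> borel_measurable (lebesgue_on S)"
    using assms(2) by (intro measurable_restrict_space1 measurable_completion) simp
qed (simp add: indicator_def)

lemma integrable_lebesgue_on_subset: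
  fixes f :: "real \<Rightarrow> real"
  assumes "integrable (lebesgue_on S) f" "A \<subseteq> S" "A \<in> sets lebesgue" "S \<in> sets lebesgue"
  shows "integrable (lebesgue_on A) f"
  using set_integrable_subset[of lebesgue S f A] assms
  by (simp add: set_integrable_def integrable_restrict_space)

lemma continuous_integrable_Ioo:
  fixes f :: "real \<Rightarrow> real"
  assumes "continuous_on {0..T} f" shows "integrable (lebesgue_on {0<..<T}) f"
  using continuous_imp_integrable_real[OF assms]
  by (rule integrable_lebesgue_on_subset) auto

lemma integral_Ioo_eq:
  fixes f :: "real \<Rightarrow> real"
  assumes "continuous_on {0..T} f" and "(f has_integral I) {0..T}"
  shows "(LINT t|lebesgue_on {0<..<T}. f t) = I"
proof -
  have "(LINT t|lebesgue_on {0<..<T}. f t) = integral {0<..<T} f"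
    by (rule lebesgue_integral_eq_integral[OF continuous_integrable_Ioo[OF assms(1)]]) simp
  also have "\<dots> = I"
    using assms(2) by (intro integral_unique) (simp add: has_integral_Icc_iff_Ioo)
  finally show ?thesis .
qed

lemma flat_0_tendsto: "(\<lambda>n. flat 0 (real (Suc n) * s)) \<longlonglongrightarrow> (if s > 0 then 1 else 0)"
proof (cases "s > 0")
  case True
  have "(\<lambda>n. exp (- (inverse (real (Suc n)) * inverse s))) \<longlonglongrightarrow> exp (- (0 * inverse s))"
    by (intro tendsto_intros LIMSEQ_inverse_real_of_nat)
  then show ?thesis using True by (simp add: flat_def)
next
  case False
  then have "flat 0 (real (Suc n) * s) = 0" for n
    by (simp add: flat_def zero_less_mult_iff del: of_nat_Suc)
  then show ?thesis using False by simp
qed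

text \<open>
  The derivative of the cut-off is an approximate Dirac mass at \<open>\<tau>\<close>: its total mass tends to \<open>1\<close>, and at
  distance at least \<open>\<delta>\<close> from \<open>\<tau>\<close> it is at most \<open>1 / (l \<delta>\<^sup>2)\<close>.
\<close>

lemma cutoff_concentration:
  fixes g :: "real \<Rightarrow> real"
  assumes g: "continuous_on {0..T} g" and \<tau>: "0 < \<tau>" "\<tau> < T"
  shows "(\<lambda>n. LINT t|lebesgue_on {0<..<T}. (real (Suc n) * flat 2 (real (Suc n) * (\<tau> - t))) * g t) \<longlonglongrightarrow> g \<tau>"
proof -
  have inner: "continuous_on S (\<lambda>t. l * (\<tau> - t))" for l S
    by (intro continuous_intros)
  have kc: "continuous_on S (\<lambda>t. l * flat 2 (l * (\<tau> - t)))" for l S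
    by (intro continuous_intros flat_continuous inner)
  have mass: "(LINT t|lebesgue_on {0<..<T}. l * flat 2 (l * (\<tau> - t))) = flat 0 (l * \<tau>)" if l: "l > 0" for l
  proof (rule integral_Ioo_eq[OF kc])
    have "((\<lambda>t. - (l * flat 2 (l * (\<tau> - t)))) has_integral flat 0 (l * (\<tau> - T)) - flat 0 (l * (\<tau> - 0))) {0..T}"
    proof (rule fundamental_theorem_of_calculus)
      show "0 \<le> T" using \<tau> by simp
      fix t
      show "((\<lambda>t. flat 0 (l * (\<tau> - t))) has_vector_derivative - (l * flat 2 (l * (\<tau> - t)))) (at t within {0..T})"
        using cutoff_has_derivative[of 0 l \<tau> t "{0..T}"]
        by (simp add: numeral_2_eq_2 has_real_derivative_iff_has_vector_derivative)
    qed
    from has_integral_neg[OF this]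
    have "((\<lambda>t. l * flat 2 (l * (\<tau> - t))) has_integral flat 0 (l * \<tau>) - flat 0 (l * (\<tau> - T))) {0..T}"
      by (simp only: minus_minus minus_diff_eq diff_zero)
    moreover have "flat 0 (l * (\<tau> - T)) = 0"
      using l \<tau> by (simp add: flat_def zero_less_mult_iff)
    ultimately show "((\<lambda>t. l * flat 2 (l * (\<tau> - t))) has_integral flat 0 (l * \<tau>)) {0..T}"
      by (simp only: diff_zero)
  qed
  have kgc: "continuous_on {0..T} (\<lambda>t. l * flat 2 (l * (\<tau> - t)) * (g t - g \<tau>))" for l
    by (intro continuous_intros kc g)
  have diff: "(\<lambda>n. LINT t|lebesgue_on {0<..<T}. real (Suc n) * flat 2 (real (Suc n) * (\<tau> - t)) * (g t - g \<tau>)) \<longlonglongrightarrow> 0"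
  proof (rule LIMSEQ_I)
    fix e :: real assume e: "e > 0"
    obtain M where M: "\<And>t. t \<in> {0..T} \<Longrightarrow> \<bar>g t\<bar> \<le> M"
      using compact_imp_bounded[OF compact_continuous_image[OF g]] unfolding bounded_iff by force
    have M0: "0 \<le> M" using M[of \<tau>] \<tau> by fastforce
    obtain \<delta> where \<delta>: "\<delta> > 0" "\<And>t. t \<in> {0..T} \<Longrightarrow> \<bar>t - \<tau>\<bar> < \<delta> \<Longrightarrow> \<bar>g t - g \<tau>\<bar> < e / 2"
      using g \<tau> e unfolding continuous_on_iff dist_real_def by (metis atLeastAtMost_iff half_gt_zero less_imp_le)
    let ?C = "2 * M / \<delta>\<^sup>2"
    obtain N :: nat where N: "2 * T * ?C / e < real N"
      using reals_Archimedean2 by blast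
    have "norm ((LINT t|lebesgue_on {0<..<T}. l * flat 2 (l * (\<tau> - t)) * (g t - g \<tau>)) - 0) < e"
      if l: "l > real N" for l
    proof -
      have l0: "l > 0" using l by simp
      have pt: "\<bar>l * flat 2 (l * (\<tau> - t)) * (g t - g \<tau>)\<bar> \<le> e / 2 * (l * flat 2 (l * (\<tau> - t))) + ?C / l"
        if t: "t \<in> {0..T}" for t
      proof (cases "\<bar>t - \<tau>\<bar> < \<delta>")
        case True
        have "\<bar>l * flat 2 (l * (\<tau> - t)) * (g t - g \<tau>)\<bar> = (l * flat 2 (l * (\<tau> - t))) * \<bar>g t - g \<tau>\<bar>"
          using l0 by (simp add: abs_mult)
        also have "\<dots> \<le> (l * flat 2 (l * (\<tau> - t))) * (e / 2)"
          using \<delta>(2)[OF t True] l0 by (intro mult_left_mono) auto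
        finally show ?thesis
          using l0 M0 by (simp add: mult.commute add_increasing2)
      next
        case False
        have k: "l * flat 2 (l * (\<tau> - t)) \<le> 1 / (l * \<delta>\<^sup>2)"
        proof (cases "t < \<tau>")
          case True
          define s where "s = \<tau> - t"
          have s: "s > 0" "\<delta> \<le> s" using True False \<delta>(1) by (auto simp: s_def)
          have "l * flat 2 (l * s) = l * ((inverse (l * s))\<^sup>2 * exp (- inverse (l * s)))"
            using l0 s by (simp add: flat_def)
          also have "\<dots> \<le> l * ((inverse (l * s))\<^sup>2 * 1)"
            using l0 s by (intro mult_left_mono) auto
          also have "\<dots> = 1 / (l * s\<^sup>2)"
            using l0 s by (simp add: field_simps power2_eq_square)
          also have "\<dots> \<le> 1 / (l * \<delta>\<^sup>2)"
            using l0 s \<delta>(1) by (intro divide_left_mono mult_left_mono power_mono) auto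
          finally show ?thesis by (simp add: s_def)
        next
          case False
          then have "flat 2 (l * (\<tau> - t)) = 0"
            using l0 by (simp add: flat_def zero_less_mult_iff)
          then show ?thesis using l0 by simp
        qed
        have "\<bar>g t - g \<tau>\<bar> \<le> 2 * M"
          using M[OF t] M[of \<tau>] \<tau> by auto
        then have "(l * flat 2 (l * (\<tau> - t))) * \<bar>g t - g \<tau>\<bar> \<le> 1 / (l * \<delta>\<^sup>2) * (2 * M)"
          using k l0 by (intro mult_mono) auto
        moreover have "1 / (l * \<delta>\<^sup>2) * (2 * M) = ?C / l"
          by simp
        moreover have "0 \<le> e / 2 * (l * flat 2 (l * (\<tau> - t)))"
          using e l0 by simp
        moreover have "\<bar>l * flat 2 (l * (\<tau> - t)) * (g t - g \<tau>)\<bar> = (l * flat 2 (l * (\<tau> - t))) * \<bar>g t - g \<tau>\<bar>"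
          using l0 by (simp add: abs_mult)
        ultimately show ?thesis by linarith
      qed
      have "\<bar>LINT t|lebesgue_on {0<..<T}. l * flat 2 (l * (\<tau> - t)) * (g t - g \<tau>)\<bar>
          \<le> (LINT t|lebesgue_on {0<..<T}. \<bar>l * flat 2 (l * (\<tau> - t)) * (g t - g \<tau>)\<bar>)"
        by (rule integral_abs_bound)
      also have "\<dots> \<le> (LINT t|lebesgue_on {0<..<T}. e / 2 * (l * flat 2 (l * (\<tau> - t))) + ?C / l)"
      proof (intro integral_mono continuous_integrable_Ioo continuous_on_rabs kgc)
        show "continuous_on {0..T} (\<lambda>t. e / 2 * (l * flat 2 (l * (\<tau> - t))) + ?C / l)"
          by (intro continuous_on_add continuous_on_mult continuous_on_const kc)
        fix t assume "t \<in> space (lebesgue_on {0<..<T})"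
        then show "\<bar>l * flat 2 (l * (\<tau> - t)) * (g t - g \<tau>)\<bar> \<le> e / 2 * (l * flat 2 (l * (\<tau> - t))) + ?C / l"
          by (intro pt) simp
      qed
      also have "\<dots> = e / 2 * flat 0 (l * \<tau>) + T * (?C / l)"
      proof -
        have "((\<lambda>t. ?C / l) has_integral T * (?C / l)) {0..T}"
          using has_integral_const_real[of "?C / l" 0 T] \<tau> by simp
        then have "(LINT t|lebesgue_on {0<..<T}. ?C / l) = T * (?C / l)"
          by (rule integral_Ioo_eq[OF continuous_on_const])
        moreover have "(LINT t|lebesgue_on {0<..<T}. e / 2 * (l * flat 2 (l * (\<tau> - t)))) = e / 2 * flat 0 (l * \<tau>)"
          by (subst integral_mult_right_zero) (simp only: mass[OF l0])
        ultimately show ?thesis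
          by (subst Bochner_Integration.integral_add)
             (simp_all only: continuous_integrable_Ioo continuous_on_mult continuous_on_const kc)
      qed
      also have "\<dots> \<le> e / 2 * 1 + T * (?C / l)"
        using e flat_0_le by (intro add_right_mono mult_left_mono) auto
      also have "\<dots> < e"
      proof -
        have "2 * T * ?C / e < l" using N l by simp
        then have "2 * T * ?C < l * e"
          by (simp only: pos_divide_less_eq[OF e])
        then have "(T * ?C) / l < e / 2"
          unfolding pos_divide_less_eq[OF l0] by (simp add: algebra_simps)
        then have "T * (?C / l) < e / 2"
          by (simp only: times_divide_eq_right)
        then show ?thesis by simp
      qed
      finally show ?thesis by simp
    qed
    then show "\<exists>no. \<forall>n\<ge>no. norm ((LINT t|lebesgue_on {0<..<T}. real (Suc n) * flat 2 (real (Suc n) * (\<tau> - t)) * (g t - g \<tau>)) - 0) < e"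
      by (intro exI[of _ N]) auto
  qed
  have "(LINT t|lebesgue_on {0<..<T}. (l * flat 2 (l * (\<tau> - t))) * g t)
      = (LINT t|lebesgue_on {0<..<T}. l * flat 2 (l * (\<tau> - t)) * (g t - g \<tau>)) + flat 0 (l * \<tau>) * g \<tau>" if "l > 0" for l
  proof -
    have "(LINT t|lebesgue_on {0<..<T}. (l * flat 2 (l * (\<tau> - t))) * g t)
      = (LINT t|lebesgue_on {0<..<T}. l * flat 2 (l * (\<tau> - t)) * (g t - g \<tau>) + (l * flat 2 (l * (\<tau> - t))) * g \<tau>)"
      by (intro Bochner_Integration.integral_cong refl) (simp add: algebra_simps)
    also have "\<dots> = (LINT t|lebesgue_on {0<..<T}. l * flat 2 (l * (\<tau> - t)) * (g t - g \<tau>))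
        + (LINT t|lebesgue_on {0<..<T}. (l * flat 2 (l * (\<tau> - t))) * g \<tau>)"
      by (intro Bochner_Integration.integral_add continuous_integrable_Ioo kgc continuous_on_mult kc continuous_on_const)
    also have "(LINT t|lebesgue_on {0<..<T}. (l * flat 2 (l * (\<tau> - t))) * g \<tau>) = flat 0 (l * \<tau>) * g \<tau>"
      by (subst integral_mult_left_zero) (simp only: mass[OF that])
    finally show ?thesis .
  qed
  moreover have "(\<lambda>n. (LINT t|lebesgue_on {0<..<T}. real (Suc n) * flat 2 (real (Suc n) * (\<tau> - t)) * (g t - g \<tau>))
      + flat 0 (real (Suc n) * \<tau>) * g \<tau>) \<longlonglongrightarrow> 0 + 1 * g \<tau>"
    using flat_0_tendsto[of \<tau>] \<tau> by (intro tendsto_add diff tendsto_mult tendsto_const) simp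
  ultimately show ?thesis by (simp del: of_nat_Suc)
qed

text \<open>
  Letting the cut-off tend to the indicator of \<open>t < \<tau>\<close> turns the weak formulation into an integrated
  equation at time \<open>\<tau>\<close>.
\<close>

lemma cutoff_limit:
  fixes g h :: "real \<Rightarrow> real"
  assumes g: "continuous_on {0..T} g" and h: "integrable (lebesgue_on {0<..<T}) h" and \<tau>: "0 < \<tau>" "\<tau> < T"
    and id: "\<And>l. l > 0 \<Longrightarrow> (LINT t|lebesgue_on {0<..<T}. (- l * flat 2 (l * (\<tau> - t))) * g t + flat 0 (l * (\<tau> - t)) * h t)
        = - flat 0 (l * \<tau>) * c"
  shows "g \<tau> = c + (LINT t|lebesgue_on {0<..<T}. indicator {..<\<tau>} t * h t)"
proof -
  let ?M = "lebesgue_on {0<..<T}"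
  have gh: "integrable ?M (\<lambda>t. flat 0 (l * (\<tau> - t)) * h t)" for l
    using h cutoff_measurable by (rule integrable_mult_bounded[where B = 1]) (simp add: flat_0_le)
  have gg: "integrable ?M (\<lambda>t. (l * flat 2 (l * (\<tau> - t))) * g t)" for l
    by (intro continuous_integrable_Ioo continuous_intros flat_continuous g)
  have split: "(LINT t|?M. flat 0 (l * (\<tau> - t)) * h t) - (LINT t|?M. (l * flat 2 (l * (\<tau> - t))) * g t) = - flat 0 (l * \<tau>) * c"
    if "l > 0" for l
    unfolding id[OF that, symmetric] using gh gg by (simp flip: Bochner_Integration.integral_diff)
  have "(\<lambda>n. LINT t|?M. flat 0 (real (Suc n) * (\<tau> - t)) * h t) \<longlonglongrightarrow> (LINT t|?M. indicator {..<\<tau>} t * h t)"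
  proof (rule integral_dominated_convergence[where w = "\<lambda>t. \<bar>h t\<bar>"])
    show "(\<lambda>t. indicator {..<\<tau>} t * h t) \<in> borel_measurable ?M"
      by (intro borel_measurable_integrable integrable_indicator_times h) simp
    show "(\<lambda>t. flat 0 (real (Suc n) * (\<tau> - t)) * h t) \<in> borel_measurable ?M" for n
      using gh by (rule borel_measurable_integrable)
    show "integrable ?M (\<lambda>t. \<bar>h t\<bar>)" using h by simp
    show "AE t in ?M. (\<lambda>n. flat 0 (real (Suc n) * (\<tau> - t)) * h t) \<longlonglongrightarrow> indicator {..<\<tau>} t * h t"
    proof (rule AE_I2)
      fix t
      have "(\<lambda>n. flat 0 (real (Suc n) * (\<tau> - t)) * h t) \<longlonglongrightarrow> (if \<tau> - t > 0 then 1 else 0) * h t"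
        by (intro tendsto_mult flat_0_tendsto tendsto_const)
      then show "(\<lambda>n. flat 0 (real (Suc n) * (\<tau> - t)) * h t) \<longlonglongrightarrow> indicator {..<\<tau>} t * h t"
        by (cases "t < \<tau>") (simp_all add: indicator_def)
    qed
    show "AE t in ?M. norm (flat 0 (real (Suc n) * (\<tau> - t)) * h t) \<le> \<bar>h t\<bar>" for n
      using flat_0_le by (intro AE_I2) (auto simp: abs_mult intro!: mult_left_le_one_le)
  qed
  from tendsto_diff[OF this cutoff_concentration[OF g \<tau>]]
  have "(\<lambda>n. - flat 0 (real (Suc n) * \<tau>) * c) \<longlonglongrightarrow> (LINT t|?M. indicator {..<\<tau>} t * h t) - g \<tau>"
    by (subst (asm) split) auto
  moreover have "(\<lambda>n. - flat 0 (real (Suc n) * \<tau>) * c) \<longlonglongrightarrow> - 1 * c"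
    using flat_0_tendsto[of \<tau>] \<tau> by (intro tendsto_mult tendsto_minus tendsto_const) simp
  ultimately have "(LINT t|?M. indicator {..<\<tau>} t * h t) - g \<tau> = - 1 * c"
    by (rule LIMSEQ_unique)
  then show ?thesis by simp
qed

section \<open>Testing the equation with a mollified field\<close>

lemma conv_add:
  assumes "trig_poly f" "integrable cellM r" "integrable cellM q"
  shows "conv f (\<lambda>y. r y + q y) x = conv f r x + conv f q x"
  using conv_integrable[OF assms(1,2)] conv_integrable[OF assms(1,3)] by (simp add: conv_def distrib_left)

lemma conv_diff:
  assumes "trig_poly f" "integrable cellM r" "integrable cellM q"
  shows "conv f (\<lambda>y. r y - q y) x = conv f r x - conv f q x"
  using conv_integrable[OF assms(1,2)] conv_integrable[OF assms(1,3)] by (simp add: conv_def right_diff_distrib)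

lemma stress_integrand_integrable:
  assumes "a \<in> L2_torus" "u \<in> L2_torus"
  shows "integrable cellM (\<lambda>x. u x $ i * u x $ j * conv (dkern m k) (\<lambda>y. a y $ l) x)"
  using trig_poly_mult_integrable[OF conv_trig_poly[OF trig_poly_dkern L2_torus_integrable[OF assms(1)]]
      L2_torus_integrable_mult[OF assms(2,2)]]
  by (simp add: mult.commute)

lemma stress_eq_sum:
  assumes "a \<in> L2_torus" "u \<in> L2_torus"
  shows "stress m a u = (\<Sum>i\<in>UNIV. \<Sum>j\<in>UNIV. LINT x|cellM. u x $ i * u x $ j * conv (dkern m j) (\<lambda>y. a y $ i) x)"
  unfolding stress_def using stress_integrand_integrable[OF assms] by simp

lemma stress_flux: "u \<in> L2_torus \<Longrightarrow> stress m u u = flux m u"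
  unfolding stress_eq_sum flux_def by (subst sum.swap) (simp add: mult.commute mult.left_commute)

lemma L2_torus_add:
  assumes "u \<in> L2_torus" "w \<in> L2_torus" shows "(\<lambda>x. u x + w x) \<in> L2_torus"
proof -
  have "(\<lambda>x. 0 - w x) \<in> L2_torus"
    by (intro L2_torus_diff L2_torus_const assms)
  from L2_torus_diff[OF assms(1) this] show ?thesis by simp
qed

lemma stress_diff:
  assumes "a \<in> L2_torus" "b \<in> L2_torus" "u \<in> L2_torus"
  shows "stress m (\<lambda>x. a x - b x) u = stress m a u - stress m b u"
proof -
  have "conv (dkern m j) (\<lambda>y. (a y - b y) $ i) x = conv (dkern m j) (\<lambda>y. a y $ i) x - conv (dkern m j) (\<lambda>y. b y $ i) x" for i j x
    using conv_diff[OF trig_poly_dkern L2_torus_integrable[OF assms(1)] L2_torus_integrable[OF assms(2)]] by simp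
  then show ?thesis
    unfolding stress_eq_sum[OF L2_torus_diff[OF assms(1,2)] assms(3)] stress_eq_sum[OF assms(1,3)] stress_eq_sum[OF assms(2,3)]
    using stress_integrand_integrable[OF assms(1,3)] stress_integrand_integrable[OF assms(2,3)]
    by (simp add: right_diff_distrib sum_subtractf)
qed

lemma stress_add:
  assumes "a \<in> L2_torus" "b \<in> L2_torus" "u \<in> L2_torus"
  shows "stress m (\<lambda>x. a x + b x) u = stress m a u + stress m b u"
  using stress_diff[OF L2_torus_add[OF assms(1,2)] assms(2,3), of m] by simp

lemma stress_bound:
  assumes a: "a \<in> L2_torus" and u: "u \<in> L2_torus"
    and B: "\<And>i j x. \<bar>conv (dkern m j) (\<lambda>y. a y $ i) x\<bar> \<le> B"
  shows "\<bar>stress m a u\<bar> \<le> 9 * B * (L2_norm u)\<^sup>2"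
proof -
  let ?s = "\<lambda>x. \<Sum>i\<in>UNIV. \<Sum>j\<in>UNIV. u x $ i * u x $ j * conv (dkern m j) (\<lambda>y. a y $ i) x"
  have "\<bar>stress m a u\<bar> \<le> (LINT x|cellM. \<bar>?s x\<bar>)"
    unfolding stress_def by (rule integral_abs_bound)
  also have "\<dots> \<le> (LINT x|cellM. 9 * B * (norm (u x))\<^sup>2)"
  proof (rule integral_mono)
    show "integrable cellM (\<lambda>x. \<bar>?s x\<bar>)"
      by (intro Bochner_Integration.integrable_abs Bochner_Integration.integrable_sum stress_integrand_integrable a u)
    show "integrable cellM (\<lambda>x. 9 * B * (norm (u x))\<^sup>2)"
      using L2_torus_integrable_norm2[OF u] by simp
    fix x
    have "\<bar>?s x\<bar> \<le> (\<Sum>i\<in>UNIV. \<Sum>j\<in>UNIV. \<bar>u x $ i * u x $ j * conv (dkern m j) (\<lambda>y. a y $ i) x\<bar>)"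
      by (rule order_trans[OF sum_abs sum_mono[OF sum_abs]])
    also have "\<dots> \<le> (\<Sum>i\<in>(UNIV::3 set). \<Sum>j\<in>(UNIV::3 set). norm (u x) * norm (u x) * B)"
      unfolding abs_mult by (intro sum_mono mult_mono component_le_norm_cart B mult_nonneg_nonneg) auto
    also have "\<dots> = 9 * B * (norm (u x))\<^sup>2"
      by (simp add: power2_eq_square)
    finally show "\<bar>?s x\<bar> \<le> 9 * B * (norm (u x))\<^sup>2" .
  qed
  also have "\<dots> = 9 * B * (L2_norm u)\<^sup>2"
    by (simp add: L2_norm_power2)
  finally show ?thesis .
qed

lemma conv_cong_AE:
  assumes "AE x in lebesgue. a x = b x" "a \<in> L2_torus" "b \<in> L2_torus" "trig_poly f"
  shows "conv f (\<lambda>y. a y $ i) x = conv f (\<lambda>y. b y $ i) x"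
  unfolding conv_def
proof (rule integral_cong_AE)
  show "(\<lambda>y. f (x - y) * a y $ i) \<in> borel_measurable cellM" "(\<lambda>y. f (x - y) * b y $ i) \<in> borel_measurable cellM"
    using conv_integrable[OF assms(4) L2_torus_integrable] assms(2,3) by (blast intro: borel_measurable_integrable)+
  show "AE y in cellM. f (x - y) * a y $ i = f (x - y) * b y $ i"
    using assms(1) by (simp add: AE_restrict_space_iff) (auto elim: eventually_mono)
qed

lemma L2_inner_cong_AE:
  assumes "AE x in lebesgue. a x = b x" "AE x in lebesgue. c x = d x"
    "a \<in> L2_torus" "b \<in> L2_torus" "c \<in> L2_torus" "d \<in> L2_torus"
  shows "L2_inner a c = L2_inner b d"
  unfolding L2_inner_def
proof (rule integral_cong_AE)
  show "(\<lambda>x. a x \<bullet> c x) \<in> borel_measurable cellM" "(\<lambda>x. b x \<bullet> d x) \<in> borel_measurable cellM"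
    using L2_inner_integrable assms by (blast intro: borel_measurable_integrable)+
  have "AE x in lebesgue. x \<in> cell \<longrightarrow> a x \<bullet> c x = b x \<bullet> d x"
    using assms(1,2) by eventually_elim simp
  then show "AE x in cellM. a x \<bullet> c x = b x \<bullet> d x"
    by (simp add: AE_restrict_space_iff)
qed

lemma mollified_L2:
  assumes "a \<in> L2_torus" shows "mollified m a \<in> L2_torus"
proof (rule continuous_L2_torus)
  show "continuous_on UNIV (mollified m a)"
    by (intro continuous_at_imp_continuous_on ballI has_derivative_continuous[OF mollified_has_derivative[OF assms]])
  show "periodic (mollified m a)"
    using trig_poly_periodic[OF conv_trig_poly[OF trig_poly_kern L2_torus_integrable[OF assms]]]
    by (simp add: periodic_def mollified_def)
qed

lemma L2_inner_mollified:
  assumes "u \<in> L2_torus" "a \<in> L2_torus"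
  shows "L2_inner u (mollified m a) = (\<Sum>i\<in>UNIV. dbl (\<lambda>x y. kern m (x - y) * (u x $ i * a y $ i)))"
  unfolding L2_inner_sum[OF assms(1) mollified_L2[OF assms(2)]]
  by (intro sum.cong refl, rule trans[OF _ dbl_conv[symmetric]]) (simp add: mollified_def)

lemma L2_inner_mollified_self: "u \<in> L2_torus \<Longrightarrow> L2_inner u (mollified m u) = energy m u"
  by (simp add: L2_inner_mollified energy_def)

lemma L2_inner_mollified_sym:
  assumes "u \<in> L2_torus" "a \<in> L2_torus"
  shows "L2_inner u (mollified m a) = L2_inner a (mollified m u)"
  unfolding L2_inner_mollified[OF assms] L2_inner_mollified[OF assms(2,1)]
  by (intro sum.cong refl dbl_even trig_poly_kern L2_torus_integrable assms kern_minus)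

lemma L2_inner_mollified_add:
  assumes "u \<in> L2_torus" "a \<in> L2_torus" "b \<in> L2_torus"
  shows "L2_inner u (mollified m (\<lambda>x. a x + b x)) = L2_inner u (mollified m a) + L2_inner u (mollified m b)"
proof -
  have "mollified m (\<lambda>x. a x + b x) x = mollified m a x + mollified m b x" for x
    using conv_add[OF trig_poly_kern L2_torus_integrable[OF assms(2)] L2_torus_integrable[OF assms(3)]]
    by (simp add: mollified_def vec_eq_iff)
  then show ?thesis
    using L2_inner_integrable[OF assms(1) mollified_L2[OF assms(2)]] L2_inner_integrable[OF assms(1) mollified_L2[OF assms(3)]]
    by (simp add: L2_inner_def inner_add_right)
qed

lemma energy_cong_AE:
  assumes "AE x in lebesgue. u x = w x" "u \<in> L2_torus" "w \<in> L2_torus"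
  shows "energy m u = energy m w"
proof -
  have "mollified m u = mollified m w"
    using conv_cong_AE[OF assms trig_poly_kern] by (simp add: mollified_def fun_eq_iff)
  then have "AE x in lebesgue. mollified m u x = mollified m w x"
    by simp
  from L2_inner_cong_AE[OF assms(1) this assms(2,3) mollified_L2[OF assms(2)] mollified_L2[OF assms(3)]]
  show ?thesis
    by (simp only: L2_inner_mollified_self assms)
qed

text \<open>
  Completeness of Lebesgue measure.
\<close>

lemma borel_measurable_lebesgue_on_AE:
  fixes f g :: "real \<Rightarrow> real"
  assumes g: "g \<in> borel_measurable (lebesgue_on S)" and S: "S \<in> sets lebesgue" and ae: "AE t in lebesgue_on S. f t = g t"
  shows "f \<in> borel_measurable (lebesgue_on S)"
proof -
  let ?f = "\<lambda>t. indicator S t *\<^sub>R f t" and ?g = "\<lambda>t. indicator S t *\<^sub>R g t"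
  have gm: "?g \<in> borel_measurable lebesgue"
    using g S by (subst borel_measurable_restrict_space_iff[symmetric]) auto
  have ae': "AE t in lebesgue. ?f t = ?g t"
    using ae S by (simp add: AE_restrict_space_iff) (auto elim!: eventually_mono simp: indicator_def)
  have "?f \<in> borel_measurable lebesgue"
  proof (rule measurableI)
    fix A :: "real set" assume A: "A \<in> sets borel"
    show "?f -` A \<inter> space lebesgue \<in> sets lebesgue"
    proof (rule completion.in_sets_AE)
      show "AE t in lebesgue. t \<in> ?g -` A \<inter> space lebesgue \<longleftrightarrow> t \<in> ?f -` A \<inter> space lebesgue"
        using ae' by eventually_elim (simp only: vimage_eq Int_iff)
      show "?g -` A \<inter> space lebesgue \<in> sets lebesgue"
        using gm A by (rule measurable_sets)
    qed auto
  qed auto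
  then show ?thesis
    using S by (subst borel_measurable_restrict_space_iff) auto
qed

text \<open>
  The field \<open>v\<close> is only Lebesgue measurable in \<open>(t, x)\<close>, and Lebesgue measure on the product is not the
  product of the Lebesgue measures.  Replace the components of \<open>v\<close> by Borel functions that agree with
  them almost everywhere; for almost every \<open>t\<close> the integral in \<open>x\<close> is unchanged, and for Borel
  functions it is measurable in \<open>t\<close>.
\<close>

lemma stress_measurable:
  assumes sol: "euler_weak_solution T v0 v" and a: "a \<in> L2_torus"
  shows "(\<lambda>t. stress m a (v t)) \<in> borel_measurable (lebesgue_on {0<..<T})"
proof -
  let ?S = "{0<..<T} \<times> (UNIV :: (real^3) set)"
  define c where "c i j = conv (dkern m j) (\<lambda>y. a y $ i)" for i j
  have c: "trig_poly (c i j)" for i j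
    unfolding c_def by (rule conv_trig_poly[OF trig_poly_dkern L2_torus_integrable[OF a]])
  have c_meas [measurable]: "c i j \<in> borel_measurable borel" for i j
    using c by (rule trig_poly_measurable)
  have S: "?S \<in> sets lebesgue"
    by (intro sets_completionI_sets) (simp add: open_Times borel_open)
  have vm: "(\<lambda>(t, x). v t x) \<in> borel_measurable (lebesgue_on ?S)"
    using sol by (simp add: euler_weak_solution_def)
  define V where "V i p = indicator ?S p *\<^sub>R (v (fst p) (snd p) $ i)" for i :: 3 and p
  have "V i \<in> borel_measurable lebesgue" for i
  proof -
    have "(\<lambda>p. (case p of (t, x) \<Rightarrow> v t x) $ i) \<in> borel_measurable (lebesgue_on ?S)"
      by (rule measurable_compose[OF vm borel_measurable_continuous_onI]) (intro continuous_intros)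
    then show ?thesis
      using S by (subst (asm) borel_measurable_restrict_space_iff) (auto simp: V_def[abs_def] case_prod_beta)
  qed
  then have "\<forall>i. \<exists>V'\<in>borel_measurable lborel. AE p in lborel. V i p = V' p"
    using completion_ex_borel_measurable_real by blast
  then obtain V' where V'm: "\<And>i. V' i \<in> borel_measurable lborel" and V'ae: "\<And>i. AE p in lborel. V i p = V' i p"
    by metis
  have V'm' [measurable]: "V' i \<in> borel_measurable (lborel \<Otimes>\<^sub>M lborel)" for i
    using V'm by (simp add: lborel_prod)
  have "AE p in lborel. \<forall>i\<in>UNIV. V i p = V' i p"
    by (subst AE_finite_all) (auto simp: V'ae)
  then have "AE p in lborel \<Otimes>\<^sub>M lborel. \<forall>i\<in>UNIV. V i p = V' i p"
    by (simp only: lborel_prod)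
  then have ae: "AE t in lborel. AE x in lborel. \<forall>i\<in>UNIV. V i (t, x) = V' i (t, x)"
    by (rule lborel_pair.AE_pair)
  define W where "W t = (LINT x|lborel. indicator cell x * (\<Sum>i\<in>UNIV. \<Sum>j\<in>UNIV. V' i (t, x) * V' j (t, x) * c i j x))" for t
  have cell_b [measurable]: "cell \<in> sets borel"
    by (simp add: cell_eq_cbox)
  have Wm: "W \<in> borel_measurable lborel"
    unfolding W_def by (rule lborel.borel_measurable_lebesgue_integral) measurable
  have L2ae: "AE t in lebesgue_on {0<..<T}. v t \<in> L2_torus"
    using sol unfolding euler_weak_solution_def Linf_H_def by (auto elim!: eventually_mono simp: H_space_L2)
  have W_ae: "AE t in lebesgue_on {0<..<T}. stress m a (v t) = W t"
  proof -
    have "AE t in lebesgue_on {0<..<T}. AE x in lborel. \<forall>i\<in>UNIV. V i (t, x) = V' i (t, x)"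
      using ae by (simp add: AE_restrict_space_iff) (auto intro: AE_completion elim: eventually_mono)
    moreover have "AE t in lebesgue_on {0<..<T}. t \<in> {0<..<T}"
      by (rule AE_I2) simp
    ultimately show ?thesis
      using L2ae
    proof eventually_elim
      case (elim t)
      let ?F = "\<lambda>x. \<Sum>i\<in>UNIV. \<Sum>j\<in>UNIV. v t x $ i * v t x $ j * c i j x"
      let ?G = "\<lambda>x. \<Sum>i\<in>UNIV. \<Sum>j\<in>UNIV. V' i (t, x) * V' j (t, x) * c i j x"
      have vt: "v t x $ i = V i (t, x)" for x i
        using elim(2) by (simp add: V_def)
      have Fint: "integrable cellM ?F"
        unfolding c_def by (intro Bochner_Integration.integrable_sum stress_integrand_integrable a elim)
      have Gm: "(\<lambda>x. indicator cell x *\<^sub>R ?G x) \<in> borel_measurable lborel"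
        by measurable
      have "stress m a (v t) = (LINT x|cellM. ?F x)"
        by (simp add: stress_def c_def)
      also have "\<dots> = (LINT x|lebesgue. indicator cell x *\<^sub>R ?F x)"
        by (rule integral_restrict_space) simp
      also have "\<dots> = (LINT x|lebesgue. indicator cell x *\<^sub>R ?G x)"
      proof (rule integral_cong_AE)
        show "(\<lambda>x. indicator cell x *\<^sub>R ?F x) \<in> borel_measurable lebesgue"
          using borel_measurable_integrable[OF Fint] by (subst borel_measurable_restrict_space_iff[symmetric]) auto
        show "(\<lambda>x. indicator cell x *\<^sub>R ?G x) \<in> borel_measurable lebesgue"
          by (rule measurable_completion[OF Gm])
        show "AE x in lebesgue. indicator cell x *\<^sub>R ?F x = indicator cell x *\<^sub>R ?G x"
          using AE_completion[OF elim(1)] by eventually_elim (simp add: vt)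
      qed
      also have "\<dots> = (LINT x|lborel. indicator cell x *\<^sub>R ?G x)"
        by (rule integral_completion[OF Gm])
      finally show ?case by (simp add: W_def)
    qed
  qed
  have "W \<in> borel_measurable (lebesgue_on {0<..<T})"
    by (intro measurable_restrict_space1 measurable_completion Wm)
  from borel_measurable_lebesgue_on_AE[OF this _ W_ae] show ?thesis
    by simp
qed

lemma finite_measure_Ioo: "finite_measure (lebesgue_on {0<..<T::real})"
proof
  show "emeasure (lebesgue_on {0<..<T}) (space (lebesgue_on {0<..<T})) \<noteq> \<infinity>"
    by (cases "0 \<le> T") (simp_all add: emeasure_restrict_space)
qed

lemma stress_integrable:
  assumes sol: "euler_weak_solution T v0 v" and a: "a \<in> L2_torus"
  shows "integrable (lebesgue_on {0<..<T}) (\<lambda>t. stress m a (v t))"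
proof -
  define b where "b i j = (SOME B. \<forall>x. \<bar>conv (dkern m j) (\<lambda>y. a y $ i) x\<bar> \<le> B)" for i j
  have "\<exists>B. \<forall>x. \<bar>conv (dkern m j) (\<lambda>y. a y $ i) x\<bar> \<le> B" for i j
    by (rule trig_poly_bounded[OF conv_trig_poly[OF trig_poly_dkern L2_torus_integrable[OF a]]])
  from someI_ex[OF this] have b: "\<bar>conv (dkern m j) (\<lambda>y. a y $ i) x\<bar> \<le> b i j" for i j x
    unfolding b_def by blast
  define B where "B = (\<Sum>i\<in>UNIV. \<Sum>j\<in>UNIV. \<bar>b i j\<bar>)"
  have B: "\<bar>conv (dkern m j) (\<lambda>y. a y $ i) x\<bar> \<le> B" for i j x
  proof -
    have "\<bar>b i j\<bar> \<le> (\<Sum>j\<in>UNIV. \<bar>b i j\<bar>)"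
      by (rule member_le_sum) auto
    also have "\<dots> \<le> B"
      unfolding B_def by (rule member_le_sum) (auto intro: sum_nonneg)
    finally show ?thesis using b[of j i x] abs_ge_self[of "b i j"] by linarith
  qed
  have B0: "0 \<le> B" using B[of 1 1 0] by linarith
  obtain C where C: "AE t in lebesgue_on {0<..<T}. v t \<in> H_space \<and> L2_norm (v t) \<le> C"
    using sol unfolding euler_weak_solution_def Linf_H_def by blast
  show ?thesis
  proof (rule finite_measure.integrable_const_bound[OF finite_measure_Ioo, where B = "9 * B * C\<^sup>2"])
    show "AE t in lebesgue_on {0<..<T}. norm (stress m a (v t)) \<le> 9 * B * C\<^sup>2"
      using C
    proof eventually_elim
      case (elim t)
      have "\<bar>stress m a (v t)\<bar> \<le> 9 * B * (L2_norm (v t))\<^sup>2"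
        using elim by (intro stress_bound a H_space_L2 B) auto
      also have "\<dots> \<le> 9 * B * C\<^sup>2"
        using elim B0 by (intro mult_left_mono power_mono) auto
      finally show ?case by simp
    qed
  qed (rule stress_measurable[OF sol a])
qed

lemma weak_representative_AE:
  assumes sol: "euler_weak_solution T v0 v" and rep: "weakly_continuous_representative T v0 v w"
  shows "AE t in lebesgue_on {0<..<T}. v t \<in> H_space \<and> w t \<in> L2_torus \<and> (AE x in lebesgue. w t x = v t x)"
proof -
  have 1: "AE t in lebesgue_on {0<..<T}. v t \<in> H_space"
    using sol unfolding euler_weak_solution_def Linf_H_def by (auto elim!: eventually_mono)
  have 2: "AE t in lebesgue_on {0<..<T}. w t \<in> L2_torus"
    using rep by (intro AE_I2) (auto simp: weakly_continuous_representative_def)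
  have 3: "AE t in lebesgue_on {0<..<T}. AE x in lebesgue. w t x = v t x"
    using rep by (simp add: weakly_continuous_representative_def)
  show ?thesis using 1 2 3 by eventually_elim simp
qed

lemma mollified_increment:
  assumes sol: "euler_weak_solution T v0 v" and rep: "weakly_continuous_representative T v0 v w"
    and a: "a \<in> L2_torus" and div: "weakly_solenoidal m a" and st: "0 < s" "s \<le> t" "t < T"
  shows "L2_inner (w t) (mollified m a) - L2_inner (w s) (mollified m a)
    = (LINT \<tau>|lebesgue_on {0<..<T}. indicator {s..<t} \<tau> * stress m a (v \<tau>))"
proof -
  let ?M = "lebesgue_on {0<..<T}"
  let ?\<psi> = "mollified m a"
  let ?g = "\<lambda>t. L2_inner (w t) ?\<psi>" and ?h = "\<lambda>t. stress m a (v t)"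
  have \<psi>: "?\<psi> \<in> L2_torus" by (rule mollified_L2[OF a])
  have g: "continuous_on {0..T} ?g"
    using rep \<psi> by (simp add: weakly_continuous_representative_def)
  have h: "integrable ?M ?h" by (rule stress_integrable[OF sol a])
  have gv: "AE t in ?M. L2_inner (v t) ?\<psi> = ?g t"
    using weak_representative_AE[OF sol rep]
  proof eventually_elim
    case (elim t)
    then show ?case
      using L2_inner_cong_AE[of "w t" "v t" ?\<psi> ?\<psi>] \<psi> H_space_L2 by auto
  qed
  have main: "?g \<tau> = L2_inner v0 ?\<psi> + (LINT t|?M. indicator {..<\<tau>} t * ?h t)" if \<tau>: "0 < \<tau>" "\<tau> < T" for \<tau>
  proof (rule cutoff_limit[OF g h \<tau>])
    fix l :: real assume l: "l > 0"
    let ?k = "\<lambda>t. - l * flat 2 (l * (\<tau> - t))" and ?c = "\<lambda>t. flat 0 (l * (\<tau> - t))"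
    have "(LINT t|?M. ?k t * ?g t + ?c t * ?h t) = (LINT t|?M. ?k t * L2_inner (v t) ?\<psi> + ?c t * ?h t)"
    proof (rule integral_cong_AE)
      have km: "?k \<in> borel_measurable ?M" and cm: "?c \<in> borel_measurable ?M"
        by (auto intro!: borel_measurable_times cutoff_measurable)
      have gm: "?g \<in> borel_measurable ?M"
        by (rule borel_measurable_integrable[OF continuous_integrable_Ioo[OF g]])
      have vm: "(\<lambda>t. L2_inner (v t) ?\<psi>) \<in> borel_measurable ?M"
        by (rule borel_measurable_lebesgue_on_AE[OF gm _ gv]) simp
      note hm = borel_measurable_integrable[OF h]
      show "(\<lambda>t. ?k t * ?g t + ?c t * ?h t) \<in> borel_measurable ?M"
        by (intro borel_measurable_add borel_measurable_times km cm gm hm)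
      show "(\<lambda>t. ?k t * L2_inner (v t) ?\<psi> + ?c t * ?h t) \<in> borel_measurable ?M"
        by (intro borel_measurable_add borel_measurable_times km cm vm hm)
      show "AE t in ?M. ?k t * ?g t + ?c t * ?h t = ?k t * L2_inner (v t) ?\<psi> + ?c t * ?h t"
        using gv by eventually_elim simp
    qed
    then show "(LINT t|?M. ?k t * ?g t + ?c t * ?h t) = - flat 0 (l * \<tau>) * L2_inner v0 ?\<psi>"
      using weak_formulation_mollified[OF sol a div \<tau>(2) l] by simp
  qed
  have ih: "integrable ?M (\<lambda>\<tau>. indicator {..<r} \<tau> * ?h \<tau>)" for r
    by (intro integrable_indicator_times h) simp
  have "?g t - ?g s = (LINT \<tau>|?M. indicator {..<t} \<tau> * ?h \<tau>) - (LINT \<tau>|?M. indicator {..<s} \<tau> * ?h \<tau>)"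
    using main[of t] main[of s] st by simp
  also have "\<dots> = (LINT \<tau>|?M. indicator {..<t} \<tau> * ?h \<tau> - indicator {..<s} \<tau> * ?h \<tau>)"
    by (rule Bochner_Integration.integral_diff[OF ih ih, symmetric])
  also have "\<dots> = (LINT \<tau>|?M. indicator {s..<t} \<tau> * ?h \<tau>)"
    using st by (intro Bochner_Integration.integral_cong refl) (auto simp: indicator_def)
  finally show ?thesis .
qed

section \<open>Conservation of energy\<close>

lemma AE_Ioo_dense:
  assumes ae: "AE t in lebesgue_on {0<..<T}. P t" and T: "T > 0" and t0: "t0 \<in> {0..T}" and \<delta>: "\<delta> > (0::real)"
  shows "\<exists>t\<in>{0<..<T}. \<bar>t - t0\<bar> < \<delta> \<and> P t"
proof (rule ccontr)
  assume no: "\<not> ?thesis"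
  define a b where "a = max 0 (t0 - \<delta>)" and "b = min T (t0 + \<delta>)"
  have ab: "a < b" using t0 T \<delta> by (auto simp: a_def b_def)
  have sub: "t \<in> {0<..<T} \<and> \<not> P t" if "t \<in> {a<..<b}" for t
    using no that by (auto simp: a_def b_def)
  have "AE t in lebesgue. t \<in> {0<..<T} \<longrightarrow> P t"
    using ae by (simp add: AE_restrict_space_iff)
  then have "AE t in lebesgue. t \<notin> {a<..<b}"
    by eventually_elim (use sub in blast)
  then have "emeasure lebesgue {a<..<b} = 0"
    by (subst (asm) AE_iff_measurable[where N = "{a<..<b}"]) auto
  then show False using ab by simp
qed

lemma continuous_AE_zero:
  fixes g :: "real \<Rightarrow> real"
  assumes g: "continuous_on {0..T} g" and T: "T > 0" and ae: "AE t in lebesgue_on {0<..<T}. g t = 0" and t: "t \<in> {0..T}"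
  shows "g t = 0"
proof (rule ccontr)
  assume "g t \<noteq> 0"
  then obtain \<delta> where \<delta>: "\<delta> > 0" "\<And>s. s \<in> {0..T} \<Longrightarrow> dist s t < \<delta> \<Longrightarrow> dist (g s) (g t) < \<bar>g t\<bar>"
    using g t unfolding continuous_on_iff by (metis zero_less_abs_iff)
  obtain s where "s \<in> {0<..<T}" "\<bar>s - t\<bar> < \<delta>" "g s = 0"
    using AE_Ioo_dense[OF ae T t \<delta>(1)] by blast
  then show False using \<delta>(2)[of s] by (auto simp: dist_real_def)
qed

text \<open>
  Errors of order \<open>\<epsilon> (t - s)\<close> on short intervals add up to \<open>\<epsilon> (t - s)\<close> over any subdivision, so they can
  be removed.
\<close>

lemma increment_bound_chain:
  fixes E \<Phi> :: "real \<Rightarrow> real"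
  assumes step: "\<And>\<epsilon>. \<epsilon> > 0 \<Longrightarrow> \<exists>\<delta>>0. \<forall>s t. 0 < s \<longrightarrow> s \<le> t \<longrightarrow> t < T \<longrightarrow> t - s < \<delta> \<longrightarrow> \<bar>E t - E s\<bar> \<le> \<Phi> t - \<Phi> s + \<epsilon> * (t - s)"
    and st: "0 < s" "s \<le> t" "t < T"
  shows "\<bar>E t - E s\<bar> \<le> \<Phi> t - \<Phi> s"
proof (rule field_le_epsilon)
  fix e :: real assume e: "e > 0"
  define \<epsilon> where "\<epsilon> = e / (t - s + 1)"
  have \<epsilon>: "\<epsilon> > 0" using e st by (simp add: \<epsilon>_def)
  have \<epsilon>e: "\<epsilon> * (t - s) \<le> e"
    using e st by (simp add: \<epsilon>_def divide_simps)
  obtain \<delta> where \<delta>: "\<delta> > 0"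
    "\<And>s t. 0 < s \<Longrightarrow> s \<le> t \<Longrightarrow> t < T \<Longrightarrow> t - s < \<delta> \<Longrightarrow> \<bar>E t - E s\<bar> \<le> \<Phi> t - \<Phi> s + \<epsilon> * (t - s)"
    using step[OF \<epsilon>] by blast
  obtain n :: nat where n: "(t - s) / \<delta> < real n"
    using reals_Archimedean2 by blast
  have n0: "n > 0" using n st \<delta>(1) by (cases n) (auto simp: divide_less_0_iff)
  define h where "h = (t - s) / real n"
  have h: "0 \<le> h" "h < \<delta>" "real n * h = t - s"
    using n n0 st \<delta>(1) by (auto simp: h_def field_simps)
  have "\<bar>E (s + real k * h) - E s\<bar> \<le> \<Phi> (s + real k * h) - \<Phi> s + \<epsilon> * (real k * h)" if "k \<le> n" for k
    using that
  proof (induction k)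
    case (Suc k)
    have "real (Suc k) * h \<le> real n * h"
      using Suc.prems h by (intro mult_right_mono) auto
    then have le: "s + real (Suc k) * h \<le> t"
      using h(3) by simp
    have kh: "0 \<le> real k * h" using h by simp
    have "\<bar>E (s + real (Suc k) * h) - E (s + real k * h)\<bar>
        \<le> \<Phi> (s + real (Suc k) * h) - \<Phi> (s + real k * h) + \<epsilon> * ((s + real (Suc k) * h) - (s + real k * h))"
    proof (rule \<delta>(2))
      show "0 < s + real k * h" using st kh by linarith
      show "s + real k * h \<le> s + real (Suc k) * h" using h(1) by (simp add: algebra_simps)
      show "s + real (Suc k) * h < T" using le st by linarith
      show "s + real (Suc k) * h - (s + real k * h) < \<delta>" using h(2) by (simp add: algebra_simps)
    qed
    also have "\<epsilon> * ((s + real (Suc k) * h) - (s + real k * h)) = \<epsilon> * h"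
      by (simp add: algebra_simps)
    finally have 1: "\<bar>E (s + real (Suc k) * h) - E (s + real k * h)\<bar> \<le> \<Phi> (s + real (Suc k) * h) - \<Phi> (s + real k * h) + \<epsilon> * h" .
    have 2: "\<epsilon> * (real (Suc k) * h) = \<epsilon> * (real k * h) + \<epsilon> * h"
      by (simp add: algebra_simps)
    have 3: "\<bar>E (s + real k * h) - E s\<bar> \<le> \<Phi> (s + real k * h) - \<Phi> s + \<epsilon> * (real k * h)"
      using Suc by simp
    show ?case using 1 2 3 by linarith
  qed simp
  from this[of n] have "\<bar>E t - E s\<bar> \<le> \<Phi> t - \<Phi> s + \<epsilon> * (t - s)"
    by (simp add: h(3))
  then show "\<bar>E t - E s\<bar> \<le> \<Phi> t - \<Phi> s + e"
    using \<epsilon>e by linarith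
qed

lemma increment_bound_closure:
  fixes E :: "real \<Rightarrow> real"
  assumes E: "continuous_on {0..T} E" and T: "T > 0"
    and b: "\<And>s t. 0 < s \<Longrightarrow> s \<le> t \<Longrightarrow> t < T \<Longrightarrow> \<bar>E t - E s\<bar> \<le> K" and t: "t \<in> {0..T}" and s: "s \<in> {0..T}"
  shows "\<bar>E t - E s\<bar> \<le> K"
proof (rule field_le_epsilon)
  fix e :: real assume e: "e > 0"
  have near: "\<exists>r\<in>{0<..<T}. \<bar>E r - E q\<bar> < e / 2" if q: "q \<in> {0..T}" for q
  proof -
    obtain \<delta> where \<delta>: "\<delta> > 0" "\<And>r. r \<in> {0..T} \<Longrightarrow> dist r q < \<delta> \<Longrightarrow> dist (E r) (E q) < e / 2"
      using E q e unfolding continuous_on_iff by (metis half_gt_zero)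
    obtain r where "r \<in> {0<..<T}" "\<bar>r - q\<bar> < \<delta>"
      using AE_Ioo_dense[where P = "\<lambda>_. True", OF _ T q \<delta>(1)] by auto
    then show ?thesis using \<delta>(2)[of r] by (intro bexI[of _ r]) (auto simp: dist_real_def)
  qed
  obtain t' s' where t': "t' \<in> {0<..<T}" "\<bar>E t' - E t\<bar> < e / 2" and s': "s' \<in> {0<..<T}" "\<bar>E s' - E s\<bar> < e / 2"
    using near[OF t] near[OF s] by blast
  have "\<bar>E t' - E s'\<bar> \<le> K"
    using b[of s' t'] b[of t' s'] t'(1) s'(1) by (cases "s' \<le> t'") (auto simp: abs_minus_commute)
  then show "\<bar>E t - E s\<bar> \<le> K + e" using t'(2) s'(2) by linarith
qed

lemma degenerate_trig_trig:
  assumes "trig_poly f" shows "degenerate trig_poly trig_poly (\<lambda>x y. f (x - y))"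
  using degenerate_trig_mult[OF trig_module_trig_poly trig_module_trig_poly assms
      degenerate.prod[where a = "\<lambda>_. 1" and b = "\<lambda>_. 1"]] by (simp add: trig_poly.const)

lemma degenerate_mult_integrable:
  "degenerate trig_poly trig_poly F \<Longrightarrow> integrable cellM P \<Longrightarrow> integrable cellM R \<Longrightarrow> deg_int (\<lambda>x y. F x y * (P x * R y))"
proof (induction rule: degenerate.induct)
  case (prod a b)
  then have "deg_int (\<lambda>x y. (a x * P x) * (b y * R y))"
    by (intro degenerate.prod trig_poly_mult_integrable)
  then show ?case by (simp add: mult_ac)
next
  case (add F G)
  then show ?case by (simp add: distrib_right degenerate.add)
qed

text \<open>
  By the degenerate form only finitely many scalar functions of time are involved, each uniformly
  continuous, with left factors that are bounded in \<open>x\<close>.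
\<close>

lemma degenerate_weak_continuity:
  fixes r :: "real \<Rightarrow> real^3 \<Rightarrow> real"
  assumes F: "degenerate trig_poly trig_poly F" and int: "\<And>t. t \<in> {0..T} \<Longrightarrow> integrable cellM (r t)"
    and cont: "\<And>b. trig_poly b \<Longrightarrow> continuous_on {0..T} (\<lambda>t. LINT y|cellM. b y * r t y)" and e: "e > 0"
  shows "\<exists>\<delta>>0. \<forall>s\<in>{0..T}. \<forall>t\<in>{0..T}. \<bar>t - s\<bar> < \<delta> \<longrightarrow> (\<forall>x. \<bar>(LINT y|cellM. F x y * r t y) - (LINT y|cellM. F x y * r s y)\<bar> \<le> e)"
  using F e
proof (induction arbitrary: e rule: degenerate.induct)
  case (prod a b)
  obtain B where B: "\<And>x. \<bar>a x\<bar> \<le> B" using trig_poly_bounded[OF prod.hyps(1)] by blast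
  have B0: "0 \<le> B" using B[of 0] by linarith
  have "uniformly_continuous_on {0..T} (\<lambda>t. LINT y|cellM. b y * r t y)"
    by (intro compact_uniformly_continuous cont prod) auto
  moreover have "e / (B + 1) > 0" using prod.prems B0 by simp
  ultimately obtain \<delta> where \<delta>: "\<delta> > 0"
    "\<And>s t. s \<in> {0..T} \<Longrightarrow> t \<in> {0..T} \<Longrightarrow> \<bar>t - s\<bar> < \<delta> \<Longrightarrow> \<bar>(LINT y|cellM. b y * r t y) - (LINT y|cellM. b y * r s y)\<bar> < e / (B + 1)"
    unfolding uniformly_continuous_on_def dist_real_def by blast
  have "\<bar>(LINT y|cellM. a x * b y * r t y) - (LINT y|cellM. a x * b y * r s y)\<bar> \<le> e"
    if "s \<in> {0..T}" "t \<in> {0..T}" "\<bar>t - s\<bar> < \<delta>" for s t x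
  proof -
    have "\<bar>(LINT y|cellM. a x * b y * r t y) - (LINT y|cellM. a x * b y * r s y)\<bar>
        = \<bar>a x\<bar> * \<bar>(LINT y|cellM. b y * r t y) - (LINT y|cellM. b y * r s y)\<bar>"
      by (simp add: mult.assoc right_diff_distrib[symmetric] abs_mult)
    also have "\<dots> \<le> (B + 1) * (e / (B + 1))"
      using \<delta>(2)[OF that] B[of x] B0 by (intro mult_mono) auto
    also have "\<dots> = e" using B0 by simp
    finally show ?thesis .
  qed
  then show ?case using \<delta>(1) by blast
next
  case (add F G)
  have e2: "e / 2 > 0" using add.prems by simp
  obtain \<delta>1 where \<delta>1: "\<delta>1 > 0"
    "\<And>s t x. s \<in> {0..T} \<Longrightarrow> t \<in> {0..T} \<Longrightarrow> \<bar>t - s\<bar> < \<delta>1 \<Longrightarrow> \<bar>(LINT y|cellM. F x y * r t y) - (LINT y|cellM. F x y * r s y)\<bar> \<le> e / 2"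
    using add.IH(1)[OF e2] by blast
  obtain \<delta>2 where \<delta>2: "\<delta>2 > 0"
    "\<And>s t x. s \<in> {0..T} \<Longrightarrow> t \<in> {0..T} \<Longrightarrow> \<bar>t - s\<bar> < \<delta>2 \<Longrightarrow> \<bar>(LINT y|cellM. G x y * r t y) - (LINT y|cellM. G x y * r s y)\<bar> \<le> e / 2"
    using add.IH(2)[OF e2] by blast
  note \<delta> = \<delta>1(1) \<delta>2(1) \<delta>1(2) \<delta>2(2)
  have i: "integrable cellM (\<lambda>y. H x y * r t y)" if "degenerate trig_poly trig_poly H" "t \<in> {0..T}" for H x t
    using deg_int_integrable_inner[OF degenerate_mult_integrable[OF that(1) integrable_const_cell[of 1] int[OF that(2)]]] by simp
  have "\<bar>(LINT y|cellM. (F x y + G x y) * r t y) - (LINT y|cellM. (F x y + G x y) * r s y)\<bar> \<le> e"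
    if st: "s \<in> {0..T}" "t \<in> {0..T}" and d: "\<bar>t - s\<bar> < min \<delta>1 \<delta>2" for s t x
  proof -
    have "(LINT y|cellM. (F x y + G x y) * r q y) = (LINT y|cellM. F x y * r q y) + (LINT y|cellM. G x y * r q y)" if "q \<in> {0..T}" for q
      using i[OF add.hyps(1) that] i[OF add.hyps(2) that] by (simp add: distrib_right)
    note eq = this[OF st(1)] this[OF st(2)]
    have "\<bar>t - s\<bar> < \<delta>1" "\<bar>t - s\<bar> < \<delta>2" using d by simp_all
    then show ?thesis
      unfolding eq using \<delta>(3)[OF st, of x] \<delta>(4)[OF st, of x] by linarith
  qed
  then show ?case using \<delta>(1,2) by (intro exI[of _ "min \<delta>1 \<delta>2"]) auto
qed

lemma degenerate_dbl_continuous: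
  fixes r :: "real \<Rightarrow> real^3 \<Rightarrow> real"
  assumes F: "degenerate trig_poly trig_poly F" and int: "\<And>t. t \<in> S \<Longrightarrow> integrable cellM (r t)"
    and cont: "\<And>b. trig_poly b \<Longrightarrow> continuous_on S (\<lambda>t. LINT y|cellM. b y * r t y)"
  shows "continuous_on S (\<lambda>t. dbl (\<lambda>x y. F x y * (r t x * r t y)))"
  using F
proof (induction rule: degenerate.induct)
  case (prod a b)
  have "dbl (\<lambda>x y. a x * b y * (r t x * r t y)) = (LINT y|cellM. a y * r t y) * (LINT y|cellM. b y * r t y)" for t
    using dbl_prod[of "\<lambda>x. a x * r t x" "\<lambda>x. b x * r t x"] by (simp add: mult_ac)
  then show ?case
    by (simp add: continuous_on_mult cont prod)
next
  case (add F G)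
  have "dbl (\<lambda>x y. (F x y + G x y) * (r t x * r t y)) = dbl (\<lambda>x y. F x y * (r t x * r t y)) + dbl (\<lambda>x y. G x y * (r t x * r t y))"
    if "t \<in> S" for t
    using degenerate_mult_integrable[OF add.hyps(1) int[OF that] int[OF that]]
      degenerate_mult_integrable[OF add.hyps(2) int[OF that] int[OF that]] by (simp add: distrib_right dbl_add)
  then show ?case
    using continuous_on_add[OF add.IH] by (simp cong: continuous_on_cong)
qed

lemma trig_component_L2: "trig_poly b \<Longrightarrow> (\<lambda>y. b y *\<^sub>R axis i 1) \<in> L2_torus"
  using trig_poly_continuous[of b UNIV] trig_poly_periodic[of b]
  by (intro continuous_L2_torus continuous_intros) (auto simp: periodic_def)

context
  fixes T :: real and v0 v w
  assumes T: "T > 0" and sol: "euler_weak_solution T v0 v" and rep: "weakly_continuous_representative T v0 v w"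
begin

lemma rep_L2: "t \<in> {0..T} \<Longrightarrow> w t \<in> L2_torus"
  using rep by (simp add: weakly_continuous_representative_def)

lemma rep_continuous: "g \<in> L2_torus \<Longrightarrow> continuous_on {0..T} (\<lambda>t. L2_inner (w t) g)"
  using rep by (simp add: weakly_continuous_representative_def)

lemma rep_component_continuous:
  assumes "trig_poly b" shows "continuous_on {0..T} (\<lambda>t. LINT y|cellM. b y * w t y $ i)"
  using rep_continuous[OF trig_component_L2[OF assms, of i]]
  by (simp add: L2_inner_def inner_axis mult.commute)

lemma rep_energy_continuous: "continuous_on {0..T} (\<lambda>t. energy m (w t))"
  unfolding energy_def
  by (intro continuous_on_sum degenerate_dbl_continuous degenerate_trig_trig trig_poly_kern rep_component_continuous
      L2_torus_integrable rep_L2)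

lemma rep_conv_equicontinuous:
  assumes "e > 0"
  shows "\<exists>\<delta>>0. \<forall>s\<in>{0..T}. \<forall>t\<in>{0..T}. \<bar>t - s\<bar> < \<delta> \<longrightarrow>
    (\<forall>i j x. \<bar>conv (dkern m j) (\<lambda>y. w t y $ i) x - conv (dkern m j) (\<lambda>y. w s y $ i) x\<bar> \<le> e)"
proof -
  define P where "P i j \<delta> \<longleftrightarrow> \<delta> > 0 \<and> (\<forall>s\<in>{0..T}. \<forall>t\<in>{0..T}. \<bar>t - s\<bar> < \<delta> \<longrightarrow>
    (\<forall>x. \<bar>conv (dkern m j) (\<lambda>y. w t y $ i) x - conv (dkern m j) (\<lambda>y. w s y $ i) x\<bar> \<le> e))" for i j and \<delta> :: real
  have "\<exists>\<delta>. P i j \<delta>" for i j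
    unfolding conv_def P_def
    by (rule degenerate_weak_continuity[OF degenerate_trig_trig[OF trig_poly_dkern]
          L2_torus_integrable[OF rep_L2] rep_component_continuous assms])
  from someI_ex[OF this] have some: "P i j (SOME \<delta>. P i j \<delta>)" for i j .
  define d where "d i j = (SOME \<delta>. P i j \<delta>)" for i j
  have d: "P i j (d i j)" for i j
    unfolding d_def by (rule some)
  let ?D = "range (\<lambda>(i, j). d i j)"
  have "Min ?D > 0" using d by (subst Min_gr_iff) (auto simp: P_def)
  moreover have "Min ?D \<le> d i j" for i j
    by (rule Min_le) (auto intro: rev_image_eqI[of "(i, j)"])
  then have "\<bar>conv (dkern m j) (\<lambda>y. w t y $ i) x - conv (dkern m j) (\<lambda>y. w s y $ i) x\<bar> \<le> e"
    if "s \<in> {0..T}" "t \<in> {0..T}" "\<bar>t - s\<bar> < Min ?D" for s t i j x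
    using d[of i j] that less_le_trans unfolding P_def by blast
  ultimately show ?thesis by blast
qed

text \<open>
  The divergence of the mollification is continuous in time by weak continuity, and it vanishes at
  almost every time because \<open>v(t)\<close> belongs to \<open>H\<close>.
\<close>

lemma rep_weakly_solenoidal:
  assumes t: "t \<in> {0..T}" shows "weakly_solenoidal m (w t)"
  unfolding weakly_solenoidal_def
proof
  fix x
  let ?g = "\<lambda>t. \<Sum>j\<in>UNIV. conv (dkern m j) (\<lambda>y. w t y $ j) x"
  have "continuous_on {0..T} ?g"
    unfolding conv_def
    by (intro continuous_on_sum rep_component_continuous trig_poly_reflect_shift trig_poly_dkern)
  moreover have "AE t in lebesgue_on {0<..<T}. ?g t = 0"
    using weak_representative_AE[OF sol rep]
  proof eventually_elim
    case (elim t)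
    then have "conv (dkern m j) (\<lambda>y. w t y $ j) x = conv (dkern m j) (\<lambda>y. v t y $ j) x" for j
      using conv_cong_AE[OF _ _ H_space_L2 trig_poly_dkern] by blast
    then show ?case using elim H_space_conv_dkern by simp
  qed
  ultimately show "?g t = 0"
    by (rule continuous_AE_zero[OF _ T _ t])
qed

text \<open>
  For a symmetric bilinear form \<open>B\<close>, \<open>B(b, b) - B(a, a) = B(b, a + b) - B(a, a + b)\<close>.  So the increment of
  the quadratic energy is an increment of a linear functional, with the fixed test field obtained by
  mollifying \<open>w t + w s\<close>.
\<close>

lemma energy_increment:
  assumes st: "0 < s" "s \<le> t" "t < T"
  shows "energy m (w t) - energy m (w s)
    = (LINT \<tau>|lebesgue_on {0<..<T}. indicator {s..<t} \<tau> * stress m (\<lambda>x. w t x + w s x) (v \<tau>))"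
proof -
  have L: "w t \<in> L2_torus" "w s \<in> L2_torus" using rep_L2 st by auto
  let ?a = "\<lambda>x. w t x + w s x"
  have "weakly_solenoidal m ?a"
  proof -
    have "conv (dkern m j) (\<lambda>y. ?a y $ j) x = conv (dkern m j) (\<lambda>y. w t y $ j) x + conv (dkern m j) (\<lambda>y. w s y $ j) x" for j x
      using conv_add[OF trig_poly_dkern L2_torus_integrable[OF L(1)] L2_torus_integrable[OF L(2)]] by simp
    then show ?thesis
      using rep_weakly_solenoidal[of t m] rep_weakly_solenoidal[of s m] st
      by (simp add: weakly_solenoidal_def sum.distrib)
  qed
  from mollified_increment[OF sol rep L2_torus_add[OF L] this st]
  have "L2_inner (w t) (mollified m ?a) - L2_inner (w s) (mollified m ?a)
    = (LINT \<tau>|lebesgue_on {0<..<T}. indicator {s..<t} \<tau> * stress m ?a (v \<tau>))" .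
  moreover have "L2_inner (w t) (mollified m ?a) - L2_inner (w s) (mollified m ?a) = energy m (w t) - energy m (w s)"
    using L2_inner_mollified_sym[OF L, of m] L
    by (simp add: L2_inner_mollified_add L2_inner_mollified_self)
  ultimately show ?thesis by simp
qed

text \<open>
  Over a short interval \<open>[s, t)\<close> the frozen field \<open>w t + w s\<close> is, after mollification, uniformly close
  to \<open>2 w \<tau>\<close> together with its gradient, so the integrand of \<open>energy_increment\<close> is within \<open>\<epsilon>\<close> of twice
  the flux at time \<open>\<tau>\<close>.  Subdividing removes the error.
\<close>

lemma energy_variation_bound:
  fixes b :: "real \<Rightarrow> real"
  assumes b: "integrable (lebesgue_on {0<..<T}) b"
    and fl: "AE \<tau> in lebesgue_on {0<..<T}. 2 * \<bar>flux m (v \<tau>)\<bar> \<le> b \<tau>"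
    and t: "t \<in> {0..T}" and s: "s \<in> {0..T}"
  shows "\<bar>energy m (w t) - energy m (w s)\<bar> \<le> (LINT \<tau>|lebesgue_on {0<..<T}. \<bar>b \<tau>\<bar>)"
proof (rule increment_bound_closure[OF rep_energy_continuous T _ t s])
  let ?M = "lebesgue_on {0<..<T}"
  define \<Phi> where "\<Phi> r = (LINT \<tau>|?M. indicator {..<r} \<tau> * \<bar>b \<tau>\<bar>)" for r
  note ind = integrable_indicator_times
  have babs: "integrable ?M (\<lambda>\<tau>. \<bar>b \<tau>\<bar>)" using b by simp
  have \<Phi>_diff: "\<Phi> t - \<Phi> s = (LINT \<tau>|?M. indicator {s..<t} \<tau> * \<bar>b \<tau>\<bar>)" if "s \<le> t" for s t
  proof -
    have "\<Phi> t - \<Phi> s = (LINT \<tau>|?M. indicator {..<t} \<tau> * \<bar>b \<tau>\<bar> - indicator {..<s} \<tau> * \<bar>b \<tau>\<bar>)"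
      unfolding \<Phi>_def by (rule Bochner_Integration.integral_diff[symmetric]) (auto intro: ind babs)
    also have "\<dots> = (LINT \<tau>|?M. indicator {s..<t} \<tau> * \<bar>b \<tau>\<bar>)"
      using that by (intro Bochner_Integration.integral_cong refl) (auto simp: indicator_def)
    finally show ?thesis .
  qed
  obtain C where C: "AE t in ?M. v t \<in> H_space \<and> L2_norm (v t) \<le> C"
    using sol unfolding euler_weak_solution_def Linf_H_def by blast
  have step: "\<exists>\<delta>>0. \<forall>s t. 0 < s \<longrightarrow> s \<le> t \<longrightarrow> t < T \<longrightarrow> t - s < \<delta> \<longrightarrow>
      \<bar>energy m (w t) - energy m (w s)\<bar> \<le> \<Phi> t - \<Phi> s + \<epsilon> * (t - s)" if \<epsilon>: "\<epsilon> > 0" for \<epsilon>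
  proof -
    define e where "e = \<epsilon> / (18 * C\<^sup>2 + 1)"
    have C1: "18 * C\<^sup>2 + 1 > 0" by (simp add: add_nonneg_pos)
    then have e: "e > 0" using \<epsilon> by (simp add: e_def)
    have eC: "18 * e * C\<^sup>2 \<le> \<epsilon>"
    proof -
      have "e * (18 * C\<^sup>2) \<le> e * (18 * C\<^sup>2 + 1)"
        using e by (intro mult_left_mono) auto
      also have "\<dots> = \<epsilon>"
        using C1 by (simp add: e_def)
      finally show ?thesis by (simp add: mult_ac)
    qed
    obtain \<delta> where \<delta>: "\<delta> > 0" "\<And>s t i j x. s \<in> {0..T} \<Longrightarrow> t \<in> {0..T} \<Longrightarrow> \<bar>t - s\<bar> < \<delta> \<Longrightarrow>
        \<bar>conv (dkern m j) (\<lambda>y. w t y $ i) x - conv (dkern m j) (\<lambda>y. w s y $ i) x\<bar> \<le> e"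
      using rep_conv_equicontinuous[OF e] by blast
    have "\<bar>energy m (w t) - energy m (w s)\<bar> \<le> \<Phi> t - \<Phi> s + \<epsilon> * (t - s)"
      if st: "0 < s" "s \<le> t" "t < T" and d: "t - s < \<delta>" for s t
    proof -
      have L: "w t \<in> L2_torus" "w s \<in> L2_torus" using rep_L2 st by auto
      let ?a = "\<lambda>x. w t x + w s x"
      \<comment> \<open>The cost of replacing the field at an end point by the field at an intermediate time.\<close>
      have near: "\<bar>stress m (\<lambda>x. w q x - w \<tau> x) (v \<tau>)\<bar> \<le> 9 * e * C\<^sup>2"
        if q: "q \<in> {s..t}" and \<tau>: "\<tau> \<in> {s..<t}" and v: "v \<tau> \<in> H_space" "L2_norm (v \<tau>) \<le> C" for q \<tau>
      proof -
        have qT: "q \<in> {0..T}" "\<tau> \<in> {0..T}" "\<bar>q - \<tau>\<bar> < \<delta>" using q \<tau> st d by auto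
        have "\<bar>stress m (\<lambda>x. w q x - w \<tau> x) (v \<tau>)\<bar> \<le> 9 * e * (L2_norm (v \<tau>))\<^sup>2"
        proof (rule stress_bound)
          show "(\<lambda>x. w q x - w \<tau> x) \<in> L2_torus" by (intro L2_torus_diff rep_L2 qT)
          show "v \<tau> \<in> L2_torus" by (rule H_space_L2[OF v(1)])
          show "\<bar>conv (dkern m j) (\<lambda>y. (w q y - w \<tau> y) $ i) x\<bar> \<le> e" for i j x
            using \<delta>(2)[OF qT(2,1,3)] conv_diff[OF trig_poly_dkern L2_torus_integrable[OF rep_L2[OF qT(1)]]
                L2_torus_integrable[OF rep_L2[OF qT(2)]]] by simp
        qed
        also have "\<dots> \<le> 9 * e * C\<^sup>2"
          using e v by (intro mult_left_mono power_mono) auto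
        finally show ?thesis .
      qed
      have ptw: "AE \<tau> in ?M. \<bar>indicator {s..<t} \<tau> * stress m ?a (v \<tau>)\<bar> \<le> indicator {s..<t} \<tau> * \<bar>b \<tau>\<bar> + \<epsilon> * indicator {s..<t} \<tau>"
        using weak_representative_AE[OF sol rep] C fl
      proof eventually_elim
        case (elim \<tau>)
        show ?case
        proof (cases "\<tau> \<in> {s..<t}")
          case True
          have vL: "v \<tau> \<in> L2_torus" using elim H_space_L2 by blast
          have wL: "w \<tau> \<in> L2_torus" using elim by blast
          have "stress m (w \<tau>) (v \<tau>) = stress m (v \<tau>) (v \<tau>)"
            using conv_cong_AE[OF _ wL vL trig_poly_dkern] elim by (simp add: stress_def)
          then have fx: "stress m (w \<tau>) (v \<tau>) = flux m (v \<tau>)"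
            using stress_flux[OF vL] by simp
          have "stress m ?a (v \<tau>) = stress m (\<lambda>x. w t x - w \<tau> x) (v \<tau>) + stress m (\<lambda>x. w s x - w \<tau> x) (v \<tau>) + 2 * flux m (v \<tau>)"
            using stress_add[OF L vL, of m] stress_diff[OF L(1) wL vL, of m] stress_diff[OF L(2) wL vL, of m] fx by simp
          moreover have "\<bar>stress m (\<lambda>x. w t x - w \<tau> x) (v \<tau>)\<bar> \<le> 9 * e * C\<^sup>2" "\<bar>stress m (\<lambda>x. w s x - w \<tau> x) (v \<tau>)\<bar> \<le> 9 * e * C\<^sup>2"
            using elim True st by (auto intro!: near)
          ultimately have "\<bar>stress m ?a (v \<tau>)\<bar> \<le> \<bar>b \<tau>\<bar> + \<epsilon>"
            using eC elim by linarith
          then show ?thesis using True by simp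
        qed simp
      qed
      have c1: "integrable ?M (\<lambda>\<tau>. 1 :: real)"
        using finite_measure.integrable_const[OF finite_measure_Ioo] .
      have i1: "integrable ?M (indicator {s..<t} :: real \<Rightarrow> real)"
        using ind[OF c1, of "{s..<t}"] by simp
      have i2: "integrable ?M (\<lambda>\<tau>. indicator {s..<t} \<tau> * \<bar>b \<tau>\<bar>)"
        by (intro ind babs) simp
      have i3: "integrable ?M (\<lambda>\<tau>. indicator {s..<t} \<tau> * stress m ?a (v \<tau>))"
        by (intro ind stress_integrable[OF sol] L2_torus_add L) simp
      have "\<bar>energy m (w t) - energy m (w s)\<bar> \<le> (LINT \<tau>|?M. \<bar>indicator {s..<t} \<tau> * stress m ?a (v \<tau>)\<bar>)"
        unfolding energy_increment[OF st] by (rule integral_abs_bound)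
      also have "\<dots> \<le> (LINT \<tau>|?M. indicator {s..<t} \<tau> * \<bar>b \<tau>\<bar> + \<epsilon> * indicator {s..<t} \<tau>)"
        by (rule integral_mono_AE[OF Bochner_Integration.integrable_abs[OF i3] _ ptw])
           (intro Bochner_Integration.integrable_add i2 integrable_mult_right i1)
      also have "\<dots> = (\<Phi> t - \<Phi> s) + \<epsilon> * (LINT \<tau>|?M. indicator {s..<t} \<tau>)"
        using i1 i2 by (simp add: \<Phi>_diff[OF st(2)])
      also have "(LINT \<tau>|?M. indicator {s..<t} \<tau>) = t - s"
      proof -
        have "(LINT \<tau>|?M. indicator {s..<t} \<tau>) = measure ?M {s..<t}"
          using st by (subst Bochner_Integration.integral_indicator) (auto intro!: arg_cong[of _ _ "measure ?M"])
        also have "\<dots> = t - s"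
          using st by (subst measure_restrict_space) auto
        finally show ?thesis .
      qed
      finally show ?thesis .
    qed
    then show ?thesis using \<delta>(1) by blast
  qed
  fix s t :: real assume st: "0 < s" "s \<le> t" "t < T"
  have "\<bar>energy m (w t) - energy m (w s)\<bar> \<le> \<Phi> t - \<Phi> s"
    by (rule increment_bound_chain[OF step st])
  also have "\<dots> \<le> (LINT \<tau>|?M. \<bar>b \<tau>\<bar>)"
    unfolding \<Phi>_diff[OF st(2)] by (intro integral_mono ind babs) (auto simp: indicator_def)
  finally show "\<bar>energy m (w t) - energy m (w s)\<bar> \<le> (LINT \<tau>|?M. \<bar>b \<tau>\<bar>)" .
qed

end

text \<open>
  At scale \<open>m\<close> the energy varies by at most the time integral of twice the flux; \<open>flux_bound\<close> makes this
  as small as desired, since \<open>f\<^sup>1\<^sup>/\<^sup>\<alpha>\<close> is integrable and \<open>\<parallel>v(t)\<parallel>\<close> is essentially bounded.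
\<close>

lemma energy_scale_limit:
  fixes T \<alpha> :: real and \<omega> :: "real \<Rightarrow> real"
  assumes T: "T > 0" and \<alpha>: "1 / 3 \<le> \<alpha>" "\<alpha> \<le> 1"
    and nn: "\<And>s. s > 0 \<Longrightarrow> \<omega> s \<ge> 0" and mono: "mono_on {0<..} \<omega>" and lim: "(\<omega> \<longlongrightarrow> 0) (at_right 0)"
    and v0: "v0 \<in> H_space" and sol: "euler_weak_solution T v0 v" and hol: "Lp_Holder (1 / \<alpha>) T \<omega> \<alpha> v"
    and rep: "weakly_continuous_representative T v0 v w" and t: "t \<in> {0..T}"
  shows "(\<lambda>m. energy m (w t)) \<longlonglongrightarrow> (L2_norm v0)\<^sup>2"
proof -
  let ?M = "lebesgue_on {0<..<T}"
  have T0: "0 \<in> {0..T}" using T by simp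
  have w0: "energy m (w 0) = energy m v0" for m
    using rep rep_L2[OF T sol rep T0] H_space_L2[OF v0]
    by (intro energy_cong_AE) (auto simp: weakly_continuous_representative_def)
  obtain f where f: "\<And>t. t \<in> {0..T} \<Longrightarrow> 0 \<le> f t"
    and fae: "AE t in lebesgue_on {0..T}. \<forall>x y. norm (v t x - v t y) \<le> f t * \<omega> (norm (x - y)) * norm (x - y) powr \<alpha>"
    and fint: "integrable (lebesgue_on {0..T}) (\<lambda>t. f t powr (1 / \<alpha>))"
    using hol unfolding Lp_Holder_def by blast
  have fint': "integrable ?M (\<lambda>t. f t powr (1 / \<alpha>))"
    by (rule integrable_lebesgue_on_subset[OF fint]) auto
  have "AE t in lebesgue. t \<in> {0..T} \<longrightarrow> (\<forall>x y. norm (v t x - v t y) \<le> f t * \<omega> (norm (x - y)) * norm (x - y) powr \<alpha>)"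
    using fae by (simp add: AE_restrict_space_iff)
  then have "AE t in lebesgue. t \<in> {0<..<T} \<longrightarrow>
      0 \<le> f t \<and> (\<forall>x y. norm (v t x - v t y) \<le> f t * \<omega> (norm (x - y)) * norm (x - y) powr \<alpha>)"
    by eventually_elim (use f in auto)
  then have fae': "AE t in ?M. 0 \<le> f t \<and> (\<forall>x y. norm (v t x - v t y) \<le> f t * \<omega> (norm (x - y)) * norm (x - y) powr \<alpha>)"
    by (subst AE_restrict_space_iff) simp_all
  obtain C where C: "AE t in ?M. v t \<in> H_space \<and> L2_norm (v t) \<le> C"
    using sol unfolding euler_weak_solution_def Linf_H_def by blast
  define V where "V = cell_volume + 4 * C\<^sup>2"
  define I where "I = (LINT t|?M. f t powr (1 / \<alpha>))"
  have V: "0 \<le> V" using cell_volume_nonneg by (simp add: V_def)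
  have I: "0 \<le> I" unfolding I_def by (rule integral_nonneg_AE) auto
  have "(\<lambda>m. energy m (w t) - energy m (w 0)) \<longlonglongrightarrow> 0"
  proof (rule LIMSEQ_I)
    fix r :: real assume r: "r > 0"
    define \<epsilon> where "\<epsilon> = r / (2 * V * I + 1)"
    have VI: "0 \<le> 2 * V * I" using V I by simp
    have \<epsilon>: "\<epsilon> > 0" unfolding \<epsilon>_def by (rule divide_pos_pos[OF r]) (use VI in linarith)
    have \<epsilon>r: "2 * \<epsilon> * V * I < r"
    proof -
      have "\<epsilon> * (2 * V * I) < \<epsilon> * (2 * V * I + 1)"
        using \<epsilon> by (intro mult_strict_left_mono) auto
      also have "\<dots> = r"
      proof -
        have "2 * V * I + 1 \<noteq> 0" using VI by linarith
        then show ?thesis unfolding \<epsilon>_def by (rule nonzero_eq_divide_eq[THEN iffD1, OF _ refl])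
      qed
      finally show ?thesis by (simp add: mult_ac)
    qed
    obtain N where N: "\<And>m u F. m \<ge> N \<Longrightarrow> u \<in> H_space \<Longrightarrow> 0 \<le> F \<Longrightarrow>
        (\<forall>x y. norm (u x - u y) \<le> F * \<omega> (norm (x - y)) * norm (x - y) powr \<alpha>) \<Longrightarrow>
        \<bar>flux m u\<bar> \<le> \<epsilon> * F powr (1 / \<alpha>) * (cell_volume + 4 * (L2_norm u)\<^sup>2)"
      using flux_bound[OF \<alpha> nn mono lim \<epsilon>] by blast
    have "norm (energy m (w t) - energy m (w 0) - 0) < r" if m: "m \<ge> N" for m
    proof -
      let ?b = "\<lambda>t. 2 * \<epsilon> * V * f t powr (1 / \<alpha>)"
      have "AE t in ?M. 2 * \<bar>flux m (v t)\<bar> \<le> ?b t"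
        using C fae'
      proof eventually_elim
        case (elim t)
        have "\<bar>flux m (v t)\<bar> \<le> \<epsilon> * f t powr (1 / \<alpha>) * (cell_volume + 4 * (L2_norm (v t))\<^sup>2)"
          using elim by (intro N[OF m]) auto
        also have "\<dots> \<le> \<epsilon> * f t powr (1 / \<alpha>) * V"
          using elim \<epsilon> unfolding V_def by (intro mult_left_mono add_left_mono power_mono) auto
        finally show ?case by (simp add: mult_ac)
      qed
      then have "\<bar>energy m (w t) - energy m (w 0)\<bar> \<le> (LINT t|?M. \<bar>?b t\<bar>)"
        using fint' by (intro energy_variation_bound[OF T sol rep _ _ t T0]) auto
      also have "\<dots> = 2 * \<epsilon> * V * I"
        using \<epsilon> V by (simp add: I_def abs_mult)
      also have "\<dots> < r" by (rule \<epsilon>r)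
      finally show ?thesis by simp
    qed
    then show "\<exists>no. \<forall>n\<ge>no. norm (energy n (w t) - energy n (w 0) - 0) < r" by blast
  qed
  from tendsto_add[OF this energy_tendsto[OF v0]] show ?thesis
    by (simp add: w0)
qed

theorem theorem4p2:
  fixes T \<alpha> :: real and \<omega> :: "real \<Rightarrow> real"
    and v0 :: "real^3 \<Rightarrow> real^3" and v w :: "real \<Rightarrow> real^3 \<Rightarrow> real^3"
  assumes "T > 0"
    and "1 / 3 \<le> \<alpha>" and "\<alpha> \<le> 1"
    and "\<And>s. s > 0 \<Longrightarrow> \<omega> s \<ge> 0"
    and "mono_on {0<..} \<omega>"
    and "(\<omega> \<longlongrightarrow> 0) (at_right 0)"
    and "v0 \<in> H_space"
    and "euler_weak_solution T v0 v"
    and "Lp_Holder (1 / \<alpha>) T \<omega> \<alpha> v"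
    and "weakly_continuous_representative T v0 v w"
  shows "\<forall>t\<in>{0..T}. L2_norm (w t) = L2_norm v0"
proof
  note T = assms(1) and sol = assms(8) and rep = assms(10)
  have limit: "(\<lambda>m. energy m (w t)) \<longlonglongrightarrow> (L2_norm v0)\<^sup>2" if "t \<in> {0..T}" for t
    by (rule energy_scale_limit[OF assms that])
  have L2: "w t \<in> L2_torus" if "t \<in> {0..T}" for t
    by (rule rep_L2[OF T sol rep that])
  fix t assume t: "t \<in> {0..T}"
  \<comment> \<open>Energies at finite scales are at most the full energy, so none is created in the limit.\<close>
  have ge: "(L2_norm v0)\<^sup>2 \<le> (L2_norm (w t))\<^sup>2"
    by (rule LIMSEQ_le_const2[OF limit[OF t]]) (auto intro: energy_le L2[OF t])
  \<comment> \<open>At almost every time \<open>w s\<close> agrees with a member of \<open>H\<close>, where the energies converge.\<close>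
  have ae: "AE s in lebesgue_on {0<..<T}. (L2_norm (w s))\<^sup>2 = (L2_norm v0)\<^sup>2"
  proof -
    have "AE s in lebesgue_on {0<..<T}. s \<in> {0<..<T}"
      by (rule AE_I2) simp
    with weak_representative_AE[OF sol rep] show ?thesis
    proof eventually_elim
      case (elim s)
      then have s: "s \<in> {0..T}" and vH: "v s \<in> H_space" and wv: "AE x in lebesgue. w s x = v s x" by auto
      have vL: "v s \<in> L2_torus" by (rule H_space_L2[OF vH])
      have "energy m (w s) = energy m (v s)" for m
        by (rule energy_cong_AE[OF wv L2[OF s] vL])
      then have "(\<lambda>m. energy m (w s)) \<longlonglongrightarrow> (L2_norm (v s))\<^sup>2"
        using energy_tendsto[OF vH] by simp
      then have "(L2_norm (v s))\<^sup>2 = (L2_norm v0)\<^sup>2"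
        using limit[OF s] by (rule LIMSEQ_unique)
      moreover have "L2_norm (w s) = L2_norm (v s)"
        unfolding L2_norm_def using L2_inner_cong_AE[OF wv wv L2[OF s] vL L2[OF s] vL] by simp
      ultimately show ?case by simp
    qed
  qed
  \<comment> \<open>Weak lower semicontinuity of the norm at \<open>t\<close>, along times \<open>s\<close> of the previous kind.\<close>
  let ?g = "\<lambda>s. L2_inner (w s) (w t)"
  let ?c = "((L2_norm v0)\<^sup>2 + (L2_norm (w t))\<^sup>2) / 2"
  have gg: "?g t = (L2_norm (w t))\<^sup>2"
    by (simp add: L2_norm_power2 L2_inner_def power2_norm_eq_inner)
  have pair: "?g s \<le> ((L2_norm (w s))\<^sup>2 + (L2_norm (w t))\<^sup>2) / 2" if s: "s \<in> {0..T}" for s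
  proof -
    have "?g s \<le> (LINT x|cellM. ((norm (w s x))\<^sup>2 + (norm (w t x))\<^sup>2) / 2)"
      unfolding L2_inner_def
    proof (rule integral_mono)
      show "integrable cellM (\<lambda>x. w s x \<bullet> w t x)"
        by (rule L2_inner_integrable[OF L2[OF s] L2[OF t]])
      show "integrable cellM (\<lambda>x. ((norm (w s x))\<^sup>2 + (norm (w t x))\<^sup>2) / 2)"
        using L2_torus_integrable_norm2[OF L2[OF s]] L2_torus_integrable_norm2[OF L2[OF t]] by simp
      fix x
      have "0 \<le> (w s x - w t x) \<bullet> (w s x - w t x)" by simp
      then show "w s x \<bullet> w t x \<le> ((norm (w s x))\<^sup>2 + (norm (w t x))\<^sup>2) / 2"
        by (simp add: power2_norm_eq_inner inner_diff_left inner_diff_right inner_commute)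
    qed
    also have "\<dots> = ((L2_norm (w s))\<^sup>2 + (L2_norm (w t))\<^sup>2) / 2"
      using L2_torus_integrable_norm2[OF L2[OF s]] L2_torus_integrable_norm2[OF L2[OF t]]
      by (simp add: L2_norm_power2)
    finally show ?thesis .
  qed
  have "?g t \<le> ?c + e" if e: "e > 0" for e
  proof -
    have "continuous_on {0..T} ?g"
      by (rule rep_continuous[OF T sol rep L2[OF t]])
    then obtain \<delta> where \<delta>: "\<delta> > 0" "\<And>s. s \<in> {0..T} \<Longrightarrow> dist s t < \<delta> \<Longrightarrow> dist (?g s) (?g t) < e"
      using t e unfolding continuous_on_iff by blast
    obtain s where s: "s \<in> {0<..<T}" "\<bar>s - t\<bar> < \<delta>" "(L2_norm (w s))\<^sup>2 = (L2_norm v0)\<^sup>2"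
      using AE_Ioo_dense[OF ae T t \<delta>(1)] by blast
    then have "s \<in> {0..T}" "dist s t < \<delta>" by (auto simp: dist_real_def)
    from \<delta>(2)[OF this] pair[OF this(1)] show ?thesis
      unfolding s(3) dist_real_def by linarith
  qed
  then have "?g t \<le> ?c" by (rule field_le_epsilon)
  then have "(L2_norm (w t))\<^sup>2 \<le> (L2_norm v0)\<^sup>2"
    unfolding gg by simp
  with ge have "(L2_norm (w t))\<^sup>2 = (L2_norm v0)\<^sup>2" by simp
  then show "L2_norm (w t) = L2_norm v0"
    by (rule power2_eq_imp_eq) auto
qed

end
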